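(* Let $(G,\rho,V)$ be a reductive prehomogeneous vector space over $\mathbb{C}$ with basic relative invariants $P_1,\dots,P_r$ ($r\geq1$), and let $d_k,c_k,\mu_i,\alpha_i,z_{ij}$ be the data attached to its $b$-functions as described in the context. Let $$Z_{\mathbb{C}}(s)=\int_V|P_1(x)|_{\mathbb{C}}^{s_1}\cdots|P_r(x)|_{\mathbb{C}}^{s_r}\exp(-2\pi x\,{}^t\bar x)\,dx,$$ which converges and is holomorphic for $s=(s_1,\dots,s_r)\in\mathbb{C}^r$ with $\mathrm{Re}(s_1),\dots,\mathrm{Re}(s_r)>0$, where $|z|_{\mathbb{C}}=z\bar z$ and $dx$ is the Haar measure on $V$ normalized so that $\int_V\exp(-2\pi x\,{}^t\bar x)dx=1$. Then $Z_{\mathbb{C}}(s)$ has a meromorphic continuation to $\mathbb{C}^r$, and $$Z_{\mathbb{C}}(s)=\prod_{k=1}^r\big((2\pi)^{-d_k}c_k\big)^{s_k}\prod_{i=1}^l\prod_j\left(\frac{\Gamma(\mu_i(s)+\alpha_i+j)}{\Gamma(\alpha_i+j)}\right)^{z_{ij}}.$$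
   Context: $G$ is a connected reductive linear algebraic group over $\mathbb{C}$, $V$ an $n$-dimensional complex vector space, $\rho$ a rational representation such that $V\setminus S$ is a single $G$-orbit for some proper algebraic subset $S$. $S_0$ is the union of the codimension-one irreducible components of $S$, assumed nonempty. A basis of $V$ is fixed for which $\rho(G)$ is self-adjoint (stable under conjugate transpose; it exists by Mostow); by it $V=\mathbb{C}^n$ and $\mathbb{C}[V]=\mathbb{C}[x_1,\dots,x_n]$. $P_1,\dots,P_r\in\mathbb{C}[x]$ are irreducible polynomials defining the irreducible components of $S_0$; they are homogeneous relative invariants, called the basic relative invariants. $d_k=\deg P_k$. $\bar P_k$ is obtained from $P_k$ by complex conjugating coefficients, and $\mathrm{grad}_x=(\partial/\partial x_1,\dots,\partial/\partial x_n)$. The $b$-functions $b_m(s)\in\mathbb{C}[s_1,\dots,s_r]$, $m=(m_1,\dots,m_r)\in\mathbb{Z}_{\ge0}^r$, are the polynomials with $$\bar P_1(\mathrm{grad}_x)^{m_1}\cdots\bar P_r(\mathrm{grad}_x)^{m_r}\big(P_1(x)^{s_1+m_1}\cdots P_r(x)^{s_r+m_r}\big)=b_m(s)P_1(x)^{s_1}\cdots P_r(x)^{s_r}.$$ By the Ore–Sato theorem they can be written, for all $0\ne m\in\mathbb{Z}_{\ge0}^r$, as $$b_m(s)=c_1^{m_1}\cdots c_r^{m_r}\prod_{i=1}^l\prod_j\prod_{\nu=0}^{\mu_i(m)-1}(\mu_i(s)+\alpha_i+j+\nu)^{z_{ij}},$$ where: $c_k\in\mathbb{R}_{>0}$; each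 $\mu_i(s)=\sum_k\mu_{ik}s_k$ is a nonzero linear form with non-negative integer coefficients whose nonzero coefficients have greatest common divisor $1$; $\alpha_i\in\mathbb{C}$; for each $i$, $z_{ij}\in\mathbb{Z}$ ($j\in\mathbb{Z}$) with only finitely many nonzero, $\sum_jz_{ij}>0$, and $z_{ij}>0$ for the smallest and for the largest $j$ with $z_{ij}\neq0$; the polynomials $\mu_i(s)+\alpha_i$ ($i=1,\dots,l$) are not carried to one another by translations $s\mapsto s+m$, $m\in\mathbb{Z}^r$. Such an expression is fixed. It is known (Kashiwara) that each $\alpha_i+j$ with $z_{ij}>0$ is a positive rational number. *)

theory Defs
  imports "HOL-Complex_Analysis.Complex_Analysis" "HOL-Library.Poly_Mapping"
begin

section \<open>Polynomials in finitely many variables\<close>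

text \<open>
  The ring of complex polynomials in variables indexed by a finite type \<open>'v\<close>, as the monoid algebra
  of the exponent vectors; its ring structure is that of \<^theory>\<open>HOL-Library.Poly_Mapping\<close>.
\<close>

type_synonym 'v cpoly = "('v \<Rightarrow>\<^sub>0 nat) \<Rightarrow>\<^sub>0 complex"

definition peval :: "'v::finite cpoly \<Rightarrow> ('v \<Rightarrow> complex) \<Rightarrow> complex" where
  "peval p a = (\<Sum>e\<in>Poly_Mapping.keys p.
     Poly_Mapping.lookup p e * (\<Prod>v\<in>UNIV. a v ^ Poly_Mapping.lookup e v))"

definition mdeg :: "('v::finite \<Rightarrow>\<^sub>0 nat) \<Rightarrow> nat" where
  "mdeg e = (\<Sum>v\<in>UNIV. Poly_Mapping.lookup e v)"

definition tdeg :: "'v::finite cpoly \<Rightarrow> nat" where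
  "tdeg p = Max (insert 0 (mdeg ` Poly_Mapping.keys p))"

definition homogeneous_poly :: "'v::finite cpoly \<Rightarrow> bool" where
  "homogeneous_poly p \<longleftrightarrow> (\<forall>e\<in>Poly_Mapping.keys p. mdeg e = tdeg p)"

definition cnj_poly :: "'v cpoly \<Rightarrow> 'v cpoly" where
  "cnj_poly p = Poly_Mapping.map cnj p"


section \<open>Holomorphic and meromorphic functions of several variables\<close>

text \<open>Complex (Frechet) differentiability at every point; used for open sets only.\<close>

definition holomorphic_sv_on :: "(complex^'v \<Rightarrow> complex) \<Rightarrow> (complex^'v) set \<Rightarrow> bool" where
  "holomorphic_sv_on f A \<longleftrightarrow>
     (\<forall>x\<in>A. \<exists>D. (f has_derivative D) (at x) \<and> (\<forall>c v. D (c *s v) = c * D v))"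

text \<open>
  Locally a quotient \<open>g / h\<close> of holomorphic functions with \<open>h\<close> not identically zero on a connected
  neighbourhood. A meromorphic function is represented by a total function; its values where
  \<open>h\<close> vanishes are not constrained.
\<close>

definition meromorphic_sv :: "(complex^'v \<Rightarrow> complex) \<Rightarrow> bool" where
  "meromorphic_sv F \<longleftrightarrow>
     (\<forall>a. \<exists>W g h. open W \<and> connected W \<and> a \<in> W \<and>
        holomorphic_sv_on g W \<and> holomorphic_sv_on h W \<and> (\<exists>w\<in>W. h w \<noteq> 0) \<and>
        (\<forall>w\<in>W. h w \<noteq> 0 \<longrightarrow> F w = g w / h w))"


section \<open>Zariski topology on the space of vectors\<close>

definition zero_locus :: "'n::finite cpoly set \<Rightarrow> (complex^'n) set" where
  "zero_locus I = {x. \<forall>p\<in>I. peval p (($) x) = 0}"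

definition algebraic_set :: "(complex^'n::finite) set \<Rightarrow> bool" where
  "algebraic_set A \<longleftrightarrow> (\<exists>I. A = zero_locus I)"

definition irreducible_closed :: "(complex^'n::finite) set \<Rightarrow> bool" where
  "irreducible_closed Y \<longleftrightarrow> algebraic_set Y \<and> Y \<noteq> {} \<and>
     (\<forall>A B. algebraic_set A \<and> algebraic_set B \<and> Y = A \<union> B \<longrightarrow> A = Y \<or> B = Y)"

definition irreducible_component :: "(complex^'n::finite) set \<Rightarrow> (complex^'n) set \<Rightarrow> bool" where
  "irreducible_component S Y \<longleftrightarrow> irreducible_closed Y \<and> Y \<subseteq> S \<and>
     (\<forall>W. irreducible_closed W \<and> Y \<subseteq> W \<and> W \<subseteq> S \<longrightarrow> W = Y)"

text \<open>Codimension of an irreducible closed set: supremum of the lengths of chains ascending from it.\<close>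

definition codimension :: "(complex^'n::finite) set \<Rightarrow> enat" where
  "codimension Y = Sup {enat N | N. \<exists>C :: nat \<Rightarrow> (complex^'n) set.
     C 0 = Y \<and> (\<forall>i\<le>N. irreducible_closed (C i)) \<and> (\<forall>i<N. C i \<subset> C (Suc i))}"


section \<open>Linear algebraic groups and prehomogeneous vector spaces\<close>

text \<open>Linear algebraic groups are realised as Zariski closed subgroups of a general linear group.\<close>

definition entries :: "complex^'m^'m \<Rightarrow> 'm \<times> 'm \<Rightarrow> complex" where
  "entries g = (\<lambda>(i, j). g $ i $ j)"

definition closed_in_GL :: "(complex^'m::finite^'m) set \<Rightarrow> bool" where
  "closed_in_GL A \<longleftrightarrow> (\<exists>I. A = {g. invertible g \<and> (\<forall>p\<in>I. peval p (entries g) = 0)})"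

definition algebraic_group :: "(complex^'m::finite^'m) set \<Rightarrow> bool" where
  "algebraic_group G \<longleftrightarrow> closed_in_GL G \<and> mat 1 \<in> G \<and>
     (\<forall>g\<in>G. \<forall>h\<in>G. g ** h \<in> G) \<and> (\<forall>g\<in>G. matrix_inv g \<in> G)"

definition zariski_connected :: "(complex^'m::finite^'m) set \<Rightarrow> bool" where
  "zariski_connected G \<longleftrightarrow>
     \<not> (\<exists>A B. closed_in_GL A \<and> closed_in_GL B \<and> A \<noteq> {} \<and> B \<noteq> {} \<and> A \<inter> B = {} \<and> A \<union> B = G)"

definition unipotent :: "complex^'m::finite^'m \<Rightarrow> bool" where
  "unipotent u \<longleftrightarrow> (\<exists>k. ((\<lambda>X. X ** (u - mat 1)) ^^ k) (mat 1) = 0)"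

text \<open>Reductive: the unipotent radical is trivial.\<close>

definition reductive_group :: "(complex^'m::finite^'m) set \<Rightarrow> bool" where
  "reductive_group G \<longleftrightarrow> algebraic_group G \<and>
     (\<forall>U. algebraic_group U \<and> U \<subseteq> G \<and> zariski_connected U \<and>
          (\<forall>g\<in>G. \<forall>u\<in>U. g ** u ** matrix_inv g \<in> U) \<and> (\<forall>u\<in>U. unipotent u)
        \<longrightarrow> U = {mat 1})"

text \<open>The regular functions on a closed subgroup of the general linear group are the polynomials in
  the entries and the inverse of the determinant.\<close>

definition rational_representation ::
    "(complex^'m::finite^'m) set \<Rightarrow> (complex^'m^'m \<Rightarrow> complex^'n::finite^'n) \<Rightarrow> bool" where
  "rational_representation G \<rho> \<longleftrightarrow>
     \<rho> (mat 1) = mat 1 \<and> (\<forall>g\<in>G. \<forall>h\<in>G. \<rho> (g ** h) = \<rho> g ** \<rho> h) \<and>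
     (\<forall>i j. \<exists>p k. \<forall>g\<in>G. \<rho> g $ i $ j = peval p (entries g) / det g ^ k)"

definition self_adjoint_image ::
    "(complex^'m::finite^'m) set \<Rightarrow> (complex^'m^'m \<Rightarrow> complex^'n::finite^'n) \<Rightarrow> bool" where
  "self_adjoint_image G \<rho> \<longleftrightarrow> (\<forall>g\<in>G. (\<chi> i j. cnj (\<rho> g $ j $ i)) \<in> \<rho> ` G)"

definition reductive_prehomogeneous ::
    "(complex^'m::finite^'m) set \<Rightarrow> (complex^'m^'m \<Rightarrow> complex^'n::finite^'n) \<Rightarrow>
     (complex^'n) set \<Rightarrow> bool" where
  "reductive_prehomogeneous G \<rho> S \<longleftrightarrow>
     reductive_group G \<and> zariski_connected G \<and> rational_representation G \<rho> \<and>
     algebraic_set S \<and> S \<noteq> UNIV \<and> (\<exists>x0. UNIV - S = (\<lambda>g. \<rho> g *v x0) ` G)"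

text \<open>The type \<open>'r\<close> indexes the components of codimension one, so that there is at least one.\<close>

definition basic_relative_invariants ::
    "(complex^'m::finite^'m) set \<Rightarrow> (complex^'m^'m \<Rightarrow> complex^'n::finite^'n) \<Rightarrow>
     (complex^'n) set \<Rightarrow> ('r::finite \<Rightarrow> 'n cpoly) \<Rightarrow> bool" where
  "basic_relative_invariants G \<rho> S P \<longleftrightarrow>
     (\<forall>k. irreducible (P k)) \<and>
     bij_betw (\<lambda>k. zero_locus {P k}) UNIV {Y. irreducible_component S Y \<and> codimension Y = 1} \<and>
     (\<forall>k. homogeneous_poly (P k)) \<and>
     (\<forall>k. \<exists>\<psi>. \<forall>g\<in>G. \<psi> g \<noteq> 0 \<and>
        (\<forall>x. peval (P k) (($) (\<rho> g *v x)) = \<psi> g * peval (P k) (($) x)))"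


section \<open>The b-functions\<close>

definition partial_deriv :: "'n::finite \<Rightarrow> (complex^'n \<Rightarrow> complex) \<Rightarrow> complex^'n \<Rightarrow> complex" where
  "partial_deriv i f x = deriv (\<lambda>t. f (x + t *s axis i 1)) 0"

text \<open>
  The linear order on the coordinates only serves to name an order in which the partial derivatives
  are taken; on holomorphic functions they commute.
\<close>

definition multi_deriv ::
    "('n::{finite,linorder} \<Rightarrow>\<^sub>0 nat) \<Rightarrow> (complex^'n::_ \<Rightarrow> complex) \<Rightarrow> complex^'n::_ \<Rightarrow> complex" where
  "multi_deriv e f =
     fold (\<lambda>i. partial_deriv i ^^ Poly_Mapping.lookup e i) (sorted_list_of_set UNIV) f"

definition diff_op ::
    "'n::{finite,linorder} cpoly \<Rightarrow> (complex^'n::_ \<Rightarrow> complex) \<Rightarrow> complex^'n::_ \<Rightarrow> complex" where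
  "diff_op p f x = (\<Sum>e\<in>Poly_Mapping.keys p. Poly_Mapping.lookup p e * multi_deriv e f x)"

text \<open>
  The defining identity of the b-functions. The complex powers of \<open>P k\<close> are multivalued: the identity
  is required for every choice of holomorphic logarithms \<open>L k\<close> of the \<open>P k\<close> on an open set.
\<close>

definition b_functions ::
    "('r::finite \<Rightarrow> 'n::{finite,linorder} cpoly) \<Rightarrow> (('r \<Rightarrow> nat) \<Rightarrow> 'r cpoly) \<Rightarrow> bool" where
  "b_functions P b \<longleftrightarrow>
     (\<forall>m (s :: complex^'r) U (L :: 'r \<Rightarrow> complex^'n::_ \<Rightarrow> complex).
        open U \<and> (\<forall>k. holomorphic_sv_on (L k) U \<and> (\<forall>x\<in>U. exp (L k x) = peval (P k) (($) x)))
        \<longrightarrow> (\<forall>x\<in>U.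
           diff_op (\<Prod>k\<in>UNIV. cnj_poly (P k) ^ m k)
             (\<lambda>y. \<Prod>k\<in>UNIV. exp ((s $ k + of_nat (m k)) * L k y)) x
           = peval (b m) (($) s) * (\<Prod>k\<in>UNIV. exp (s $ k * L k x))))"

definition lin_form :: "('r::finite \<Rightarrow> nat) \<Rightarrow> complex^'r \<Rightarrow> complex" where
  "lin_form a s = (\<Sum>k\<in>UNIV. of_nat (a k) * s $ k)"

definition lin_form_nat :: "('r::finite \<Rightarrow> nat) \<Rightarrow> ('r \<Rightarrow> nat) \<Rightarrow> nat" where
  "lin_form_nat a m = (\<Sum>k\<in>UNIV. a k * m k)"

text \<open>
  The structure of the b-functions. Since exponents \<open>z i j\<close> may be negative, the product formula is an
  identity of rational functions, that is, an identity of values at all points where no factor with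
  negative exponent vanishes.
\<close>

definition b_function_data ::
    "(('r::finite \<Rightarrow> nat) \<Rightarrow> 'r cpoly) \<Rightarrow> ('r \<Rightarrow> real) \<Rightarrow> nat \<Rightarrow> (nat \<Rightarrow> 'r \<Rightarrow> nat) \<Rightarrow>
     (nat \<Rightarrow> complex) \<Rightarrow> (nat \<Rightarrow> int \<Rightarrow> int) \<Rightarrow> bool" where
  "b_function_data b c l \<mu> \<alpha> z \<longleftrightarrow>
     (\<forall>k. c k > 0) \<and>
     (\<forall>i\<in>{1..l}. (\<exists>k. \<mu> i k \<noteq> 0) \<and> Gcd {\<mu> i k | k. \<mu> i k \<noteq> 0} = 1) \<and>
     (\<forall>i\<in>{1..l}. finite {j. z i j \<noteq> 0} \<and> (\<Sum>j | z i j \<noteq> 0. z i j) > 0 \<and>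
        z i (Min {j. z i j \<noteq> 0}) > 0 \<and> z i (Max {j. z i j \<noteq> 0}) > 0) \<and>
     (\<forall>i\<in>{1..l}. \<forall>i'\<in>{1..l}. i \<noteq> i' \<longrightarrow>
        \<not> (\<exists>m :: 'r \<Rightarrow> int. \<forall>s.
             lin_form (\<mu> i) (\<chi> k. s $ k + of_int (m k)) + \<alpha> i = lin_form (\<mu> i') s + \<alpha> i')) \<and>
     (\<forall>m s. (\<exists>k. m k \<noteq> 0) \<and>
        (\<forall>i\<in>{1..l}. \<forall>j. \<forall>\<nu><lin_form_nat (\<mu> i) m.
           z i j < 0 \<longrightarrow> lin_form (\<mu> i) s + \<alpha> i + of_int j + of_nat \<nu> \<noteq> 0)
        \<longrightarrow> peval (b m) (($) s) =
          (\<Prod>k\<in>UNIV. of_real (c k) ^ m k) *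
          (\<Prod>i\<in>{1..l}. \<Prod>j | z i j \<noteq> 0. \<Prod>\<nu><lin_form_nat (\<mu> i) m.
             (lin_form (\<mu> i) s + \<alpha> i + of_int j + of_nat \<nu>) powi z i j))"


section \<open>The zeta integral\<close>

definition gauss :: "complex^'n::finite \<Rightarrow> real" where
  "gauss x = exp (- 2 * pi * (\<Sum>i\<in>UNIV. (cmod (x $ i))\<^sup>2))"

text \<open>Lebesgue measure, rescaled so that \<^const>\<open>gauss\<close> has integral one.\<close>

definition haarV :: "(complex^'n::finite) measure" where
  "haarV = density lborel (\<lambda>_. ennreal (1 / (\<integral>x. gauss (x :: complex^'n) \<partial>lborel)))"

definition zeta_integrand ::
    "('r::finite \<Rightarrow> 'n::finite cpoly) \<Rightarrow> complex^'r \<Rightarrow> complex^'n \<Rightarrow> complex" where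
  "zeta_integrand P s x =
     (\<Prod>k\<in>UNIV. (peval (P k) (($) x) * cnj (peval (P k) (($) x))) powr (s $ k)) * of_real (gauss x)"

definition zeta_int :: "('r::finite \<Rightarrow> 'n::finite cpoly) \<Rightarrow> complex^'r \<Rightarrow> complex" where
  "zeta_int P s = (\<integral>x. zeta_integrand P s x \<partial>haarV)"

end

theory Submission
  imports Defs "HOL-Probability.Distributions"
begin

text \<open>
  For real exponents \<open>t\<close> let \<open>Z(t)\<close> be the integral of \<open>\<Prod>k. |P k|^(2 * t k)\<close> against the Gaussian, and let
  \<open>\<gamma>(t)\<close> be the product of powers of the \<open>c k / (2\<pi>)^(d k)\<close> and of Gamma functions on the right-hand side,
  before normalisation. Three properties determine \<open>Z\<close>.

  \<^item> The functional equation (\<open>gaussian_functional_equation\<close>). The Gaussian turns multiplication by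
    \<open>cnj (x i)\<close> into the Wirtinger derivative in \<open>x i\<close>, up to the factor \<open>2\<pi>\<close>. Multiplying the integrand by
    \<open>|P k|^2\<close> therefore amounts to applying the constant coefficient operator attached to
    \<open>cnj_poly (P k)\<close> to \<open>P k * \<Prod>j. |P j|^(2 * t j)\<close>. Locally this function is a product of complex powers
    of the \<open>P j\<close>, which is holomorphic, and of an antiholomorphic function, which the operator does
    not see; so the result is given by the b-function. For this the powers must be often enough
    differentiable, hence \<open>t\<close> large. The equation is one that \<open>\<gamma>\<close> satisfies as well.
  \<^item> Log-convexity of \<open>Z\<close>, that is, Hoelder's inequality (\<open>real_zeta_log_convex\<close>).
  \<^item> Stirling's asymptotics for \<open>\<gamma>\<close> (\<open>gamma_product_asymptotics\<close>).

  As in the theorem of Bohr and Mollerup these force \<open>Z / \<gamma>\<close> to be constant along each coordinate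
  direction (\<open>log_convex_solution_unique\<close>), hence constant for large real exponents. Growth in
  imaginary directions would not do instead: a bounded integral divided by \<open>\<gamma>\<close> may grow too fast
  there to exclude nonconstant periodic functions. The zeta integral is holomorphic where all exponents
  have positive real part (\<open>holomorphic_zeta_int\<close>), and writing \<open>\<gamma> = numer / denom\<close> with entire functions
  (reciprocals of Gamma being entire), the identity theorem in each variable separately gives
  \<open>zeta_int P s * denom s = K * numer s\<close> for all such exponents, with a constant \<open>K \<noteq> 0\<close>.

  The constant is found at the boundary point \<open>s = 0\<close>, where the zeta integral tends to one because the
  \<open>P k\<close> vanish only on a null set. It has to be known that no \<open>\<alpha> i + j\<close> occurring in the formula is a pole
  of Gamma, and this follows from the identity just obtained: among all numbers \<open>\<alpha> i + j\<close> that are real and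
  not positive, with \<open>j\<close> the smallest index in the support of \<open>z i\<close>, consider the one whose pole is met first
  when the point \<open>(\<tau>, ..., \<tau>)\<close> moves from infinity to zero. There \<open>denom\<close> vanishes, the exponent belonging to
  the smallest index being positive, and \<open>numer\<close> does not, since negative exponents belong to larger
  indices, whose factors have not reached their poles yet (\<open>first_pole_on_diagonal\<close>). This contradicts the
  finiteness of the zeta integral.
\<close>

no_notation fps_nth (infixl \<open>$\<close> 75)

section \<open>Function classes closed under differentiation\<close>

text \<open>
  Functions that are \<open>n\<close> times differentiable on \<open>B\<close>, all derivatives of order up to \<open>n\<close> belonging to the
  class \<open>adm\<close> and all differentials to the class \<open>lin\<close>. Two instances are needed: \<open>C^n\<close> functions whose
  derivatives grow polynomially, for which integration by parts against the Gaussian is legitimate,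
  and holomorphic functions on an open set.
\<close>

primrec smooth_class ::
    "(('a::real_normed_vector \<Rightarrow> complex) \<Rightarrow> bool) \<Rightarrow> (('a \<Rightarrow> complex) \<Rightarrow> bool) \<Rightarrow> 'a set \<Rightarrow>
     nat \<Rightarrow> ('a \<Rightarrow> complex) \<Rightarrow> bool" where
  "smooth_class adm lin B 0 f \<longleftrightarrow> adm f"
| "smooth_class adm lin B (Suc n) f \<longleftrightarrow> adm f \<and>
     (\<exists>D. (\<forall>x\<in>B. (f has_derivative D x) (at x) \<and> lin (D x)) \<and>
          (\<forall>v. smooth_class adm lin B n (\<lambda>x. D x v)))"

locale differential_algebra =
  fixes adm :: "('a::real_normed_vector \<Rightarrow> complex) \<Rightarrow> bool"
    and lin :: "('a \<Rightarrow> complex) \<Rightarrow> bool"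
    and B :: "'a set"
  assumes adm_const: "adm (\<lambda>_. c)"
    and adm_add: "adm f \<Longrightarrow> adm g \<Longrightarrow> adm (\<lambda>x. f x + g x)"
    and adm_mult: "adm f \<Longrightarrow> adm g \<Longrightarrow> adm (\<lambda>x. f x * g x)"
    and lin_zero: "lin (\<lambda>_. 0)"
    and lin_add: "lin S \<Longrightarrow> lin T \<Longrightarrow> lin (\<lambda>v. S v + T v)"
    and lin_scale: "lin T \<Longrightarrow> lin (\<lambda>v. c * T v)"
begin

abbreviation "smooth \<equiv> smooth_class adm lin B"

lemma smooth_adm: "smooth n f \<Longrightarrow> adm f"
  by (cases n) auto

lemma smooth_SucD: "smooth (Suc n) f \<Longrightarrow> smooth n f"
proof (induction n arbitrary: f)
  case (Suc n)
  then obtain D where "adm f" "\<forall>x\<in>B. (f has_derivative D x) (at x) \<and> lin (D x)"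
    "\<forall>v. smooth (Suc n) (\<lambda>x. D x v)"
    unfolding smooth_class.simps(2)[of adm lin B "Suc n"] by blast
  with Suc.IH show ?case
    unfolding smooth_class.simps(2)[of adm lin B n f] by blast
qed auto

lemma smooth_const: "smooth n (\<lambda>_. c)"
proof (induction n arbitrary: c)
  case (Suc n)
  then show ?case
    using adm_const lin_zero by (auto intro!: exI[of _ "\<lambda>_ _. 0"])
qed (simp add: adm_const)

lemma smooth_add: "smooth n f \<Longrightarrow> smooth n g \<Longrightarrow> smooth n (\<lambda>x. f x + g x)"
proof (induction n arbitrary: f g)
  case (Suc n)
  from Suc.prems obtain D E where
    D: "\<And>x. x \<in> B \<Longrightarrow> (f has_derivative D x) (at x) \<and> lin (D x)" "\<And>v. smooth n (\<lambda>x. D x v)" and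
    E: "\<And>x. x \<in> B \<Longrightarrow> (g has_derivative E x) (at x) \<and> lin (E x)" "\<And>v. smooth n (\<lambda>x. E x v)"
    by auto metis
  show ?case
    using Suc.prems D E Suc.IH
    by (auto intro!: exI[of _ "\<lambda>x v. D x v + E x v"] adm_add lin_add has_derivative_add)
qed (simp add: adm_add)

lemma smooth_mult: "smooth n f \<Longrightarrow> smooth n g \<Longrightarrow> smooth n (\<lambda>x. f x * g x)"
proof (induction n arbitrary: f g)
  case (Suc n)
  from Suc.prems obtain D E where
    D: "\<And>x. x \<in> B \<Longrightarrow> (f has_derivative D x) (at x) \<and> lin (D x)" "\<And>v. smooth n (\<lambda>x. D x v)" and
    E: "\<And>x. x \<in> B \<Longrightarrow> (g has_derivative E x) (at x) \<and> lin (E x)" "\<And>v. smooth n (\<lambda>x. E x v)"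
    by auto metis
  have "lin (\<lambda>v. f x * E x v + D x v * g x)" if "x \<in> B" for x
    using lin_add[OF lin_scale[of "E x" "f x"] lin_scale[of "D x" "g x"]] D E that
    by (simp add: mult.commute)
  moreover have "smooth n (\<lambda>x. f x * E x v + D x v * g x)" for v
    using smooth_SucD[OF Suc.prems(1)] smooth_SucD[OF Suc.prems(2)] D E
    by (intro smooth_add Suc.IH) auto
  moreover have "((\<lambda>x. f x * g x) has_derivative (\<lambda>v. f x * E x v + D x v * g x)) (at x)"
    if "x \<in> B" for x
    using D E that by (auto intro!: derivative_eq_intros)
  ultimately show ?case
    using Suc.prems by (auto intro!: exI[of _ "\<lambda>x v. f x * E x v + D x v * g x"] adm_mult)
qed (simp add: adm_mult)

lemma smooth_sum: "(\<And>i. i \<in> A \<Longrightarrow> smooth n (f i)) \<Longrightarrow> smooth n (\<lambda>x. \<Sum>i\<in>A. f i x)"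
  by (induction A rule: infinite_finite_induct) (auto intro: smooth_const smooth_add)

lemma smooth_prod: "(\<And>i. i \<in> A \<Longrightarrow> smooth n (f i)) \<Longrightarrow> smooth n (\<lambda>x. \<Prod>i\<in>A. f i x)"
  by (induction A rule: infinite_finite_induct) (auto intro: smooth_const smooth_mult)

lemma smooth_power: "smooth n f \<Longrightarrow> smooth n (\<lambda>x. f x ^ k)"
  by (induction k) (auto intro: smooth_const smooth_mult)

lemma smooth_linear:
  assumes "bounded_linear T" "lin T" "adm T"
  shows "smooth n T"
proof (cases n)
  case (Suc m)
  have "(T has_derivative T) (at x)" for x
    using assms(1) by (rule bounded_linear_imp_has_derivative)
  then show ?thesis
    unfolding Suc smooth_class.simps(2) using assms smooth_const
    by (intro conjI exI[of _ "\<lambda>_. T"]) auto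
qed (use assms in simp)

end

text \<open>
  Continuity is included because it gives measurability for free.
\<close>

definition moderate :: "('a::real_normed_vector \<Rightarrow> complex) \<Rightarrow> bool" where
  "moderate f \<longleftrightarrow> continuous_on UNIV f \<and> (\<exists>M k. \<forall>x. norm (f x) \<le> M * (1 + norm x) ^ k)"

abbreviation tempered :: "nat \<Rightarrow> ('a::real_normed_vector \<Rightarrow> complex) \<Rightarrow> bool" where
  "tempered \<equiv> smooth_class moderate (\<lambda>_. True) UNIV"

definition complex_linear :: "(complex^'v::finite \<Rightarrow> complex) \<Rightarrow> bool" where
  "complex_linear T \<longleftrightarrow> (\<forall>c v. T (c *s v) = c * T v)"

abbreviation holo_class :: "(complex^'v::finite) set \<Rightarrow> nat \<Rightarrow> (complex^'v \<Rightarrow> complex) \<Rightarrow> bool" where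
  "holo_class \<equiv> smooth_class (\<lambda>_. True) complex_linear"

lemma moderateI:
  assumes "continuous_on UNIV f" "\<And>x. norm (f x) \<le> M * (1 + norm x) ^ k"
  shows "moderate f"
  using assms by (auto simp: moderate_def)

lemma moderateE:
  assumes "moderate f"
  obtains M k where "M \<ge> 0" "\<And>x. norm (f x) \<le> M * (1 + norm x) ^ k"
proof -
  from assms obtain M k where M: "\<And>x. norm (f x) \<le> M * (1 + norm x) ^ k"
    by (auto simp: moderate_def)
  have "M \<ge> 0" using M[of 0] by (simp add: norm_ge_zero[THEN order_trans])
  with M that show ?thesis by blast
qed

lemma moderate_mult: "moderate f \<Longrightarrow> moderate g \<Longrightarrow> moderate (\<lambda>x. f x * g x)"
proof -
  assume f: "moderate f" and g: "moderate g"
  obtain M k where M: "M \<ge> 0" "\<And>x. norm (f x) \<le> M * (1 + norm x) ^ k" using moderateE[OF f] by blast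
  obtain M' k' where M': "M' \<ge> 0" "\<And>x. norm (g x) \<le> M' * (1 + norm x) ^ k'" using moderateE[OF g] by blast
  show ?thesis
  proof (rule moderateI)
    show "continuous_on UNIV (\<lambda>x. f x * g x)"
      using f g by (auto simp: moderate_def intro!: continuous_intros)
    show "norm (f x * g x) \<le> (M * M') * (1 + norm x) ^ (k + k')" for x
      using mult_mono[OF M(2)[of x] M'(2)[of x]] M(1) by (simp add: norm_mult power_add mult_ac)
  qed
qed

lemma moderate_add: "moderate f \<Longrightarrow> moderate g \<Longrightarrow> moderate (\<lambda>x. f x + g x)"
proof -
  assume f: "moderate f" and g: "moderate g"
  obtain M k where M: "M \<ge> 0" "\<And>x. norm (f x) \<le> M * (1 + norm x) ^ k" using moderateE[OF f] by blast
  obtain M' k' where M': "M' \<ge> 0" "\<And>x. norm (g x) \<le> M' * (1 + norm x) ^ k'" using moderateE[OF g] by blast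
  show ?thesis
  proof (rule moderateI)
    show "continuous_on UNIV (\<lambda>x. f x + g x)"
      using f g by (auto simp: moderate_def intro!: continuous_intros)
    show "norm (f x + g x) \<le> (M + M') * (1 + norm x) ^ (k + k')" for x
    proof -
      have "M * (1 + norm x) ^ k \<le> M * (1 + norm x) ^ (k + k')"
           "M' * (1 + norm x) ^ k' \<le> M' * (1 + norm x) ^ (k + k')"
        using M M' by (auto intro!: mult_left_mono power_increasing)
      then show ?thesis
        using norm_triangle_ineq[of "f x" "g x"] M(2)[of x] M'(2)[of x]
        by (simp add: distrib_right)
    qed
  qed
qed

lemma moderate_const: "moderate (\<lambda>_. c)"
  by (rule moderateI[of _ "norm c" 0]) auto

lemma moderate_bounded_linear: "bounded_linear T \<Longrightarrow> moderate T"
proof -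
  assume T: "bounded_linear T"
  then obtain K where K: "K \<ge> 0" "\<And>x. norm (T x) \<le> norm x * K"
    using bounded_linear.nonneg_bounded by blast
  show ?thesis
  proof (rule moderateI)
    show "continuous_on UNIV T" using T by (rule linear_continuous_on)
    show "norm (T x) \<le> K * (1 + norm x) ^ 1" for x
      using K(2)[of x] K(1) by (simp add: algebra_simps)
  qed
qed

interpretation tempered: differential_algebra moderate "\<lambda>_. True" UNIV
  by unfold_locales (auto intro: moderate_const moderate_add moderate_mult)

interpretation holo: differential_algebra "\<lambda>_. True" complex_linear B for B
  by unfold_locales (auto simp: complex_linear_def algebra_simps)

lemma bounded_linear_component: "bounded_linear (\<lambda>x::complex^'v::finite. x $ i)"
  by (rule bounded_linear_vec_nth)

lemma tempered_component: "tempered n (\<lambda>x::complex^'v::finite. x $ i)"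
  by (rule tempered.smooth_linear) (auto intro: bounded_linear_component moderate_bounded_linear)

lemma holo_component: "holo_class B n (\<lambda>x::complex^'v::finite. x $ i)"
  by (rule holo.smooth_linear) (auto intro: bounded_linear_component simp: complex_linear_def)

lemma tempered_peval: "tempered n (\<lambda>x::complex^'v::finite. peval p (($) x))"
  unfolding peval_def
  by (intro tempered.smooth_sum tempered.smooth_mult tempered.smooth_const tempered.smooth_prod
        tempered.smooth_power tempered_component)

lemma holo_peval: "holo_class B n (\<lambda>x::complex^'v::finite. peval p (($) x))"
  unfolding peval_def
  by (intro holo.smooth_sum holo.smooth_mult holo.smooth_const holo.smooth_prod
        holo.smooth_power holo_component)

lemma tempered_cnj: "tempered n f \<Longrightarrow> tempered n (\<lambda>x. cnj (f x))"
proof (induction n arbitrary: f)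
  case 0
  then show ?case by (auto simp: moderate_def intro!: continuous_intros)
next
  case (Suc n)
  then obtain D where "moderate f" "\<And>x. (f has_derivative D x) (at x)" "\<And>v. tempered n (\<lambda>x. D x v)"
    by auto
  moreover from this(1) have "moderate (\<lambda>x. cnj (f x))"
    by (auto simp: moderate_def intro!: continuous_intros)
  ultimately show ?case
    using Suc.IH by (auto intro!: exI[of _ "\<lambda>x v. cnj (D x v)"] derivative_intros)
qed

subsection \<open>Powers of absolute values\<close>

text \<open>
  The power \<open>|w|^(2t)\<close>. With the convention that a power of zero is zero it is continuous for \<open>t > 0\<close> and
  behaves multiplicatively in \<open>t\<close> without exceptions.
\<close>

definition abs2pow :: "real \<Rightarrow> complex \<Rightarrow> real" where
  "abs2pow t w = (cmod w)\<^sup>2 powr t"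

text \<open>
  At the origin the derivative exists because \<open>|w|^(2t) \<le> |w|^2\<close> nearby, which is where \<open>t > 1\<close> enters.
\<close>

lemma has_derivative_abs2pow:
  assumes "t > 1"
  shows "(abs2pow t has_derivative (\<lambda>h. t * abs2pow (t - 1) w * (2 * Re (cnj w * h)))) (at w)"
proof (cases "w = 0")
  case False
  have "((\<lambda>w. (cmod w)\<^sup>2) has_derivative (\<lambda>h. 2 * Re (cnj w * h))) (at w)"
    unfolding cmod_power2
    by (auto intro!: derivative_eq_intros simp: algebra_simps)
  from has_derivative_powr[OF this has_derivative_const[of t]] False
  show ?thesis
    unfolding abs2pow_def[abs_def]
    by (simp add: powr_diff algebra_simps add_divide_distrib)
next
  case True
  have "((\<lambda>h::complex. norm (abs2pow t h - 0 - 0) / norm h) \<longlongrightarrow> 0) (at 0)"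
  proof (rule Lim_null_comparison)
    show "\<forall>\<^sub>F h::complex in at 0. norm (norm (abs2pow t h - 0 - 0) / norm h) \<le> norm h"
      unfolding eventually_at
    proof (intro exI[of _ 1] conjI ballI impI)
      fix h :: complex assume h: "h \<noteq> 0 \<and> dist h 0 < 1"
      have "(cmod h)\<^sup>2 powr t \<le> (cmod h)\<^sup>2 powr 1"
        using h assms by (intro powr_mono') (auto simp: power_le_one)
      with h show "norm (norm (abs2pow t h - 0 - 0) / norm h) \<le> norm h"
        by (simp add: abs2pow_def divide_le_eq power2_eq_square)
    qed simp
    show "((\<lambda>h::complex. norm h) \<longlongrightarrow> 0) (at 0)"
      by (auto intro!: tendsto_eq_intros)
  qed
  then show ?thesis
    using True by (simp add: has_derivative_at abs2pow_def)
qed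

lemma continuous_abs2pow:
  assumes "t > 0" shows "continuous_on UNIV (abs2pow t)"
  unfolding abs2pow_def[abs_def] using assms
  by (intro continuous_on_powr') (auto intro!: continuous_intros)

lemma moderate_abs2pow:
  assumes "t > 0" "moderate f"
  shows "moderate (\<lambda>x. of_real (abs2pow t (f x)))"
proof -
  obtain m :: nat where m: "t \<le> real m" using real_arch_simple by blast
  have "moderate (\<lambda>x. (1 + f x * cnj (f x)) ^ m)" (is "moderate ?g")
    using assms(2) tempered_cnj[of 0 f]
    by (intro tempered.smooth_power[of 0, simplified] moderate_add moderate_const moderate_mult) auto
  then obtain M k where M: "M \<ge> 0" "\<And>x. norm (?g x) \<le> M * (1 + norm x) ^ k" using moderateE by blast
  show ?thesis
  proof (rule moderateI)
    have "continuous_on UNIV (\<lambda>x. abs2pow t (f x))"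
      using continuous_on_compose2[OF continuous_abs2pow[OF assms(1)], of UNIV f] assms(2)
      by (auto simp: moderate_def)
    then show "continuous_on UNIV (\<lambda>x. complex_of_real (abs2pow t (f x)))"
      by (intro continuous_intros)
    show "norm (complex_of_real (abs2pow t (f x))) \<le> M * (1 + norm x) ^ k" for x
    proof -
      let ?a = "(cmod (f x))\<^sup>2"
      have "abs2pow t (f x) \<le> (1 + ?a) powr t"
        unfolding abs2pow_def using assms by (intro powr_mono2) auto
      also have "\<dots> \<le> (1 + ?a) powr real m"
        using m by (intro powr_mono) auto
      also have "\<dots> = (1 + ?a) ^ m"
        by (intro powr_realpow) (simp add: add_pos_nonneg)
      also have "\<dots> = norm (?g x)"
      proof -
        have "1 + f x * cnj (f x) = of_real (1 + ?a)"
          using complex_norm_square[of "f x"] by simp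
        then show ?thesis
          by (simp add: norm_power del: of_real_add)
      qed
      also have "\<dots> \<le> M * (1 + norm x) ^ k" by (rule M)
      finally show ?thesis by (simp add: abs2pow_def)
    qed
  qed
qed

text \<open>
  Each differentiation of \<open>|f|^(2t)\<close> lowers the exponent \<open>t\<close> by one and produces factors \<open>f\<close>, \<open>cnj f\<close> and
  derivatives of these, so \<open>n\<close> differentiations are possible when \<open>t > n\<close>.
\<close>

lemma tempered_abs2pow:
  assumes "t > real n" "t > 0" "tempered n f"
  shows "tempered n (\<lambda>x. of_real (abs2pow t (f x)))"
  using assms
proof (induction n arbitrary: t)
  case 0
  then show ?case by (auto intro: moderate_abs2pow)
next
  case (Suc n)
  then obtain D where D: "\<And>x. (f has_derivative D x) (at x)" "\<And>v. tempered n (\<lambda>x. D x v)"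
    by auto
  let ?E = "\<lambda>x v. of_real t * of_real (abs2pow (t - 1) (f x)) *
               (cnj (f x) * D x v + f x * cnj (D x v)) :: complex"
  have "tempered n f" using Suc.prems(3) by (rule tempered.smooth_SucD)
  then have "tempered n (\<lambda>x. ?E x v)" for v
    using Suc.prems Suc.IH[of "t - 1"] D(2)
    by (intro tempered.smooth_mult tempered.smooth_add tempered_cnj tempered.smooth_const) auto
  moreover have "((\<lambda>x. complex_of_real (abs2pow t (f x))) has_derivative ?E x) (at x)" for x
  proof -
    have "((\<lambda>x. abs2pow t (f x)) has_derivative
        (\<lambda>v. t * abs2pow (t - 1) (f x) * (2 * Re (cnj (f x) * D x v)))) (at x)"
      using has_derivative_compose[OF D(1) has_derivative_abs2pow[of t "f x"]] Suc.prems by simp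
    from has_derivative_of_real[OF this]
    have 1: "((\<lambda>x. complex_of_real (abs2pow t (f x))) has_derivative
       (\<lambda>v. complex_of_real (t * abs2pow (t - 1) (f x) * (2 * Re (cnj (f x) * D x v))))) (at x)" .
    have "complex_of_real (2 * Re (cnj (f x) * D x v)) = cnj (f x) * D x v + f x * cnj (D x v)" for v
      using complex_add_cnj[of "cnj (f x) * D x v"] by simp
    then show ?thesis
      using 1 by (simp add: mult.assoc)
  qed
  ultimately show ?case
    using Suc.prems moderate_abs2pow[of t f] tempered.smooth_adm[of "Suc n" f]
    by (auto intro!: exI[of _ ?E])
qed

subsection \<open>Powers with a holomorphic exponent\<close>

lemma has_derivative_exp_comp:
  fixes L :: "'a::real_normed_vector \<Rightarrow> complex"
  assumes "(L has_derivative D) (at x)"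
  shows "((\<lambda>x. exp (L x)) has_derivative (\<lambda>v. exp (L x) * D v)) (at x)"
  using has_derivative_compose[OF assms DERIV_exp[unfolded has_field_derivative_def]] .

text \<open>
  The derivative of \<open>p^c\<close> is \<open>c * p' * p^(c - 1)\<close>, again a product of derivatives of \<open>p\<close> with such a power.
  This yields holomorphy of all partial derivatives without a Cauchy formula in several variables.
\<close>

lemma holo_exp_log:
  assumes L: "holomorphic_sv_on L B" and p: "\<And>n. holo_class B n p" and B: "open B"
    and exp: "\<And>x. x \<in> B \<Longrightarrow> exp (L x) = p x"
  shows "holo_class B n (\<lambda>x. exp (c * L x))"
proof (induction n arbitrary: c)
  case (Suc n)
  from p[of "Suc n"] obtain Dp where
    Dp: "\<And>x. x \<in> B \<Longrightarrow> (p has_derivative Dp x) (at x)" "\<And>x. x \<in> B \<Longrightarrow> complex_linear (Dp x)"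
        "\<And>v. holo_class B n (\<lambda>x. Dp x v)" by auto
  let ?E = "\<lambda>x v. c * Dp x v * exp ((c - 1) * L x)"
  have der: "((\<lambda>x. exp (c * L x)) has_derivative ?E x) (at x)" if x: "x \<in> B" for x
  proof -
    from L x obtain D where D: "(L has_derivative D) (at x)"
      unfolding holomorphic_sv_on_def by blast
    have "((\<lambda>x. exp (L x)) has_derivative (\<lambda>v. exp (L x) * D v)) (at x)"
      using D by (rule has_derivative_exp_comp)
    then have "(p has_derivative (\<lambda>v. exp (L x) * D v)) (at x)"
      by (rule has_derivative_transform_within_open[OF _ B x]) (use exp in auto)
    with Dp(1)[OF x] have eq: "Dp x = (\<lambda>v. exp (L x) * D v)"
      by (rule has_derivative_unique)
    have "((\<lambda>x. exp (c * L x)) has_derivative (\<lambda>v. exp (c * L x) * (c * D v))) (at x)"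
      by (rule has_derivative_exp_comp[OF has_derivative_mult_right[OF D]])
    also have "(\<lambda>v. exp (c * L x) * (c * D v)) = ?E x"
      by (auto simp: eq fun_eq_iff left_diff_distrib exp_diff)
    finally show ?thesis .
  qed
  have "complex_linear (?E x)" if "x \<in> B" for x
    using Dp(2)[OF that] by (auto simp: complex_linear_def)
  moreover have "holo_class B n (\<lambda>x. ?E x v)" for v
    using Suc.IH by (intro holo.smooth_mult holo.smooth_const Dp)
  ultimately show ?case
    using der by (auto intro!: exI[of _ ?E])
qed auto

section \<open>Gaussian integrals and integration by parts\<close>

lemma integrable_exp_neg_norm_sq:
  assumes "a > 0"
  shows "integrable lborel (\<lambda>x::'a::euclidean_space. exp (- a * (norm x)\<^sup>2))"
proof -
  have 1: "integrable lborel (\<lambda>u::real. exp (- a * u\<^sup>2))"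
  proof -
    define \<sigma> where "\<sigma> = 1 / sqrt (2 * a)"
    have s: "\<sigma> > 0" "\<sigma>\<^sup>2 = 1 / (2 * a)"
      using assms by (auto simp: \<sigma>_def power_divide)
    have "integrable lborel (\<lambda>u. normal_density 0 \<sigma> u * (u - 0) ^ 0)"
      by (rule integrable_normal_moment) (use s in auto)
    then have "integrable lborel (\<lambda>u. sqrt (2 * pi * \<sigma>\<^sup>2) * (normal_density 0 \<sigma> u * (u - 0) ^ 0))"
      by (rule integrable_mult_right)
    also have "(\<lambda>u. sqrt (2 * pi * \<sigma>\<^sup>2) * (normal_density 0 \<sigma> u * (u - 0) ^ 0)) = (\<lambda>u. exp (- a * u\<^sup>2))"
      using assms s by (auto simp: normal_density_def fun_eq_iff)
    finally show ?thesis .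
  qed
  have "(\<integral>\<^sup>+x. ennreal (exp (- a * (norm (x::'a))\<^sup>2)) \<partial>lborel) =
        (\<integral>\<^sup>+x. (\<Prod>b\<in>Basis. ennreal (exp (- a * ((x::'a) \<bullet> b)\<^sup>2))) \<partial>lborel)"
  proof (intro nn_integral_cong)
    fix x :: 'a
    have "(norm x)\<^sup>2 = (\<Sum>b\<in>Basis. (x \<bullet> b)\<^sup>2)"
      by (simp add: norm_eq_sqrt_inner euclidean_inner[of x x] power2_eq_square sum_nonneg)
    then show "ennreal (exp (- a * (norm x)\<^sup>2)) = (\<Prod>b\<in>Basis. ennreal (exp (- a * (x \<bullet> b)\<^sup>2)))"
      by (simp add: sum_distrib_left exp_sum prod_ennreal flip: sum_negf)
  qed
  also have "\<dots> = (\<Prod>b\<in>(Basis::'a set). \<integral>\<^sup>+u. ennreal (exp (- a * u\<^sup>2)) \<partial>lborel)"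
    by (rule nn_integral_lborel_prod) auto
  also have "\<dots> < \<infinity>"
    using 1 by (auto simp: integrable_iff_bounded prod_constant power_less_top_ennreal)
  finally show ?thesis
    by (intro integrableI_bounded) auto
qed

text \<open>
  From \<open>1 + r \<le> exp r\<close> and completion of the square in \<open>k r - (b - a) r^2\<close>.
\<close>

lemma polynomial_times_gaussian_le:
  fixes a b r :: real
  assumes "a < b" "r \<ge> 0"
  shows "(1 + r) ^ k * exp (- b * r\<^sup>2) \<le> exp (real k ^ 2 / (4 * (b - a))) * exp (- a * r\<^sup>2)"
proof -
  define c where "c = b - a"
  have c: "c > 0" using assms by (simp add: c_def)
  have "(1 + r) ^ k \<le> exp r ^ k"
    using assms by (intro power_mono exp_ge_add_one_self) auto
  also have "\<dots> = exp (k * r)" by (simp add: exp_of_nat_mult)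
  finally have "(1 + r) ^ k * exp (- b * r\<^sup>2) \<le> exp (k * r) * exp (- b * r\<^sup>2)"
    by (rule mult_right_mono) simp
  also have "\<dots> = exp (k * r - c * r\<^sup>2) * exp (- a * r\<^sup>2)"
    by (simp add: c_def algebra_simps flip: exp_add)
  also have "\<dots> \<le> exp (real k ^ 2 / (4 * c)) * exp (- a * r\<^sup>2)"
  proof -
    have "real k ^ 2 / (4 * c) - (k * r - c * r\<^sup>2) = (real k - 2 * c * r)\<^sup>2 / (4 * c)"
      using c by (simp add: field_simps power2_eq_square)
    also have "\<dots> \<ge> 0" using c by simp
    finally show ?thesis by simp
  qed
  finally show ?thesis by (simp add: c_def)
qed

lemma gauss_eq: "gauss x = exp (- (2 * pi) * (norm x)\<^sup>2)"
  by (simp add: gauss_def norm_vec_def L2_set_def sum_nonneg)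

lemma gauss_pos: "gauss x > 0"
  by (simp add: gauss_def)

lemma continuous_gauss: "continuous_on A gauss"
  unfolding gauss_eq[abs_def] by (intro continuous_intros)

lemma measurable_gauss[measurable]: "gauss \<in> borel_measurable borel"
  by (intro borel_measurable_continuous_onI continuous_gauss)

lemma moderate_gauss_bound:
  assumes "moderate (f :: complex^'n::finite \<Rightarrow> complex)"
  shows "\<exists>K\<ge>0. \<forall>x. norm (f x) * gauss x \<le> K * exp (- 1 * (norm x)\<^sup>2)"
proof -
  obtain M k where M: "M \<ge> 0" "\<And>x. norm (f x) \<le> M * (1 + norm x) ^ k"
    using assms moderateE by blast
  let ?K = "exp (real k ^ 2 / (4 * (2 * pi - 1)))"
  have "norm (f x) * gauss x \<le> (M * ?K) * exp (- 1 * (norm x)\<^sup>2)" for x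
  proof -
    have "norm (f x) * gauss x \<le> M * ((1 + norm x) ^ k * exp (- (2 * pi) * (norm x)\<^sup>2))"
      using mult_right_mono[OF M(2)[of x], of "gauss x"] gauss_pos[of x]
      by (simp add: gauss_eq mult.assoc)
    also have "\<dots> \<le> M * (?K * exp (- 1 * (norm x)\<^sup>2))"
      using pi_gt3 M(1) by (intro mult_left_mono polynomial_times_gaussian_le) auto
    finally show ?thesis by (simp add: mult.assoc)
  qed
  then show ?thesis using M(1) by (intro exI[of _ "M * ?K"]) auto
qed

lemma integrable_moderate_gauss:
  assumes "moderate (f :: complex^'n::finite \<Rightarrow> complex)"
  shows "integrable lborel (\<lambda>x. f x * of_real (gauss x))"
proof -
  obtain K where K: "K \<ge> 0" "\<And>x. norm (f x) * gauss x \<le> K * exp (- 1 * (norm x)\<^sup>2)"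
    using moderate_gauss_bound[OF assms] by blast
  show ?thesis
  proof (rule Bochner_Integration.integrable_bound)
    show "integrable lborel (\<lambda>x::complex^'n. K * exp (- 1 * (norm x)\<^sup>2))"
      by (intro integrable_mult_right integrable_exp_neg_norm_sq) simp
    have "continuous_on UNIV f" using assms by (simp add: moderate_def)
    then show "(\<lambda>x. f x * complex_of_real (gauss x)) \<in> borel_measurable lborel"
      by (intro borel_measurable_continuous_onI borel_measurable_times borel_measurable_of_real)
         (auto intro!: borel_measurable_continuous_onI continuous_intros continuous_gauss)
    show "AE x in lborel. norm (f x * complex_of_real (gauss x)) \<le> norm (K * exp (- 1 * (norm x)\<^sup>2))"
    proof (intro AE_I2)
      fix x :: "complex^'n"
      have "\<bar>gauss x\<bar> = gauss x" "\<bar>K * exp (- 1 * (norm x)\<^sup>2)\<bar> = K * exp (- 1 * (norm x)\<^sup>2)"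
        using gauss_pos[of x] K(1) by simp_all
      then show "norm (f x * complex_of_real (gauss x)) \<le> norm (K * exp (- 1 * (norm x)\<^sup>2))"
        using K(2)[of x] by (simp add: norm_mult)
    qed
  qed
qed

lemma integrable_translate:
  fixes F :: "'a::euclidean_space \<Rightarrow> complex"
  assumes "integrable lborel F"
  shows "integrable lborel (\<lambda>x. F (x + v))" "(\<integral>x. F (x + v) \<partial>lborel) = (\<integral>x. F x \<partial>lborel)"
proof -
  have F: "F \<in> borel_measurable borel" using assms by auto
  have "integrable (distr lborel borel ((+) v)) F"
    using assms by (subst lborel_distr_plus)
  then show "integrable lborel (\<lambda>x. F (x + v))"
    using F by (subst (asm) integrable_distr_eq) (auto simp: add.commute)
  have "(\<integral>x. F x \<partial>lborel) = (\<integral>x. F x \<partial>distr lborel borel ((+) v))"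
    by (simp add: lborel_distr_plus)
  also have "\<dots> = (\<integral>x. F (v + x) \<partial>lborel)"
    using F by (subst integral_distr) auto
  finally show "(\<integral>x. F (x + v) \<partial>lborel) = (\<integral>x. F x \<partial>lborel)"
    by (simp add: add.commute)
qed

text \<open>
  The integral of \<open>F (x + h v)\<close> does not depend on \<open>h\<close>, so all difference quotients of \<open>F\<close> have integral zero;
  they converge dominatedly to the directional derivative. A Gaussian bound survives translation by
  vectors of bounded length, at the price of a smaller constant in the exponent.
\<close>

lemma integral_directional_derivative_eq_0:
  fixes F :: "'a::euclidean_space \<Rightarrow> complex"
  assumes F: "\<And>x. (F has_derivative D x) (at x)" "integrable lborel F"
    and D: "continuous_on UNIV (\<lambda>x. D x v)" "\<And>x. norm (D x v) \<le> K * exp (- 1 * (norm x)\<^sup>2)"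
  shows "(\<integral>x. D x v \<partial>lborel) = 0"
proof -
  have K: "K \<ge> 0"
    using order_trans[OF norm_ge_zero D(2)[of 0]] by simp
  define h :: "nat \<Rightarrow> real" where "h n = 1 / real (Suc n)" for n
  define g where "g n x = (F (x + h n *\<^sub>R v) - F x) /\<^sub>R h n" for n x
  have h: "h n > 0" "h n \<le> 1" for n by (auto simp: h_def)
  have h0: "h \<longlonglongrightarrow> 0" unfolding h_def by (rule LIMSEQ_Suc[OF lim_1_over_n])
  have line: "((\<lambda>t. F (x + t *\<^sub>R v)) has_vector_derivative D (x + t *\<^sub>R v) v) (at t)" for x t
  proof -
    have "((\<lambda>t. x + t *\<^sub>R v) has_derivative (\<lambda>t. t *\<^sub>R v)) (at t)"
      by (auto intro!: derivative_eq_intros)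
    from has_derivative_compose[OF this F(1)]
    show ?thesis
      using linear_scale[OF has_derivative_linear[OF F(1)]]
      by (simp add: has_vector_derivative_def)
  qed
  define w where "w x = K * exp ((norm v)\<^sup>2) * exp (- (1/2) * (norm x)\<^sup>2)" for x :: 'a
  have bound: "norm (g n x) \<le> w x" for n x
  proof -
    \<comment> \<open>mean value inequality on the segment from \<open>x\<close> to \<open>x + h n *\<^sub>R v\<close>, along which \<open>w x\<close> bounds the derivative\<close>
    have "norm (F (x + h n *\<^sub>R v) - F (x + 0 *\<^sub>R v)) \<le> w x * h n - w x * 0"
    proof (rule differentiable_bound_general[where f' = "\<lambda>t. D (x + t *\<^sub>R v) v" and \<phi>' = "\<lambda>_. w x"])
      show "0 < h n" by (rule h)
      show "continuous_on {0..h n} (\<lambda>t. F (x + t *\<^sub>R v))"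
        using line has_vector_derivative_continuous by (intro continuous_at_imp_continuous_on) blast
      show "continuous_on {0..h n} (\<lambda>t. w x * t)" by (intro continuous_intros)
      show "((\<lambda>t. w x * t) has_vector_derivative w x) (at t)" for t
        by (auto intro!: derivative_eq_intros simp: has_real_derivative_iff_has_vector_derivative[symmetric])
      show "norm (D (x + t *\<^sub>R v) v) \<le> w x" if t: "0 < t" "t < h n" for t
      proof -
        have t1: "\<bar>t\<bar> \<le> 1" using t h(2)[of n] by auto
        have "norm x \<le> norm (x + t *\<^sub>R v) + norm v"
        proof -
          have "norm x \<le> norm (x + t *\<^sub>R v) + norm (t *\<^sub>R v)"
            using norm_triangle_ineq4[of "x + t *\<^sub>R v" "t *\<^sub>R v"] by simp
          also have "norm (t *\<^sub>R v) \<le> norm v"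
            using t1 by (simp add: mult_left_le_one_le)
          finally show ?thesis by simp
        qed
        then have "(norm x)\<^sup>2 \<le> (norm (x + t *\<^sub>R v) + norm v)\<^sup>2"
          by (intro power_mono) auto
        also have "\<dots> \<le> 2 * (norm (x + t *\<^sub>R v))\<^sup>2 + 2 * (norm v)\<^sup>2"
          using sum_squares_bound[of "norm (x + t *\<^sub>R v)" "norm v"] by (simp add: power2_sum)
        finally have "- 1 * (norm (x + t *\<^sub>R v))\<^sup>2 \<le> (norm v)\<^sup>2 + - (1/2) * (norm x)\<^sup>2" by simp
        then have "exp (- 1 * (norm (x + t *\<^sub>R v))\<^sup>2) \<le> exp ((norm v)\<^sup>2) * exp (- (1/2) * (norm x)\<^sup>2)"
          by (simp flip: exp_add)
        then show ?thesis
          unfolding w_def using order_trans[OF D(2)[of "x + t *\<^sub>R v"] mult_left_mono[OF _ K]]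
          by (simp add: mult.assoc)
      qed
    qed (rule line)
    then show ?thesis
      using h(1)[of n] by (simp add: g_def divide_simps mult.commute)
  qed
  have meas: "F \<in> borel_measurable lborel" "(\<lambda>x. D x v) \<in> borel_measurable lborel"
    using F(2) D(1) by (auto intro: borel_measurable_continuous_onI)
  have int_g: "(\<integral>x. g n x \<partial>lborel) = 0" for n
    unfolding g_def using integrable_translate[OF F(2), of "h n *\<^sub>R v"] F(2)
    by simp
  have "(\<lambda>n. \<integral>x. g n x \<partial>lborel) \<longlonglongrightarrow> (\<integral>x. D x v \<partial>lborel)"
  proof (rule integral_dominated_convergence[where w = w])
    show "(\<lambda>x. D x v) \<in> borel_measurable lborel" by (rule meas)
    show "g n \<in> borel_measurable lborel" for n
      unfolding g_def[abs_def]
      using integrable_translate(1)[OF F(2), of "h n *\<^sub>R v", THEN borel_measurable_integrable] meas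
      by measurable
    show "integrable lborel w"
      unfolding w_def[abs_def] by (intro integrable_mult_right integrable_exp_neg_norm_sq) simp
    show "AE x in lborel. (\<lambda>n. g n x) \<longlonglongrightarrow> D x v"
    proof (intro AE_I2)
      fix x
      have "((\<lambda>t. F (x + t *\<^sub>R v)) has_vector_derivative D x v) (at 0)"
        using line[of x 0] by simp
      then have "((\<lambda>t. norm (F (x + t *\<^sub>R v) - F x - t *\<^sub>R D x v) / norm t) \<longlongrightarrow> 0) (at 0)"
        unfolding has_vector_derivative_def has_derivative_at by simp
      moreover have "(\<forall>\<^sub>F t in at 0. norm (F (x + t *\<^sub>R v) - F x - t *\<^sub>R D x v) / norm t =
          norm ((F (x + t *\<^sub>R v) - F x) /\<^sub>R t - D x v))"
        unfolding eventually_at_filter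
      proof (intro always_eventually allI impI)
        fix t :: real assume t: "t \<noteq> 0"
        then have "(F (x + t *\<^sub>R v) - F x) /\<^sub>R t - D x v = (F (x + t *\<^sub>R v) - F x - t *\<^sub>R D x v) /\<^sub>R t"
          by (simp add: scaleR_diff_right)
        then show "norm (F (x + t *\<^sub>R v) - F x - t *\<^sub>R D x v) / norm t =
          norm ((F (x + t *\<^sub>R v) - F x) /\<^sub>R t - D x v)"
          by (simp add: divide_inverse mult.commute)
      qed
      ultimately have "((\<lambda>t. norm ((F (x + t *\<^sub>R v) - F x) /\<^sub>R t - D x v)) \<longlongrightarrow> 0) (at 0)"
        by (rule Lim_transform_eventually)
      then have "((\<lambda>t. (F (x + t *\<^sub>R v) - F x) /\<^sub>R t) \<longlongrightarrow> D x v) (at 0)"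
        by (subst Lim_null) (simp add: tendsto_norm_zero_iff)
      moreover have "filterlim h (at 0) sequentially"
        unfolding filterlim_at using h0 h(1) by (auto simp: less_imp_neq[symmetric])
      ultimately show "(\<lambda>n. g n x) \<longlonglongrightarrow> D x v"
        unfolding g_def by (rule filterlim_compose)
    qed
    show "AE x in lborel. norm (g n x) \<le> w x" for n
      using bound by simp
  qed
  with int_g show ?thesis
    using LIMSEQ_unique[of "\<lambda>_. 0::complex" 0] by simp
qed

section \<open>Wirtinger derivatives against the Gaussian\<close>

lemma (in differential_algebra) smooth_mono: "m \<le> n \<Longrightarrow> smooth n f \<Longrightarrow> smooth m f"
  by (induction rule: inc_induct) (blast intro: smooth_SucD)+

lemma temperedE:
  assumes "tempered (Suc n) f"
  obtains D where "moderate f" "\<And>x. (f has_derivative D x) (at x)" "\<And>v. tempered n (\<lambda>x. D x v)"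
  using assms by auto

text \<open>
  The operator \<open>\<partial>/\<partial>z i = (\<partial>/\<partial>x i - \<i> \<partial>/\<partial>y i) / 2\<close> on functions that are differentiable in the real sense. Unlike
  complex partial derivatives it makes sense for the non-holomorphic powers \<open>|P k|^(2t)\<close>.
\<close>

definition wirtinger :: "'n::finite \<Rightarrow> (complex^'n \<Rightarrow> complex) \<Rightarrow> complex^'n \<Rightarrow> complex" where
  "wirtinger i f x =
     (frechet_derivative f (at x) (axis i 1) - \<i> * frechet_derivative f (at x) (axis i \<i>)) / 2"

lemma wirtinger_eq:
  assumes "(f has_derivative D) (at x)"
  shows "wirtinger i f x = (D (axis i 1) - \<i> * D (axis i \<i>)) / 2"
  using frechet_derivative_at[OF assms] by (simp add: wirtinger_def)

lemma tempered_wirtinger: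
  assumes "tempered (Suc n) f" shows "tempered n (wirtinger i f)"
proof -
  obtain D where "moderate f" and D: "\<And>x. (f has_derivative D x) (at x)" "\<And>v. tempered n (\<lambda>x. D x v)"
    using assms by auto
  have "wirtinger i f = (\<lambda>x. (D x (axis i 1) + (- \<i>) * D x (axis i \<i>)) * (1/2))"
    using wirtinger_eq[OF D(1)] by (auto simp: fun_eq_iff)
  moreover have "tempered n (\<lambda>x. (D x (axis i 1) + (- \<i>) * D x (axis i \<i>)) * (1/2))"
    by (intro tempered.smooth_mult tempered.smooth_add tempered.smooth_const D(2))
  ultimately show ?thesis by simp
qed

lemma has_derivative_gauss:
  "((\<lambda>x. complex_of_real (gauss x)) has_derivative (\<lambda>v. of_real (- (4 * pi) * (x \<bullet> v) * gauss x))) (at x)"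
proof -
  have "(gauss has_derivative (\<lambda>v. - (4 * pi) * (x \<bullet> v) * gauss x)) (at x)"
    unfolding gauss_eq[abs_def] power2_norm_eq_inner
    by (auto intro!: derivative_eq_intros simp: inner_commute algebra_simps)
  from has_derivative_of_real[OF this] show ?thesis .
qed

text \<open>
  The derivative of the Gaussian in direction \<open>v\<close> is \<open>- 4\<pi> (x \<bullet> v)\<close> times the Gaussian.
\<close>

lemma gaussian_directional_by_parts:
  fixes f :: "complex^'n::finite \<Rightarrow> complex"
  assumes f: "moderate f" "\<And>x. (f has_derivative D x) (at x)" "moderate (\<lambda>x. D x v)"
  shows "(\<integral>x. D x v * of_real (gauss x) \<partial>lborel) =
         4 * pi * (\<integral>x. f x * of_real (x \<bullet> v) * of_real (gauss x) \<partial>lborel)"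
proof -
  let ?m = "\<lambda>x. D x v + of_real (- (4 * pi)) * (f x * of_real (x \<bullet> v))"
  have lin: "bounded_linear (\<lambda>x. complex_of_real (x \<bullet> v))"
    by (intro bounded_linear_compose[OF bounded_linear_of_real] bounded_linear_inner_left)
  have mod: "moderate (\<lambda>x. f x * of_real (x \<bullet> v))"
    using f(1) moderate_bounded_linear[OF lin] by (rule moderate_mult)
  then have m: "moderate ?m"
    by (intro moderate_add moderate_mult[OF moderate_const] f)
  then obtain K where K: "\<And>x. norm (?m x) * gauss x \<le> K * exp (- 1 * (norm x)\<^sup>2)"
    using moderate_gauss_bound by blast
  have "(\<integral>x. ?m x * of_real (gauss x) \<partial>lborel) = 0"
  proof -
    let ?E = "\<lambda>x v. f x * of_real (- (4 * pi) * (x \<bullet> v) * gauss x) + D x v * of_real (gauss x)"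
    have E: "((\<lambda>x. f x * of_real (gauss x)) has_derivative ?E x) (at x)" for x
      using has_derivative_mult[OF f(2) has_derivative_gauss] .
    have eq: "?E x v = ?m x * of_real (gauss x)" for x
      by (simp add: algebra_simps)
    have "(\<integral>x. ?E x v \<partial>lborel) = 0"
    proof (rule integral_directional_derivative_eq_0[OF E])
      show "integrable lborel (\<lambda>x. f x * complex_of_real (gauss x))"
        using f(1) by (rule integrable_moderate_gauss)
      show "continuous_on UNIV (\<lambda>x. ?E x v)"
        unfolding eq using m by (auto simp: moderate_def intro!: continuous_intros continuous_gauss)
      show "cmod (?E x v) \<le> K * exp (- 1 * (norm x)\<^sup>2)" for x
        unfolding eq norm_mult using K[of x] gauss_pos[of x] by simp
    qed
    then show ?thesis unfolding eq .
  qed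
  moreover have "(\<integral>x. ?m x * of_real (gauss x) \<partial>lborel) =
     (\<integral>x. D x v * of_real (gauss x) \<partial>lborel) +
     of_real (- (4 * pi)) * (\<integral>x. f x * of_real (x \<bullet> v) * of_real (gauss x) \<partial>lborel)"
    unfolding distrib_right mult.assoc[of "complex_of_real (- (4 * pi))"]
    using integrable_moderate_gauss[OF f(3)] integrable_moderate_gauss[OF mod]
    by (subst Bochner_Integration.integral_add) (auto simp: integrable_mult_right)
  ultimately show ?thesis by simp
qed

text \<open>
  The two real directions of the \<open>i\<close>-th coordinate combine: \<open>x \<bullet> axis i 1 - \<i> (x \<bullet> axis i \<i>)\<close> is \<open>cnj (x $ i)\<close>.
\<close>

lemma gaussian_wirtinger_by_parts:
  fixes f :: "complex^'n::finite \<Rightarrow> complex"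
  assumes f: "tempered (Suc 0) f"
  shows "(\<integral>x. wirtinger i f x * of_real (gauss x) \<partial>lborel) =
         2 * pi * (\<integral>x. f x * cnj (x $ i) * of_real (gauss x) \<partial>lborel)"
proof -
  obtain D where D: "moderate f" "\<And>x. (f has_derivative D x) (at x)" "\<And>v. moderate (\<lambda>x. D x v)"
    using temperedE[OF f] by (metis smooth_class.simps(1))
  let ?I = "\<lambda>h. \<integral>x. h x * complex_of_real (gauss x) \<partial>lborel"
  have int: "integrable lborel (\<lambda>x. D x v * complex_of_real (gauss x))" for v
    by (rule integrable_moderate_gauss[OF D(3)])
  have int2: "integrable lborel (\<lambda>x. f x * of_real (x \<bullet> v) * complex_of_real (gauss x))" for v
  proof (rule integrable_moderate_gauss[OF moderate_mult[OF D(1) moderate_bounded_linear]])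
    show "bounded_linear (\<lambda>x. complex_of_real (x \<bullet> v))"
      by (intro bounded_linear_compose[OF bounded_linear_of_real] bounded_linear_inner_left)
  qed
  have "?I (wirtinger i f) = (\<integral>x. (D x (axis i 1) * of_real (gauss x)
          - \<i> * (D x (axis i \<i>) * of_real (gauss x))) / 2 \<partial>lborel)"
    by (intro Bochner_Integration.integral_cong) (auto simp: wirtinger_eq[OF D(2)] algebra_simps diff_divide_distrib)
  also have "\<dots> = (?I (\<lambda>x. D x (axis i 1)) - \<i> * ?I (\<lambda>x. D x (axis i \<i>))) / 2"
    using int by (simp add: Bochner_Integration.integral_diff)
  also have "\<dots> = 2 * pi * (?I (\<lambda>x. f x * of_real (x \<bullet> axis i 1)) - \<i> * ?I (\<lambda>x. f x * of_real (x \<bullet> axis i \<i>)))"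
    unfolding gaussian_directional_by_parts[OF D] by (simp add: algebra_simps diff_divide_distrib)
  also have "?I (\<lambda>x. f x * of_real (x \<bullet> axis i 1)) - \<i> * ?I (\<lambda>x. f x * of_real (x \<bullet> axis i \<i>)) =
     (\<integral>x. f x * of_real (x \<bullet> axis i 1) * of_real (gauss x)
        - \<i> * (f x * of_real (x \<bullet> axis i \<i>) * of_real (gauss x)) \<partial>lborel)"
    using int2 by (simp add: Bochner_Integration.integral_diff)
  also have "\<dots> = ?I (\<lambda>x. f x * cnj (x $ i))"
  proof (intro Bochner_Integration.integral_cong refl)
    fix x :: "complex^'n"
    have "cnj (x $ i) = of_real (x \<bullet> axis i 1) - \<i> * of_real (x \<bullet> axis i \<i>)"
      by (simp add: inner_axis inner_complex_def complex_eq_iff)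
    show "f x * of_real (x \<bullet> axis i 1) * of_real (gauss x)
        - \<i> * (f x * of_real (x \<bullet> axis i \<i>) * of_real (gauss x)) =
      f x * cnj (x $ i) * complex_of_real (gauss x)"
      unfolding \<open>cnj (x $ i) = _\<close> by (simp add: algebra_simps)
  qed
  finally show ?thesis .
qed

definition antilinear :: "(complex^'n::finite \<Rightarrow> complex) \<Rightarrow> bool" where
  "antilinear T \<longleftrightarrow> (\<forall>c v. T (c *s v) = cnj c * T v)"

lemma axis_imaginary_unit: "axis i \<i> = \<i> *s axis i (1::complex)"
  by (simp add: vec_eq_iff axis_def)

text \<open>
  Antiholomorphic factors are constants for Wirtinger derivatives. This is used twice: for the conjugate
  coordinates produced by integration by parts, and for the antiholomorphic half of \<open>|P k|^(2t)\<close>.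
\<close>

lemma wirtinger_mult_antiholomorphic:
  assumes f: "(f has_derivative D) (at x)" and g: "(g has_derivative E) (at x)" "antilinear E"
  shows "wirtinger i (\<lambda>x. f x * g x) x = wirtinger i f x * g x"
proof -
  have "E (axis i \<i>) = - \<i> * E (axis i 1)"
    using g(2) by (simp add: axis_imaginary_unit antilinear_def)
  then show ?thesis
    by (simp add: wirtinger_eq[OF has_derivative_mult[OF f g(1)]] wirtinger_eq[OF f] field_simps)
qed

definition cnj_monom :: "'n::finite list \<Rightarrow> complex^'n \<Rightarrow> complex" where
  "cnj_monom is x = prod_list (map (\<lambda>i. cnj (x $ i)) is)"

lemma cnj_monom_simps: "cnj_monom [] x = 1" "cnj_monom (i # is) x = cnj (x $ i) * cnj_monom is x"
  by (auto simp: cnj_monom_def)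

lemma tempered_cnj_monom: "tempered n (cnj_monom is)"
proof (induction "is")
  case Nil
  then show ?case by (simp add: cnj_monom_simps[abs_def] tempered.smooth_const)
next
  case (Cons i "is")
  have "cnj_monom (i # is) = (\<lambda>x. cnj (x $ i) * cnj_monom is x)"
    by (simp add: cnj_monom_simps fun_eq_iff)
  moreover have "tempered n (\<lambda>x. cnj (x $ i) * cnj_monom is x)"
    by (intro tempered.smooth_mult tempered_cnj tempered_component Cons)
  ultimately show ?case by simp
qed

lemma antiholomorphic_cnj_monom: "\<exists>E. (cnj_monom is has_derivative E) (at x) \<and> antilinear E"
proof (induction "is")
  case Nil
  then show ?case by (auto simp: cnj_monom_simps[abs_def] antilinear_def intro!: exI[of _ "\<lambda>_. 0"])
next
  case (Cons i "is")
  then obtain E where E: "(cnj_monom is has_derivative E) (at x)" "antilinear E" by blast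
  have "((\<lambda>x. cnj (x $ i)) has_derivative (\<lambda>v. cnj (v $ i))) (at x)"
    by (intro has_derivative_cnj bounded_linear_imp_has_derivative bounded_linear_component)
  from has_derivative_mult[OF this E(1)]
  have "(cnj_monom (i # is) has_derivative (\<lambda>v. cnj (x $ i) * E v + cnj (v $ i) * cnj_monom is x)) (at x)"
    by (simp add: cnj_monom_simps(2)[abs_def])
  moreover have "antilinear (\<lambda>v. cnj (x $ i) * E v + cnj (v $ i) * cnj_monom is x)"
    using E(2) by (simp add: antilinear_def algebra_simps)
  ultimately show ?case by blast
qed

text \<open>
  By induction on the list of indices. The conjugate coordinates coming from the later derivatives pass
  through the first one because they are antiholomorphic.
\<close>

lemma gaussian_iterated_by_parts:
  fixes f :: "complex^'n::finite \<Rightarrow> complex"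
  assumes "tempered (length is) f"
  shows "(\<integral>x. fold wirtinger is f x * of_real (gauss x) \<partial>lborel) =
         of_real ((2 * pi) ^ length is) * (\<integral>x. f x * cnj_monom is x * of_real (gauss x) \<partial>lborel)"
  using assms
proof (induction "is" arbitrary: f)
  case (Cons i "is")
  obtain D where D: "\<And>x. (f has_derivative D x) (at x)" using temperedE Cons.prems by (metis length_Cons)
  have prod: "wirtinger i f x * cnj_monom is x = wirtinger i (\<lambda>x. f x * cnj_monom is x) x" for x
    using antiholomorphic_cnj_monom[of "is" x] wirtinger_mult_antiholomorphic[OF D] by metis
  have "tempered (Suc 0) (\<lambda>x. f x * cnj_monom is x)"
    using Cons.prems tempered.smooth_mono[of "Suc 0" "length (i # is)" f]
    by (intro tempered.smooth_mult tempered_cnj_monom) auto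
  from gaussian_wirtinger_by_parts[OF this, of i]
  have "(\<integral>x. wirtinger i f x * cnj_monom is x * of_real (gauss x) \<partial>lborel) =
        2 * pi * (\<integral>x. f x * cnj_monom (i # is) x * of_real (gauss x) \<partial>lborel)"
    unfolding prod by (simp add: cnj_monom_simps mult_ac)
  moreover have "tempered (length is) (wirtinger i f)"
    using Cons.prems by (intro tempered_wirtinger) simp
  ultimately show ?case
    using Cons.IH[of "wirtinger i f"] by (simp add: algebra_simps)
qed (simp add: cnj_monom_simps)

subsection \<open>Comparison with holomorphic partial derivatives\<close>

lemma holo_class_cong:
  assumes "open U" "\<And>x. x \<in> U \<Longrightarrow> f x = g x" "holo_class U n f"
  shows "holo_class U n g"
proof (cases n)
  case (Suc m)
  with assms(3) obtain D where "\<And>x. x \<in> U \<Longrightarrow> (f has_derivative D x) (at x) \<and> complex_linear (D x)"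
    "\<And>v. holo_class U m (\<lambda>x. D x v)" by auto
  then show ?thesis
    unfolding Suc smooth_class.simps
    by (intro conjI exI[of _ D])
       (use assms in \<open>auto intro: has_derivative_transform_within_open\<close>)
qed simp

text \<open>
  Restriction to a line in a coordinate direction reduces several variables to one.
\<close>

lemma has_field_derivative_along_axis:
  fixes f :: "complex^'v::finite \<Rightarrow> complex"
  assumes "(f has_derivative D) (at (x + w *s axis i 1))" "\<And>c v. D (c *s v) = c * D v"
  shows "((\<lambda>t. f (x + t *s axis i 1)) has_field_derivative D (axis i 1)) (at w)"
proof -
  have "bounded_linear (\<lambda>t::complex. t *s axis i (1::complex))"
    by (rule linear_conv_bounded_linear[THEN iffD1], rule linearI)
       (simp_all add: vec_eq_iff algebra_simps)
  from has_derivative_add[OF has_derivative_const bounded_linear_imp_has_derivative[OF this]]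
  have "((\<lambda>t. x + t *s axis i 1) has_derivative (\<lambda>t. t *s axis i (1::complex))) (at w)" by simp
  from has_derivative_compose[OF this assms(1)]
  show ?thesis
    using assms(2) by (simp add: has_field_derivative_def mult.commute[of _ "D (axis i 1)"])
qed

lemma partial_deriv_eq:
  assumes "(f has_derivative D) (at x)" "complex_linear D"
  shows "partial_deriv i f x = D (axis i 1)"
  unfolding partial_deriv_def using assms
  by (intro DERIV_imp_deriv has_field_derivative_along_axis) (auto simp: complex_linear_def)

lemma wirtinger_holomorphic:
  assumes "(f has_derivative D) (at x)" "complex_linear D"
  shows "wirtinger i f x = D (axis i 1)"
proof -
  have "D (axis i \<i>) = \<i> * D (axis i 1)"
    using assms(2) by (simp add: axis_imaginary_unit complex_linear_def)
  then show ?thesis by (simp add: wirtinger_eq[OF assms(1)])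
qed

text \<open>
  Here \<open>f\<close> is defined globally, while its factorisation into a holomorphic \<open>H\<close> and an antiholomorphic \<open>A\<close>
  exists only on \<open>U\<close>: for \<open>f = \<Prod>k. |P k|^(2 t k)\<close> it depends on a choice of logarithms of the \<open>P k\<close>.
\<close>

lemma iterated_wirtinger_eq_partial_deriv:
  assumes U: "open U" and H: "holo_class U (length is) H"
    and A: "\<And>x. x \<in> U \<Longrightarrow> \<exists>E. (A has_derivative E) (at x) \<and> antilinear E"
    and f: "\<And>x. x \<in> U \<Longrightarrow> f x = H x * A x" and x: "x \<in> U"
  shows "fold wirtinger is f x = fold partial_deriv is H x * A x"
  using H f x
proof (induction "is" arbitrary: f H x)
  case (Cons i "is")
  from Cons.prems(1) obtain D where
    D: "\<And>x. x \<in> U \<Longrightarrow> (H has_derivative D x) (at x) \<and> complex_linear (D x)"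
       "\<And>v. holo_class U (length is) (\<lambda>x. D x v)" by auto
  have pd: "partial_deriv i H x = D x (axis i 1)" if "x \<in> U" for x
    using D(1)[OF that] by (auto intro: partial_deriv_eq)
  have "holo_class U (length is) (partial_deriv i H)"
    by (rule holo_class_cong[OF U _ D(2)[of "axis i 1"]]) (simp add: pd)
  moreover have "wirtinger i f x = partial_deriv i H x * A x" if x: "x \<in> U" for x
  proof -
    from A[OF x] obtain E where E: "(A has_derivative E) (at x)" "antilinear E" by blast
    have HA: "((\<lambda>x. H x * A x) has_derivative (\<lambda>v. H x * E v + D x v * A x)) (at x)"
      using has_derivative_mult[OF _ E(1)] D(1)[OF x] by blast
    have "(f has_derivative (\<lambda>v. H x * E v + D x v * A x)) (at x)"
      by (rule has_derivative_transform_within_open[OF HA U x]) (use Cons.prems in auto)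
    then have "wirtinger i f x = wirtinger i (\<lambda>x. H x * A x) x"
      using HA by (simp add: wirtinger_eq)
    also have "\<dots> = wirtinger i H x * A x"
      using D(1)[OF x] E by (intro wirtinger_mult_antiholomorphic) auto
    finally show ?thesis
      using D(1)[OF x] pd[OF x] wirtinger_holomorphic by metis
  qed
  ultimately show ?case
    using Cons.IH[of "partial_deriv i H" "wirtinger i f"] Cons.prems by simp
qed auto

section \<open>Zero sets of homogeneous polynomials\<close>

lemma peval_scale:
  assumes "homogeneous_poly p"
  shows "peval p (($) (c *s x)) = c ^ tdeg p * peval p (($) x)"
proof -
  have "(\<Prod>v\<in>UNIV. (c * x $ v) ^ Poly_Mapping.lookup e v) =
        c ^ mdeg e * (\<Prod>v\<in>UNIV. x $ v ^ Poly_Mapping.lookup e v)"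
    for e
    by (simp add: mdeg_def power_mult_distrib prod.distrib power_sum)
  then show ?thesis
    using assms by (auto simp: peval_def homogeneous_poly_def sum_distrib_left mult_ac intro!: sum.cong)
qed

lemma mdeg_le_tdeg: "e \<in> Poly_Mapping.keys p \<Longrightarrow> mdeg e \<le> tdeg p"
  by (auto simp: tdeg_def intro!: Max_ge)

lemma peval_on_line:
  fixes p :: "'n::finite cpoly"
  shows "\<exists>q. degree q \<le> tdeg p \<and> (\<forall>t. poly q t = peval p (($) (x + t *s y)))"
proof (intro exI conjI allI)
  let ?q = "\<Sum>e\<in>Poly_Mapping.keys p. [:Poly_Mapping.lookup p e:] *
     (\<Prod>v\<in>UNIV. [:x $ v, y $ v:] ^ Poly_Mapping.lookup e v)"
  show "degree ?q \<le> tdeg p"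
  proof (rule degree_sum_le)
    fix e assume e: "e \<in> Poly_Mapping.keys p"
    have "degree (\<Prod>v\<in>UNIV. [:x $ v, y $ v:] ^ Poly_Mapping.lookup e v) \<le>
          (\<Sum>v\<in>UNIV. degree ([:x $ v, y $ v:] ^ Poly_Mapping.lookup e v))"
      by (rule order_trans[OF degree_prod_sum_le]) auto
    also have "\<dots> \<le> mdeg e"
      unfolding mdeg_def
    proof (intro sum_mono)
      fix v
      have "degree ([:x $ v, y $ v:] ^ Poly_Mapping.lookup e v) \<le> degree [:x $ v, y $ v:] * Poly_Mapping.lookup e v"
        by (rule degree_power_le)
      also have "\<dots> \<le> 1 * Poly_Mapping.lookup e v" by (intro mult_right_mono) auto
      finally show "degree ([:x $ v, y $ v:] ^ Poly_Mapping.lookup e v) \<le> Poly_Mapping.lookup e v" by simp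
    qed
    also have "\<dots> \<le> tdeg p" using e by (rule mdeg_le_tdeg)
    finally show "degree ([:Poly_Mapping.lookup p e:] * (\<Prod>v\<in>UNIV. [:x $ v, y $ v:] ^ Poly_Mapping.lookup e v)) \<le> tdeg p"
      using degree_mult_le[of "[:Poly_Mapping.lookup p e:]" "\<Prod>v\<in>UNIV. [:x $ v, y $ v:] ^ Poly_Mapping.lookup e v"]
      by simp
  qed simp
  show "poly ?q t = peval p (($) (x + t *s y))" for t
    by (simp add: peval_def poly_sum poly_prod algebra_simps)
qed

text \<open>
  On a line with direction \<open>y\<close> the polynomial restricts to a polynomial in one variable of degree at most
  \<open>tdeg p\<close>. It is not the zero polynomial: by homogeneity its values at large parameters \<open>1/t\<close> are those of \<open>p\<close>
  near \<open>y\<close>, up to a power of \<open>t\<close>.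
\<close>

lemma finitely_many_zeros_on_line:
  assumes "homogeneous_poly p" "peval p (($) y) \<noteq> 0"
  shows "finite {t. peval p (($) (x + t *s y)) = 0}" "card {t. peval p (($) (x + t *s y)) = 0} \<le> tdeg p"
proof -
  obtain q where q: "degree q \<le> tdeg p" "\<And>t. poly q t = peval p (($) (x + t *s y))"
    using peval_on_line by blast
  obtain r where r: "\<And>t. poly r t = peval p (($) (y + t *s x))"
    using peval_on_line by blast
  have "poly r 0 \<noteq> 0" using r[of 0] assms(2) by simp
  then have "finite {t. poly r t = 0}"
    by (intro poly_roots_finite) auto
  then have "finite (insert 0 {t. poly r t = 0})" by simp
  then obtain t where t: "t \<notin> insert 0 {t. poly r t = 0}"
    using infinite_UNIV_char_0[where 'a = complex] ex_new_if_finite by blast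
  have "x + inverse t *s y = inverse t *s (y + t *s x)"
    using t by (simp add: vector_add_ldistrib add.commute)
  then have "poly q (inverse t) \<noteq> 0"
    using t r[of t] by (simp only: q(2) peval_scale[OF assms(1)]) simp
  then have "q \<noteq> 0" by auto
  then show "finite {t. peval p (($) (x + t *s y)) = 0}" "card {t. peval p (($) (x + t *s y)) = 0} \<le> tdeg p"
    using q card_poly_roots_bound[of q] poly_roots_finite[of q] by auto
qed

text \<open>
  If a bounded piece of the zero set had positive measure, so would its translates by \<open>y / k\<close>, which all lie
  in one ball. But a point \<open>x\<close> belongs to at most \<open>tdeg p\<close> of them, since each membership is a zero on the line
  through \<open>x\<close> in direction \<open>y\<close>; hence the total measure of arbitrarily many translates is bounded.
\<close>

lemma AE_peval_nonzero:
  fixes p :: "'n::finite cpoly"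
  assumes hom: "homogeneous_poly p" and y: "peval p (($) y) \<noteq> 0"
  shows "AE x in lborel. peval p (($) (x :: complex^'n)) \<noteq> 0"
proof -
  have cont: "continuous_on UNIV (\<lambda>x. peval p (($) (x :: complex^'n)))"
    using tempered_peval[of 0 p] by (simp add: moderate_def)
  define A where "A = {x :: complex^'n. peval p (($) x) = 0}"
  have A: "A \<in> sets borel"
    unfolding A_def using closed_Collect_eq[OF cont continuous_on_const] by (rule borel_closed)
  define C where "C R = A \<inter> cball 0 (real R)" for R :: nat
  have C: "C R \<in> sets borel" for R using A by (auto simp: C_def)
  define v where "v k = (1 / real (Suc k)) *\<^sub>R y" for k
  have "emeasure lborel (C R) = 0" for R
  proof (rule ccontr)
    assume nz: "emeasure lborel (C R) \<noteq> 0"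
    define Ck where "Ck k = (\<lambda>x. x + v k) -` C R" for k
    have Ck: "Ck k \<in> sets borel" for k
      unfolding Ck_def using C[of R] measurable_sets[of "\<lambda>x. x + v k" borel borel "C R"] by simp
    have em: "emeasure lborel (Ck k) = emeasure lborel (C R)" for k
    proof -
      have "emeasure lborel (C R) = emeasure (distr lborel borel ((+) (v k))) (C R)"
        by (simp add: lborel_distr_plus)
      also have "\<dots> = emeasure lborel (Ck k)"
        using C[of R] by (subst emeasure_distr) (auto simp: Ck_def vimage_def add.commute)
      finally show ?thesis ..
    qed
    let ?B = "cball (0::complex^'n) (real R + norm y)"
    have le: "(\<Sum>k<N. indicator (Ck k) x) \<le> of_nat (tdeg p) * (indicator ?B x :: ennreal)" for N x
    proof (cases "x \<in> ?B")
      case False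
      have "x \<notin> Ck k" for k
      proof
        assume "x \<in> Ck k"
        then have "norm (x + v k) \<le> real R" by (simp add: Ck_def C_def)
        moreover have "norm (v k) \<le> norm y"
          by (simp add: v_def divide_le_eq algebra_simps)
        ultimately have "norm x \<le> real R + norm y"
          using norm_triangle_ineq4[of "x + v k" "v k"] by simp
        with False show False by simp
      qed
      then show ?thesis by simp
    next
      case True
      let ?T = "{t. peval p (($) (x + t *s y)) = 0}"
      have "(\<Sum>k<N. indicator (Ck k) x) = (of_nat (card {k\<in>{..<N}. x \<in> Ck k}) :: ennreal)"
        by (simp add: indicator_def sum.If_cases Int_def)
      also have "card {k\<in>{..<N}. x \<in> Ck k} \<le> card ?T"
      proof (rule card_inj_on_le[where f = "\<lambda>k. 1 / of_nat (Suc k)"])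
        show "inj_on (\<lambda>k. 1 / of_nat (Suc k) :: complex) {k\<in>{..<N}. x \<in> Ck k}"
          by (auto simp: inj_on_def simp del: of_nat_Suc)
        show "(\<lambda>k. 1 / of_nat (Suc k)) ` {k\<in>{..<N}. x \<in> Ck k} \<subseteq> ?T"
        proof safe
          fix k assume "x \<in> Ck k"
          moreover have "v k = (1 / of_nat (Suc k)) *s y"
            by (simp add: v_def vec_eq_iff, simp add: scaleR_conv_of_real)
          ultimately show "peval p (($) (x + (1 / of_nat (Suc k)) *s y)) = 0"
            by (simp add: Ck_def C_def A_def)
        qed
        show "finite ?T" by (rule finitely_many_zeros_on_line[OF assms])
      qed
      also have "card ?T \<le> tdeg p" by (rule finitely_many_zeros_on_line[OF assms])
      finally show ?thesis using True by simp
    qed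
    have bnd: "of_nat N * emeasure lborel (C R) \<le> of_nat (tdeg p) * emeasure lborel ?B" for N
    proof -
      have "of_nat N * emeasure lborel (C R) = (\<Sum>k<N. emeasure lborel (Ck k))"
        by (simp add: em)
      also have "\<dots> = (\<integral>\<^sup>+x. (\<Sum>k<N. indicator (Ck k) x) \<partial>lborel)"
        using Ck by (subst nn_integral_sum) auto
      also have "\<dots> \<le> (\<integral>\<^sup>+x. of_nat (tdeg p) * indicator ?B x \<partial>lborel)"
        by (intro nn_integral_mono le)
      also have "\<dots> = of_nat (tdeg p) * emeasure lborel ?B"
        by (rule nn_integral_cmult_indicator) simp
      finally show ?thesis .
    qed
    have fin: "of_nat (tdeg p) * emeasure lborel ?B < top"
      using emeasure_lborel_cball_finite[of "0::complex^'n" "real R + norm y"]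
      by (simp add: ennreal_mult_less_top of_nat_less_top less_top)
    have fC: "emeasure lborel (C R) < top"
      using bnd[of 1] fin by (simp add: order.strict_trans1)
    define c where "c = enn2real (emeasure lborel (C R))"
    define M where "M = enn2real (of_nat (tdeg p) * emeasure lborel ?B)"
    have c: "c > 0" "emeasure lborel (C R) = ennreal c"
      using fC nz by (auto simp: c_def enn2real_positive_iff zero_less_iff_neq_zero)
    have M: "M \<ge> 0" "of_nat (tdeg p) * emeasure lborel ?B = ennreal M"
      using fin by (auto simp: M_def)
    have "real N * c \<le> M" for N
      using bnd[of N] c M by (simp add: ennreal_of_nat_eq_real_of_nat flip: ennreal_mult)
    moreover obtain N where "M < real N * c"
      using reals_Archimedean3[OF c(1)] by blast
    ultimately show False by (meson not_le)
  qed
  then have "C R \<in> null_sets lborel" for R using C by auto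
  then have "(\<Union>R. C R) \<in> null_sets lborel" by auto
  moreover have "A \<subseteq> (\<Union>R. C R)"
  proof
    fix x assume "x \<in> A"
    moreover obtain R :: nat where "norm x \<le> real R" using real_arch_simple by blast
    ultimately show "x \<in> (\<Union>R. C R)" by (auto simp: C_def)
  qed
  ultimately show ?thesis
    by (intro AE_I[of _ _ "\<Union>R. C R"]) (auto simp: A_def null_sets_def)
qed

section \<open>The functional equation of the zeta integral\<close>

text \<open>
  An exponent vector written out as the sequence of coordinates in which \<open>multi_deriv\<close> differentiates; lists
  permit induction over one derivative at a time.
\<close>

definition index_list :: "('n::{finite,linorder} \<Rightarrow>\<^sub>0 nat) \<Rightarrow> 'n list" where
  "index_list e = concat (map (\<lambda>i. replicate (Poly_Mapping.lookup e i) i) (sorted_list_of_set UNIV))"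

lemma multi_deriv_eq_fold: "multi_deriv e f = fold partial_deriv (index_list e) f"
proof -
  have "fold (\<lambda>i. partial_deriv i ^^ Poly_Mapping.lookup e i) is f =
        fold partial_deriv (concat (map (\<lambda>i. replicate (Poly_Mapping.lookup e i) i) is)) f" for "is"
    by (induction "is" arbitrary: f) (simp_all add: fold_replicate)
  then show ?thesis by (simp add: multi_deriv_def index_list_def)
qed

lemma length_index_list: "length (index_list e) = mdeg e"
proof -
  have "length (concat (map (\<lambda>i. replicate (Poly_Mapping.lookup e i) i) is)) =
        sum_list (map (Poly_Mapping.lookup e) is)" for "is"
    by (induction "is") auto
  then show ?thesis
    by (simp add: index_list_def mdeg_def sum_list_distinct_conv_sum_set)
qed

lemma cnj_monom_index_list:
  "cnj_monom (index_list e) x = cnj (\<Prod>v\<in>UNIV. x $ v ^ Poly_Mapping.lookup e v)"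
proof -
  have "prod_list (map (\<lambda>i. cnj (x $ i)) (concat (map (\<lambda>i. replicate (Poly_Mapping.lookup e i) i) is))) =
        prod_list (map (\<lambda>i. cnj (x $ i) ^ Poly_Mapping.lookup e i) is)" for "is"
    by (induction "is") (auto simp: prod_list_replicate)
  then show ?thesis
    by (simp add: cnj_monom_def index_list_def prod.distinct_set_conv_list[symmetric])
qed

lemma lookup_cnj_poly: "Poly_Mapping.lookup (cnj_poly p) e = cnj (Poly_Mapping.lookup p e)"
  by (simp add: cnj_poly_def Poly_Mapping.map.rep_eq when_def)

lemma keys_cnj_poly: "Poly_Mapping.keys (cnj_poly p) = Poly_Mapping.keys p"
  by (auto simp: in_keys_iff lookup_cnj_poly)

definition absprod :: "('r::finite \<Rightarrow> 'n::finite cpoly) \<Rightarrow> ('r \<Rightarrow> real) \<Rightarrow> complex^'n \<Rightarrow> real" where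
  "absprod P t x = (\<Prod>k\<in>UNIV. abs2pow (t k) (peval (P k) (($) x)))"

lemma tempered_fold_wirtinger:
  "tempered n g \<Longrightarrow> length is \<le> n \<Longrightarrow> tempered (n - length is) (fold wirtinger is g)"
proof (induction "is" arbitrary: n g)
  case (Cons i "is")
  then obtain m where m: "n = Suc m" by (cases n) auto
  with Cons.prems have "tempered m (wirtinger i g)" by (intro tempered_wirtinger) simp
  from Cons.IH[OF this] m Cons.prems show ?case by simp
qed simp

text \<open>
  Homogeneity makes the powers of \<open>2\<pi>\<close> of all monomials agree, so that they can be taken out.
\<close>

lemma gaussian_polynomial_by_parts:
  fixes p :: "'n::{finite,linorder} cpoly"
  assumes hom: "homogeneous_poly p" and f: "tempered (tdeg p) f"
  shows "(\<integral>x. (\<Sum>e\<in>Poly_Mapping.keys p. cnj (Poly_Mapping.lookup p e) * fold wirtinger (index_list e) f x)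
              * of_real (gauss x) \<partial>lborel) =
         of_real ((2 * pi) ^ tdeg p) * (\<integral>x. f x * cnj (peval p (($) x)) * of_real (gauss x) \<partial>lborel)"
proof -
  have len: "length (index_list e) = tdeg p" if "e \<in> Poly_Mapping.keys p" for e
    using hom that by (simp add: length_index_list homogeneous_poly_def)
  have mod: "moderate (fold wirtinger (index_list e) f)" if "e \<in> Poly_Mapping.keys p" for e
    using tempered_fold_wirtinger[OF f, of "index_list e"] len[OF that] by simp
  have modf: "moderate (\<lambda>x. f x * cnj_monom is x)" for "is"
    using tempered.smooth_adm[OF f] tempered_cnj_monom[of 0 "is"] by (intro moderate_mult) auto
  let ?I = "\<lambda>h. \<integral>x. h x * complex_of_real (gauss x) \<partial>lborel"
  have "?I (\<lambda>x. \<Sum>e\<in>Poly_Mapping.keys p. cnj (Poly_Mapping.lookup p e) * fold wirtinger (index_list e) f x) =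
        (\<Sum>e\<in>Poly_Mapping.keys p. cnj (Poly_Mapping.lookup p e) * ?I (fold wirtinger (index_list e) f))"
    unfolding sum_distrib_right mult.assoc
    by (subst Bochner_Integration.integral_sum)
       (auto intro!: integrable_mult_right integrable_moderate_gauss mod)
  also have "\<dots> = (\<Sum>e\<in>Poly_Mapping.keys p. cnj (Poly_Mapping.lookup p e) *
       (of_real ((2 * pi) ^ tdeg p) * ?I (\<lambda>x. f x * cnj_monom (index_list e) x)))"
    using f len by (intro sum.cong refl) (simp add: gaussian_iterated_by_parts)
  also have "\<dots> = of_real ((2 * pi) ^ tdeg p) *
       (\<Sum>e\<in>Poly_Mapping.keys p. cnj (Poly_Mapping.lookup p e) * ?I (\<lambda>x. f x * cnj_monom (index_list e) x))"
    by (simp add: sum_distrib_left mult_ac)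
  also have "(\<Sum>e\<in>Poly_Mapping.keys p. cnj (Poly_Mapping.lookup p e) * ?I (\<lambda>x. f x * cnj_monom (index_list e) x)) =
       (\<integral>x. (\<Sum>e\<in>Poly_Mapping.keys p. cnj (Poly_Mapping.lookup p e) *
          (f x * cnj_monom (index_list e) x * of_real (gauss x))) \<partial>lborel)"
    by (subst Bochner_Integration.integral_sum)
       (auto intro!: integrable_mult_right integrable_moderate_gauss modf)
  also have "\<dots> = ?I (\<lambda>x. f x * cnj (peval p (($) x)))"
    by (intro Bochner_Integration.integral_cong refl)
       (simp add: peval_def cnj_monom_index_list sum_distrib_left sum_distrib_right mult_ac)
  finally show ?thesis .
qed

text \<open>
  Near \<open>x\<close> the quotients \<open>P k / P k x\<close> have positive real part, where the principal logarithm is holomorphic.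
\<close>

lemma local_logarithms:
  fixes P :: "'r::finite \<Rightarrow> 'n::finite cpoly"
  assumes "\<And>k. peval (P k) (($) x) \<noteq> 0"
  shows "\<exists>U L. open U \<and> x \<in> U \<and> (\<forall>k. holomorphic_sv_on (L k) U) \<and>
    (\<forall>k. \<forall>y\<in>U. exp (L k y) = peval (P k) (($) y))"
proof -
  let ?p = "\<lambda>k y. peval (P k) (($) (y :: complex^'n))"
  let ?q = "\<lambda>k y. ?p k y / ?p k x"
  let ?U = "\<Inter>k. {y. 0 < Re (?q k y)}"
  let ?L = "\<lambda>k y. Ln (?q k y) + Ln (?p k x)"
  have "continuous_on UNIV (?p k)" for k
    using tempered_peval[of 0 "P k"] by (simp add: moderate_def)
  then have "open ?U"
    using assms by (intro open_INT ballI open_Collect_less continuous_intros) auto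
  moreover have "x \<in> ?U" using assms by simp
  moreover have "exp (?L k y) = ?p k y" if "y \<in> ?U" for k y
  proof -
    have "0 < Re (?q k y)" using that by blast
    then have "?q k y \<noteq> 0" by (metis less_irrefl zero_complex.simps(1))
    then show ?thesis using assms[of k] by (simp add: exp_add)
  qed
  moreover have "holomorphic_sv_on (?L k) ?U" for k
    unfolding holomorphic_sv_on_def
  proof (intro ballI)
    fix y assume y: "y \<in> ?U"
    then have "0 < Re (?q k y)" by blast
    then have nz: "?q k y \<notin> \<real>\<^sub>\<le>\<^sub>0" by (auto simp: complex_nonpos_Reals_iff)
    obtain D where D: "(?p k has_derivative D) (at y)" "complex_linear D"
      using holo_peval[of UNIV "Suc 0" "P k"] by auto
    have "(?q k has_derivative (\<lambda>v. D v / ?p k x)) (at y)"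
      using has_derivative_mult_left[OF D(1), of "inverse (?p k x)"] by (simp add: divide_inverse)
    from has_derivative_add[OF has_derivative_compose[OF this
          has_field_derivative_Ln[OF nz, unfolded has_field_derivative_def]] has_derivative_const]
    have "(?L k has_derivative (\<lambda>v. inverse (?q k y) * (D v / ?p k x))) (at y)" by simp
    moreover have "\<forall>c v. inverse (?q k y) * (D (c *s v) / ?p k x) = c * (inverse (?q k y) * (D v / ?p k x))"
      using D(2) by (simp add: complex_linear_def)
    ultimately show "\<exists>D. (?L k has_derivative D) (at y) \<and> (\<forall>c v. D (c *s v) = c * D v)"
      by (intro exI conjI)
  qed
  ultimately show ?thesis by (intro exI[of _ ?U] exI[of _ ?L]) blast
qed

text \<open>
  Integration by parts moves the factor \<open>cnj (P k0)\<close> onto \<open>f = P k0 * \<Prod>k. |P k|^(2 t k)\<close> as a differential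
  operator of order \<open>tdeg (P k0)\<close>; the lower bound on \<open>t\<close> provides that many derivatives. Outside the null set
  where some \<open>P k\<close> vanishes, the defining identity of the b-functions evaluates the result.
\<close>

theorem gaussian_functional_equation:
  fixes P :: "'r::finite \<Rightarrow> 'n::{finite,linorder} cpoly"
  assumes b: "b_functions P b" and hom: "homogeneous_poly (P k0)"
    and nz: "AE x in lborel. \<forall>k. peval (P k) (($) x) \<noteq> 0"
    and t: "\<And>k. t k > 0" "\<And>k. t k > real (tdeg (P k0))"
  shows "of_real ((2 * pi) ^ tdeg (P k0)) *
      (\<integral>x. complex_of_real (absprod P (t(k0 := t k0 + 1)) x) * of_real (gauss x) \<partial>lborel) =
    peval (b (\<lambda>k. if k = k0 then 1 else 0)) (\<lambda>k. of_real (t k)) *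
      (\<integral>x. complex_of_real (absprod P t x) * of_real (gauss x) \<partial>lborel)"
proof -
  define \<delta> :: "'r \<Rightarrow> nat" where "\<delta> = (\<lambda>k. if k = k0 then 1 else 0)"
  let ?p = "\<lambda>k x. peval (P k) (($) (x :: complex^'n::_))"
  define f where "f x = complex_of_real (absprod P t x) * ?p k0 x" for x
  have f: "tempered (tdeg (P k0)) f"
    unfolding f_def absprod_def of_real_prod
    by (intro tempered.smooth_mult tempered.smooth_prod tempered_abs2pow tempered_peval t)
  have absprod_step: "absprod P (t(k0 := t k0 + 1)) x = absprod P t x * (cmod (?p k0 x))\<^sup>2" for x
  proof -
    have "abs2pow (t k0 + 1) w = abs2pow (t k0) w * (cmod w)\<^sup>2" for w
      by (simp add: abs2pow_def powr_add)
    then show ?thesis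
      unfolding absprod_def by (simp add: prod.remove[of UNIV k0] mult_ac)
  qed
  have loc: "(\<Sum>e\<in>Poly_Mapping.keys (P k0). cnj (Poly_Mapping.lookup (P k0) e) * fold wirtinger (index_list e) f x) =
      peval (b \<delta>) (\<lambda>k. of_real (t k)) * of_real (absprod P t x)" if x: "\<And>k. ?p k x \<noteq> 0" for x
  proof -
    from local_logarithms[of P x, OF x] obtain U where "\<exists>L. open U \<and> x \<in> U \<and>
        (\<forall>k. holomorphic_sv_on (L k) U) \<and> (\<forall>k. \<forall>y\<in>U. exp (L k y) = ?p k y)" ..
    then obtain L where UL: "open U \<and> x \<in> U \<and>
        (\<forall>k. holomorphic_sv_on (L k) U) \<and> (\<forall>k. \<forall>y\<in>U. exp (L k y) = ?p k y)" ..
    then have U: "open U" "x \<in> U" "\<And>k. holomorphic_sv_on (L k) U"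
      "\<And>k y. y \<in> U \<Longrightarrow> exp (L k y) = ?p k y" by simp_all
    \<comment> \<open>\<open>H\<close> is the function \<open>\<Prod>k. P k^(t k + \<delta> k)\<close> to which the b-function identity applies, \<open>A\<close> is \<open>cnj (\<Prod>k. P k^(t k))\<close>\<close>
    define H where "H y = (\<Prod>k\<in>UNIV. exp ((of_real (t k) + of_nat (\<delta> k)) * L k y))" for y
    define A where "A y = (\<Prod>k\<in>UNIV. cnj (exp (of_real (t k) * L k y)))" for y
    have abs: "complex_of_real (abs2pow (t k) (?p k y)) =
        exp (of_real (t k) * L k y) * cnj (exp (of_real (t k) * L k y))" if "y \<in> U" for k y
    proof -
      have "abs2pow (t k) (?p k y) = (exp (Re (L k y)))\<^sup>2 powr t k"
        using U(4)[OF that, of k] by (simp add: abs2pow_def flip: norm_exp_eq_Re)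
      also have "\<dots> = (cmod (exp (of_real (t k) * L k y)))\<^sup>2"
        by (simp add: powr_def ln_realpow norm_exp_eq_Re power2_eq_square flip: exp_add exp_double)
      finally show ?thesis by (simp add: complex_norm_square[symmetric])
    qed
    have absA: "complex_of_real (absprod P t y) = (\<Prod>k\<in>UNIV. exp (of_real (t k) * L k y)) * A y"
      if "y \<in> U" for y
      using abs[OF that] by (simp add: absprod_def A_def prod.distrib)
    have fHA: "f y = H y * A y" if "y \<in> U" for y
    proof -
      have "(\<Prod>k\<in>UNIV. exp (of_nat (\<delta> k) * L k y)) = (\<Prod>k\<in>UNIV. if k = k0 then ?p k0 y else 1)"
        using U(4)[OF that] by (intro prod.cong) (auto simp: \<delta>_def)
      then have "H y = (\<Prod>k\<in>UNIV. exp (of_real (t k) * L k y)) * ?p k0 y"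
        by (simp add: H_def distrib_right exp_add prod.distrib)
      then show ?thesis using absA[OF that] by (simp add: f_def mult_ac)
    qed
    have H: "holo_class U n H" for n
      unfolding H_def[abs_def]
      by (intro holo.smooth_prod holo_exp_log[OF U(3) _ U(1,4)] holo_peval)
    have A: "\<exists>E. (A has_derivative E) (at y) \<and> antilinear E" if y: "y \<in> U" for y
    proof -
      obtain D where D: "((\<lambda>y. \<Prod>k\<in>UNIV. exp (of_real (t k) * L k y)) has_derivative D) (at y)" "complex_linear D"
        using holo.smooth_prod[of UNIV U "Suc 0" "\<lambda>k y. exp (of_real (t k) * L k y)"]
          holo_exp_log[OF U(3) _ U(1,4), of _ "Suc 0"] holo_peval y
        by auto blast
      have "A = (\<lambda>y. cnj (\<Prod>k\<in>UNIV. exp (of_real (t k) * L k y)))"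
        by (simp add: A_def fun_eq_iff)
      with has_derivative_cnj[OF D(1)] D(2) show ?thesis
        by (intro exI[of _ "\<lambda>v. cnj (D v)"]) (auto simp: antilinear_def complex_linear_def)
    qed
    have "(\<Sum>e\<in>Poly_Mapping.keys (P k0). cnj (Poly_Mapping.lookup (P k0) e) * fold wirtinger (index_list e) f x) =
        (\<Sum>e\<in>Poly_Mapping.keys (P k0). cnj (Poly_Mapping.lookup (P k0) e) * fold partial_deriv (index_list e) H x) * A x"
      using iterated_wirtinger_eq_partial_deriv[OF U(1) H A fHA U(2)]
      by (simp add: sum_distrib_right mult.assoc)
    also have "(\<Sum>e\<in>Poly_Mapping.keys (P k0). cnj (Poly_Mapping.lookup (P k0) e) * fold partial_deriv (index_list e) H x)
        = diff_op (cnj_poly (P k0)) H x"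
      by (simp add: diff_op_def keys_cnj_poly lookup_cnj_poly multi_deriv_eq_fold)
    also have "cnj_poly (P k0) = (\<Prod>k\<in>UNIV. cnj_poly (P k) ^ \<delta> k)"
    proof -
      have "(\<Prod>k\<in>UNIV. cnj_poly (P k) ^ \<delta> k) = (\<Prod>k\<in>UNIV. if k = k0 then cnj_poly (P k0) else 1)"
        by (intro prod.cong) (auto simp: \<delta>_def)
      then show ?thesis by simp
    qed
    also have "diff_op (\<Prod>k\<in>UNIV. cnj_poly (P k) ^ \<delta> k) H x =
        peval (b \<delta>) (\<lambda>k. of_real (t k)) * (\<Prod>k\<in>UNIV. exp (of_real (t k) * L k x))"
    proof -
      let ?s = "\<chi> k. complex_of_real (t k)"
      have "diff_op (\<Prod>k\<in>UNIV. cnj_poly (P k) ^ \<delta> k)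
             (\<lambda>y. \<Prod>k\<in>UNIV. exp ((?s $ k + of_nat (\<delta> k)) * L k y)) x
           = peval (b \<delta>) (($) ?s) * (\<Prod>k\<in>UNIV. exp (?s $ k * L k x))"
        using b U unfolding b_functions_def by blast
      moreover have "($) ?s = (\<lambda>k. complex_of_real (t k))" by (simp add: fun_eq_iff)
      ultimately show ?thesis by (simp add: H_def[abs_def])
    qed
    finally show ?thesis using absA[OF U(2)] by simp
  qed
  let ?I = "\<lambda>h. \<integral>x. h x * complex_of_real (gauss x) \<partial>lborel"
  have "of_real ((2 * pi) ^ tdeg (P k0)) * ?I (\<lambda>x. of_real (absprod P (t(k0 := t k0 + 1)) x)) =
        of_real ((2 * pi) ^ tdeg (P k0)) * ?I (\<lambda>x. f x * cnj (?p k0 x))"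
    unfolding absprod_step f_def of_real_mult complex_norm_square mult.assoc ..
  also have "\<dots> = ?I (\<lambda>x. \<Sum>e\<in>Poly_Mapping.keys (P k0).
      cnj (Poly_Mapping.lookup (P k0) e) * fold wirtinger (index_list e) f x)"
    by (rule gaussian_polynomial_by_parts[OF hom f, symmetric])
  also have "\<dots> = ?I (\<lambda>x. peval (b \<delta>) (\<lambda>k. of_real (t k)) * of_real (absprod P t x))"
  proof (rule integral_cong_AE)
    have "moderate (fold wirtinger (index_list e) f)" if "e \<in> Poly_Mapping.keys (P k0)" for e
      using tempered_fold_wirtinger[OF f, of "index_list e"] hom that
      by (simp add: length_index_list homogeneous_poly_def)
    then have "(\<lambda>x. fold wirtinger (index_list e) f x) \<in> borel_measurable borel" if "e \<in> Poly_Mapping.keys (P k0)" for e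
      using that by (auto simp: moderate_def intro: borel_measurable_continuous_onI)
    then show "(\<lambda>x. (\<Sum>e\<in>Poly_Mapping.keys (P k0). cnj (Poly_Mapping.lookup (P k0) e) *
        fold wirtinger (index_list e) f x) * complex_of_real (gauss x)) \<in> borel_measurable lborel"
      by (auto intro!: borel_measurable_times borel_measurable_sum)
    have "moderate (\<lambda>x. \<Prod>k\<in>UNIV. complex_of_real (abs2pow (t k) (?p k x)))"
      using t tempered_peval[of 0]
      by (intro tempered.smooth_prod[of _ 0, simplified] moderate_abs2pow) auto
    then have "(\<lambda>x. complex_of_real (absprod P t x)) \<in> borel_measurable borel"
      by (auto simp: moderate_def absprod_def intro: borel_measurable_continuous_onI)
    then show "(\<lambda>x. peval (b \<delta>) (\<lambda>k. of_real (t k)) * complex_of_real (absprod P t x) * of_real (gauss x))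
        \<in> borel_measurable lborel"
      by (auto intro!: borel_measurable_times)
    show "AE x in lborel. (\<Sum>e\<in>Poly_Mapping.keys (P k0). cnj (Poly_Mapping.lookup (P k0) e) *
        fold wirtinger (index_list e) f x) * complex_of_real (gauss x) =
        peval (b \<delta>) (\<lambda>k. of_real (t k)) * complex_of_real (absprod P t x) * of_real (gauss x)"
      using nz by eventually_elim (simp add: loc)
  qed
  also have "\<dots> = peval (b \<delta>) (\<lambda>k. of_real (t k)) * ?I (\<lambda>x. of_real (absprod P t x))"
    unfolding mult.assoc by (rule integral_mult_right_zero)
  finally show ?thesis by (simp add: \<delta>_def)
qed

section \<open>The zeta integral in its domain of convergence\<close>

definition real_zeta :: "('r::finite \<Rightarrow> 'n::finite cpoly) \<Rightarrow> ('r \<Rightarrow> real) \<Rightarrow> real" where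
  "real_zeta P t = (\<integral>x. absprod P t x * gauss x \<partial>lborel)"

lemma moderate_peval: "moderate (\<lambda>x::complex^'n::finite. peval p (($) x))"
  using tempered_peval[of 0 p] by simp

lemma moderate_prod: "(\<And>i. i \<in> A \<Longrightarrow> moderate (f i)) \<Longrightarrow> moderate (\<lambda>x. \<Prod>i\<in>A. f i x)"
  using tempered.smooth_prod[of A 0 f] by simp

lemma moderate_absprod: "(\<And>k. t k > 0) \<Longrightarrow> moderate (\<lambda>x. complex_of_real (absprod P t x))"
  unfolding absprod_def of_real_prod by (intro moderate_prod moderate_abs2pow moderate_peval)

lemma integrable_real_moderate_gauss:
  assumes "moderate (\<lambda>x. complex_of_real (f x))"
  shows "integrable lborel (\<lambda>x::complex^'n::finite. f x * gauss x)"
  using integrable_moderate_gauss[OF assms] by (simp flip: of_real_mult add: complex_of_real_integrable_eq)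

lemma integrable_absprod:
  "(\<And>k. t k > 0) \<Longrightarrow> integrable lborel (\<lambda>x::complex^'n::finite. absprod P t x * gauss x)"
  by (intro integrable_real_moderate_gauss moderate_absprod)

lemma complex_real_zeta:
  "(\<integral>x. complex_of_real (absprod P t x) * of_real (gauss x) \<partial>lborel) = of_real (real_zeta P t)"
  unfolding real_zeta_def of_real_mult[symmetric] by (rule integral_complex_of_real)

lemma absprod_nonneg: "absprod P t x \<ge> 0"
  by (auto simp: absprod_def abs2pow_def intro!: prod_nonneg)

lemma real_zeta_pos:
  fixes P :: "'r::finite \<Rightarrow> 'n::finite cpoly"
  assumes nz: "AE x in lborel. \<forall>k. peval (P k) (($) (x :: complex^'n)) \<noteq> 0" and t: "\<And>k. t k > 0"
  shows "real_zeta P t > 0"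
proof -
  have pos: "AE x in lborel. absprod P t x * gauss (x :: complex^'n) > 0"
    using nz by eventually_elim (auto simp: absprod_def abs2pow_def gauss_pos intro!: mult_pos_pos prod_pos)
  have "real_zeta P t \<ge> 0"
    unfolding real_zeta_def
    by (intro Bochner_Integration.integral_nonneg mult_nonneg_nonneg absprod_nonneg less_imp_le[OF gauss_pos])
  moreover have "real_zeta P t \<noteq> 0"
  proof
    assume "real_zeta P t = 0"
    then have "AE x in lborel. absprod P t x * gauss (x :: complex^'n) = 0"
      unfolding real_zeta_def
      by (subst (asm) integral_nonneg_eq_0_iff_AE)
         (auto intro!: integrable_absprod t mult_nonneg_nonneg absprod_nonneg less_imp_le[OF gauss_pos])
    with pos have "AE x in lborel. x \<in> ({} :: (complex^'n) set)"
      by eventually_elim simp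
    then have "emeasure lborel (UNIV :: (complex^'n) set) = 0"
      by (subst (asm) AE_iff_measurable[of "UNIV"]) auto
    then show False by simp
  qed
  ultimately show ?thesis by simp
qed

lemma absprod_convex_combination:
  "absprod P (\<lambda>k. (1 - \<theta>) * a k + \<theta> * b k) x = absprod P a x powr (1 - \<theta>) * absprod P b x powr \<theta>"
proof -
  have "abs2pow ((1 - \<theta>) * u + \<theta> * v) w = abs2pow u w powr (1 - \<theta>) * abs2pow v w powr \<theta>" for u v w
    by (simp add: abs2pow_def powr_add powr_powr mult.commute)
  then show ?thesis
    by (simp add: absprod_def prod.distrib prod_powr_distrib abs2pow_def)
qed

lemma weighted_AM_GM:
  fixes u v \<theta> :: real
  assumes "u \<ge> 0" "v \<ge> 0" "0 \<le> \<theta>" "\<theta> \<le> 1"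
  shows "u powr (1 - \<theta>) * v powr \<theta> \<le> (1 - \<theta>) * u + \<theta> * v"
proof (cases "u = 0 \<or> v = 0")
  case True
  then show ?thesis using assms by (auto intro!: add_nonneg_nonneg mult_nonneg_nonneg)
next
  case False
  then show ?thesis using Youngs_inequality_0[of "1 - \<theta>" \<theta> u v] assms by simp
qed

text \<open>
  Hoelder's inequality, obtained by integrating the weighted inequality of arithmetic and geometric means
  for the two integrands divided by their integrals \<open>A\<close> and \<open>B\<close>.
\<close>

lemma real_zeta_log_convex:
  fixes P :: "'r::finite \<Rightarrow> 'n::finite cpoly"
  assumes nz: "AE x in lborel. \<forall>k. peval (P k) (($) (x :: complex^'n)) \<noteq> 0"
    and a: "\<And>k. a k > 0" and b: "\<And>k. b k > 0" and \<theta>: "0 \<le> \<theta>" "\<theta> \<le> 1"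
  shows "real_zeta P (\<lambda>k. (1 - \<theta>) * a k + \<theta> * b k) \<le> real_zeta P a powr (1 - \<theta>) * real_zeta P b powr \<theta>"
proof -
  define A where "A = real_zeta P a"
  define B where "B = real_zeta P b"
  have AB: "A > 0" "B > 0" unfolding A_def B_def by (intro real_zeta_pos nz a b)+
  define c where "c = A powr (1 - \<theta>) * B powr \<theta>"
  have c: "c \<ge> 0" by (simp add: c_def)
  have pos: "(1 - \<theta>) * a k + \<theta> * b k > 0" for k
    using a[of k] b[of k] \<theta> by (cases "\<theta> = 0") (auto intro!: add_nonneg_pos)
  have le: "absprod P (\<lambda>k. (1 - \<theta>) * a k + \<theta> * b k) x * gauss x \<le>
        c * ((1 - \<theta>) / A * (absprod P a x * gauss x) + \<theta> / B * (absprod P b x * gauss x))" for x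
  proof -
    let ?u = "absprod P a x" and ?v = "absprod P b x"
    have "?u powr (1 - \<theta>) * ?v powr \<theta> = c * ((?u / A) powr (1 - \<theta>) * (?v / B) powr \<theta>)"
      using AB by (simp add: c_def powr_divide absprod_nonneg)
    also have "\<dots> \<le> c * ((1 - \<theta>) * (?u / A) + \<theta> * (?v / B))"
      using AB c \<theta> by (intro mult_left_mono weighted_AM_GM) (auto simp: absprod_nonneg)
    finally have "?u powr (1 - \<theta>) * ?v powr \<theta> * gauss x \<le> c * ((1 - \<theta>) * (?u / A) + \<theta> * (?v / B)) * gauss x"
      by (rule mult_right_mono) (rule less_imp_le[OF gauss_pos])
    then show ?thesis
      unfolding absprod_convex_combination by (simp add: algebra_simps)
  qed
  have "real_zeta P (\<lambda>k. (1 - \<theta>) * a k + \<theta> * b k) \<le>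
     (\<integral>x. c * ((1 - \<theta>) / A * (absprod P a x * gauss x) + \<theta> / B * (absprod P b x * gauss x)) \<partial>lborel)"
    unfolding real_zeta_def
    by (intro integral_mono le integrable_absprod pos integrable_mult_right Bochner_Integration.integrable_add a b)
  also have "\<dots> = c * ((1 - \<theta>) / A * A + \<theta> / B * B)"
    using integrable_absprod[of a P] integrable_absprod[of b P] a b
    by (simp add: A_def B_def real_zeta_def)
  also have "\<dots> = c" using AB by simp
  finally show ?thesis by (simp add: c_def A_def B_def)
qed

subsection \<open>Integrability and holomorphy\<close>

definition gauss_mass :: "'n::finite itself \<Rightarrow> real" where
  "gauss_mass _ = (\<integral>x. gauss (x :: complex^'n) \<partial>lborel)"

lemma integrable_gauss: "integrable lborel (gauss :: complex^'n::finite \<Rightarrow> real)"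
  using integrable_real_moderate_gauss[of "\<lambda>_. 1"] by (simp add: moderate_const)

lemma gauss_mass_pos: "gauss_mass TYPE('n::finite) > 0"
proof -
  have "gauss_mass TYPE('n) \<ge> 0"
    unfolding gauss_mass_def by (intro Bochner_Integration.integral_nonneg less_imp_le[OF gauss_pos])
  moreover have "gauss_mass TYPE('n) \<noteq> 0"
  proof
    assume "gauss_mass TYPE('n) = 0"
    then have "AE x in lborel. gauss (x :: complex^'n) = 0"
      unfolding gauss_mass_def
      by (subst (asm) integral_nonneg_eq_0_iff_AE) (auto intro!: integrable_gauss less_imp_le[OF gauss_pos])
    then have "AE x in lborel. x \<in> ({} :: (complex^'n) set)"
      by eventually_elim (use gauss_pos in \<open>metis less_irrefl\<close>)
    then have "emeasure lborel (UNIV :: (complex^'n) set) = 0"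
      by (subst (asm) AE_iff_measurable[of "UNIV"]) auto
    then show False by simp
  qed
  ultimately show ?thesis by simp
qed

lemma haarV_eq: "(haarV :: (complex^'n::finite) measure) = density lborel (\<lambda>_. ennreal (1 / gauss_mass TYPE('n)))"
  by (simp add: haarV_def gauss_mass_def)

lemma integrable_haarV:
  fixes f :: "complex^'n::finite \<Rightarrow> complex"
  assumes "integrable lborel f"
  shows "integrable haarV f" "(\<integral>x. f x \<partial>haarV) = (\<integral>x. f x \<partial>lborel) / of_real (gauss_mass TYPE('n))"
proof -
  have f: "f \<in> borel_measurable lborel" using assms by auto
  have c: "0 \<le> 1 / gauss_mass TYPE('n)" using gauss_mass_pos[where 'n='n] by simp
  show "integrable haarV f"
    unfolding haarV_eq using f c assms
    by (subst integrable_density) (auto intro: integrable_scaleR_right)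
  show "(\<integral>x. f x \<partial>haarV) = (\<integral>x. f x \<partial>lborel) / of_real (gauss_mass TYPE('n))"
    unfolding haarV_eq using f c assms
    by (subst integral_density) (auto simp: scaleR_conv_of_real divide_inverse mult.commute)
qed

text \<open>
  The complex power in the zeta integral has a nonnegative real base, so it is a genuine exponential in
  \<open>s\<close>.
\<close>

lemma powr_abs_square:
  "(w * cnj w) powr s = (if w = 0 then 0 else exp (s * of_real (ln ((cmod w)\<^sup>2))))"
proof -
  have "w * cnj w = of_real ((cmod w)\<^sup>2)" by (simp only: complex_norm_square)
  then show ?thesis
    by (simp add: powr_def Ln_of_real del: of_real_power)
qed

lemma zeta_integrand_measurable: "zeta_integrand P s \<in> borel_measurable borel"
proof -
  have [measurable]: "(\<lambda>x::complex^'a::finite. peval p (($) x)) \<in> borel_measurable borel" for p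
    using moderate_peval[of p] by (auto simp: moderate_def intro: borel_measurable_continuous_onI)
  show ?thesis
    unfolding zeta_integrand_def[abs_def] powr_abs_square by measurable
qed

lemma norm_zeta_integrand:
  "norm (zeta_integrand P s x) = absprod P (\<lambda>k. Re (s $ k)) x * gauss x"
proof -
  have "norm ((w * cnj w) powr u) = abs2pow (Re u) w" for w u
    unfolding powr_abs_square by (simp add: abs2pow_def powr_def)
  then show ?thesis
    using gauss_pos[of x] by (simp add: zeta_integrand_def norm_mult prod_norm[symmetric] absprod_def)
qed

lemma integrable_zeta_integrand:
  fixes P :: "'r::finite \<Rightarrow> 'n::finite cpoly"
  assumes "\<And>k. Re (s $ k) > 0"
  shows "integrable lborel (zeta_integrand P s)"
proof (rule Bochner_Integration.integrable_bound)
  show "integrable lborel (\<lambda>x::complex^'n. absprod P (\<lambda>k. Re (s $ k)) x * gauss x)"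
    by (intro integrable_absprod assms)
  show "zeta_integrand P s \<in> borel_measurable lborel"
    using zeta_integrand_measurable by simp
  show "AE x in lborel. norm (zeta_integrand P s x) \<le> norm (absprod P (\<lambda>k. Re (s $ k)) x * gauss x)"
    unfolding norm_zeta_integrand by (simp add: absprod_nonneg)
qed

lemma zeta_int_real:
  fixes P :: "'r::finite \<Rightarrow> 'n::finite cpoly"
  assumes "\<And>k. t k > 0"
  shows "zeta_int P (\<chi> k. of_real (t k)) = of_real (real_zeta P t / gauss_mass TYPE('n))"
proof -
  have "(w * cnj w) powr of_real u = of_real (abs2pow u w)" for w u
    unfolding powr_abs_square by (simp add: abs2pow_def powr_def exp_of_real flip: of_real_mult)
  then have eq: "zeta_integrand P (\<chi> k. of_real (t k)) =
      (\<lambda>x. of_real (absprod P t x) * of_real (gauss x))"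
    by (simp add: zeta_integrand_def absprod_def fun_eq_iff)
  have "integrable lborel (zeta_integrand P (\<chi> k. of_real (t k)))"
    using assms by (intro integrable_zeta_integrand) simp
  then show ?thesis
    by (simp add: zeta_int_def integrable_haarV(2) eq complex_real_zeta)
qed

lemma has_derivative_quadratic_remainder:
  fixes f :: "'a::real_normed_vector \<Rightarrow> 'b::real_normed_vector"
  assumes D: "bounded_linear D" and \<delta>: "\<delta> > 0"
    and le: "\<And>h. norm h \<le> \<delta> \<Longrightarrow> norm (f (x + h) - f x - D h) \<le> C * (norm h)\<^sup>2"
  shows "(f has_derivative D) (at x)"
  unfolding has_derivative_at
proof (intro conjI D)
  show "((\<lambda>h. norm (f (x + h) - f x - D h) / norm h) \<longlongrightarrow> 0) (at 0)"
  proof (rule Lim_null_comparison)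
    show "\<forall>\<^sub>F h in at 0. norm (norm (f (x + h) - f x - D h) / norm h) \<le> C * norm h"
      unfolding eventually_at
    proof (intro exI[of _ \<delta>] conjI ballI impI)
      fix h :: 'a assume h: "h \<noteq> 0 \<and> dist h 0 < \<delta>"
      then show "norm (norm (f (x + h) - f x - D h) / norm h) \<le> C * norm h"
        using le[of h] by (simp add: divide_le_eq power2_eq_square mult.assoc)
    qed (rule \<delta>)
    show "((\<lambda>h. C * norm h) \<longlongrightarrow> 0) (at 0)"
      by (auto intro!: tendsto_eq_intros)
  qed
qed

lemma norm_exp_minus_1_minus_le: "norm (exp w - 1 - w) \<le> (norm w)\<^sup>2 * exp (norm (w::complex))"
proof -
  have "norm (exp w - (\<Sum>k\<le>1. w ^ k / fact k)) \<le> exp (norm w) * norm w ^ Suc 1 / fact 1"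
    by (rule Taylor_exp_field)
  then show ?thesis by (simp add: mult.commute diff_diff_eq power2_eq_square)
qed

lemma zeta_integrand_shift:
  assumes "\<And>k. peval (P k) (($) x) \<noteq> 0"
  shows "zeta_integrand P (s + h) x =
    zeta_integrand P s x * exp (\<Sum>k\<in>UNIV. h $ k * of_real (ln ((cmod (peval (P k) (($) x)))\<^sup>2)))"
  using assms
  by (simp add: zeta_integrand_def powr_abs_square exp_sum distrib_right exp_add prod.distrib)

text \<open>
  For each \<open>k\<close> one of the two summands on the right is the left-hand factor, according to the sign of the
  logarithm. Thus the logarithms that appear on differentiating in \<open>s\<close> are absorbed by slightly changed
  exponents, for which the integral still converges.
\<close>

lemma absprod_tilt:
  fixes P :: "'r::finite \<Rightarrow> 'n::finite cpoly" and x :: "complex^'n"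
  assumes "\<And>k. peval (P k) (($) x) \<noteq> 0"
  shows "absprod P \<sigma> x * exp (\<epsilon> * (\<Sum>k\<in>UNIV. \<bar>ln ((cmod (peval (P k) (($) x)))\<^sup>2)\<bar>)) \<le>
    (\<Prod>k\<in>UNIV. abs2pow (\<sigma> k + \<epsilon>) (peval (P k) (($) x)) + abs2pow (\<sigma> k - \<epsilon>) (peval (P k) (($) x)))"
proof -
  have "abs2pow u w * exp (\<epsilon> * \<bar>ln ((cmod w)\<^sup>2)\<bar>) \<le> abs2pow (u + \<epsilon>) w + abs2pow (u - \<epsilon>) w"
    if "w \<noteq> 0" for u w
    using that by (cases "ln ((cmod w)\<^sup>2) \<ge> 0") (auto simp: abs2pow_def powr_def algebra_simps simp flip: exp_add)
  then show ?thesis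
    using assms unfolding absprod_def sum_distrib_left exp_sum[OF finite] prod.distrib[symmetric]
    by (intro prod_mono conjI mult_nonneg_nonneg) (auto simp: abs2pow_def)
qed

text \<open>
  The total derivative is obtained by differentiating under the integral sign in all variables at once. By
  \<open>zeta_integrand_shift\<close> the remainder of first order is the integrand times \<open>exp T - 1 - T\<close>, where \<open>T\<close> is
  linear in \<open>h\<close> with logarithmic coefficients; it is bounded by \<open>(norm h)^2\<close> times an integrable function.
\<close>

theorem holomorphic_zeta_int:
  fixes P :: "'r::finite \<Rightarrow> 'n::finite cpoly"
  assumes nz: "AE x in lborel. \<forall>k. peval (P k) (($) (x :: complex^'n)) \<noteq> 0"
  shows "holomorphic_sv_on (zeta_int P) {s. \<forall>k. Re (s $ k) > 0}"
  unfolding holomorphic_sv_on_def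
proof (intro ballI)
  fix s :: "complex^'r" assume "s \<in> {s. \<forall>k. Re (s $ k) > 0}"
  then have s: "Re (s $ k) > 0" for k by simp
  \<comment> \<open>one \<open>\<delta>\<close> is spent on the exponential \<open>exp T\<close> and one on the logarithms, so exponents change by \<open>2 \<delta>\<close> and stay positive\<close>
  define \<delta> where "\<delta> = Min (range (\<lambda>k. Re (s $ k))) / 4"
  have "Min (range (\<lambda>k. Re (s $ k))) > 0" using s by (subst Min_gr_iff) auto
  then have \<delta>: "\<delta> > 0" by (simp add: \<delta>_def)
  have \<delta>4: "4 * \<delta> \<le> Re (s $ k)" for k by (simp add: \<delta>_def)
  let ?l = "\<lambda>k x. ln ((cmod (peval (P k) (($) (x :: complex^'n))))\<^sup>2)"
  let ?\<Lambda> = "\<lambda>x. \<Sum>k\<in>UNIV. \<bar>?l k x\<bar>"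
  let ?z = "zeta_integrand P"
  have [measurable]: "(\<lambda>x::complex^'n. peval p (($) x)) \<in> borel_measurable borel" for p
    using moderate_peval[of p] by (auto simp: moderate_def intro: borel_measurable_continuous_onI)
  have [measurable]: "?z u \<in> borel_measurable borel" for u
    by (rule zeta_integrand_measurable)
  define w where "w x = (\<Prod>k\<in>UNIV. abs2pow (Re (s $ k) + 2 * \<delta>) (peval (P k) (($) x)) +
      abs2pow (Re (s $ k) - 2 * \<delta>) (peval (P k) (($) x))) * gauss x" for x :: "complex^'n"
  have w0: "w x \<ge> 0" for x
    by (auto simp: w_def abs2pow_def intro!: mult_nonneg_nonneg prod_nonneg less_imp_le[OF gauss_pos])
  have "moderate (\<lambda>x::complex^'n. complex_of_real (\<Prod>k\<in>UNIV. abs2pow (Re (s $ k) + 2 * \<delta>) (peval (P k) (($) x)) +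
      abs2pow (Re (s $ k) - 2 * \<delta>) (peval (P k) (($) x))))"
    unfolding of_real_prod of_real_add
  proof (intro moderate_prod moderate_add moderate_abs2pow moderate_peval)
    show "0 < Re (s $ k) + 2 * \<delta>" "0 < Re (s $ k) - 2 * \<delta>" for k
      using \<delta> \<delta>4[of k] by linarith+
  qed
  then have w: "integrable lborel w"
    unfolding w_def by (rule integrable_real_moderate_gauss)
  have dom: "AE x in lborel. norm (?z s x) * exp (2 * \<delta> * ?\<Lambda> x) \<le> w x"
    using nz
  proof eventually_elim
    fix x :: "complex^'n" assume "\<forall>k. peval (P k) (($) x) \<noteq> 0"
    then have "absprod P (\<lambda>k. Re (s $ k)) x * exp (2 * \<delta> * ?\<Lambda> x) \<le>
      (\<Prod>k\<in>UNIV. abs2pow (Re (s $ k) + 2 * \<delta>) (peval (P k) (($) x)) +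
        abs2pow (Re (s $ k) - 2 * \<delta>) (peval (P k) (($) x)))"
      by (intro absprod_tilt) simp
    from mult_right_mono[OF this less_imp_le[OF gauss_pos[of x]]]
    show "norm (?z s x) * exp (2 * \<delta> * ?\<Lambda> x) \<le> w x"
      by (simp add: w_def norm_zeta_integrand mult_ac)
  qed
  have le_exp: "y \<le> exp (\<delta> * y) / \<delta>" "y\<^sup>2 \<le> 2 / \<delta>\<^sup>2 * exp (\<delta> * y)" if "y \<ge> 0" for y
  proof -
    have "\<delta> * y \<le> exp (\<delta> * y)" using exp_ge_add_one_self[of "\<delta> * y"] by linarith
    then show "y \<le> exp (\<delta> * y) / \<delta>" using \<delta> by (simp add: field_simps)
    have "(\<delta> * y)\<^sup>2 / 2 \<le> exp (\<delta> * y)"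
      using exp_lower_Taylor_quadratic[of "\<delta> * y"] mult_nonneg_nonneg[of \<delta> y] \<delta> that by linarith
    then show "y\<^sup>2 \<le> 2 / \<delta>\<^sup>2 * exp (\<delta> * y)"
      using \<delta> by (simp add: field_simps power_mult_distrib)
  qed
  have \<Lambda>0: "?\<Lambda> x \<ge> 0" for x by (intro sum_nonneg) simp
  have int_z: "integrable lborel (?z u)" if "\<And>k. Re (u $ k) > 0" for u
    using that by (rule integrable_zeta_integrand)
  have int_zl: "integrable lborel (\<lambda>x. ?z s x * of_real (?l k x))" for k
  proof (rule Bochner_Integration.integrable_bound)
    show "integrable lborel (\<lambda>x. w x / \<delta>)" using w by simp
    show "(\<lambda>x. ?z s x * of_real (?l k x)) \<in> borel_measurable lborel" by measurable
    show "AE x in lborel. norm (?z s x * of_real (?l k x)) \<le> norm (w x / \<delta>)"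
      using dom
    proof eventually_elim
      fix x :: "complex^'n" assume d: "norm (?z s x) * exp (2 * \<delta> * ?\<Lambda> x) \<le> w x"
      have "\<bar>?l k x\<bar> \<le> ?\<Lambda> x" by (rule member_le_sum) auto
      also have "\<dots> \<le> exp (\<delta> * ?\<Lambda> x) / \<delta>" by (rule le_exp[OF \<Lambda>0])
      also have "\<dots> \<le> exp (2 * \<delta> * ?\<Lambda> x) / \<delta>"
        using \<delta> \<Lambda>0[of x] by (intro divide_right_mono) (auto intro!: mult_right_mono)
      finally have "norm (?z s x) * \<bar>?l k x\<bar> \<le> norm (?z s x) * (exp (2 * \<delta> * ?\<Lambda> x) / \<delta>)"
        by (rule mult_left_mono) simp
      also have "\<dots> \<le> w x / \<delta>" using divide_right_mono[OF d, of \<delta>] \<delta> by simp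
      finally show "norm (?z s x * of_real (?l k x)) \<le> norm (w x / \<delta>)"
        using w0[of x] \<delta> by (simp add: norm_mult)
    qed
  qed
  define G where "G = gauss_mass TYPE('n)"
  have G: "G > 0" by (simp add: G_def gauss_mass_pos)
  define D where "D h = (\<Sum>k\<in>UNIV. h $ k * ((\<integral>x. ?z s x * of_real (?l k x) \<partial>lborel) / of_real G))" for h
  have D_lin: "bounded_linear D"
    unfolding D_def
    by (intro bounded_linear_sum bounded_linear_mult_const bounded_linear_component)
  have "(zeta_int P has_derivative D) (at s)"
  proof (rule has_derivative_quadratic_remainder[OF D_lin \<delta>])
    fix h :: "complex^'r" assume h: "norm h \<le> \<delta>"
    have hk: "norm (h $ k) \<le> norm h" for k by (rule Finite_Cartesian_Product.norm_nth_le)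
    have sh: "Re ((s + h) $ k) > 0" for k
      using abs_Re_le_cmod[of "h $ k"] hk[of k] h \<delta>4[of k] \<delta> by simp
    let ?T = "\<lambda>x. \<Sum>k\<in>UNIV. h $ k * of_real (?l k x)"
    have Dh: "D h = (\<integral>x. ?z s x * ?T x \<partial>lborel) / of_real G"
    proof -
      have "(\<integral>x. ?z s x * ?T x \<partial>lborel) = (\<integral>x. (\<Sum>k\<in>UNIV. h $ k * (?z s x * of_real (?l k x))) \<partial>lborel)"
        by (simp add: sum_distrib_left mult_ac)
      also have "\<dots> = (\<Sum>k\<in>UNIV. h $ k * (\<integral>x. ?z s x * of_real (?l k x) \<partial>lborel))"
        using int_zl by (subst Bochner_Integration.integral_sum) auto
      finally show ?thesis by (simp add: D_def sum_divide_distrib)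
    qed
    have int_T: "integrable lborel (\<lambda>x. ?z s x * ?T x)"
    proof -
      have "integrable lborel (\<lambda>x. \<Sum>k\<in>UNIV. h $ k * (?z s x * of_real (?l k x)))"
        using int_zl by (intro Bochner_Integration.integrable_sum integrable_mult_right)
      then show ?thesis by (simp add: sum_distrib_left mult_ac)
    qed
    have "zeta_int P (s + h) - zeta_int P s - D h =
        (\<integral>x. ?z (s + h) x - ?z s x - ?z s x * ?T x \<partial>lborel) / of_real G"
      unfolding zeta_int_def integrable_haarV(2)[OF int_z[OF sh]] integrable_haarV(2)[OF int_z[OF s]] Dh G_def
      using int_z[OF sh] int_z[OF s] int_T by (simp add: diff_divide_distrib)
    also have "norm \<dots> \<le> (\<integral>x. 2 / \<delta>\<^sup>2 * (norm h)\<^sup>2 * w x \<partial>lborel) / G"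
    proof -
      have "norm (\<integral>x. ?z (s + h) x - ?z s x - ?z s x * ?T x \<partial>lborel) \<le>
            (\<integral>x. 2 / \<delta>\<^sup>2 * (norm h)\<^sup>2 * w x \<partial>lborel)"
      proof (rule integral_norm_bound_integral[THEN order_trans, OF _ _ order_refl] | rule Bochner_Integration.integral_norm_bound[THEN order_trans])+
        show "(\<integral>x. norm (?z (s + h) x - ?z s x - ?z s x * ?T x) \<partial>lborel) \<le>
            (\<integral>x. 2 / \<delta>\<^sup>2 * (norm h)\<^sup>2 * w x \<partial>lborel)"
        proof (rule integral_mono_AE)
          show "integrable lborel (\<lambda>x. norm (?z (s + h) x - ?z s x - ?z s x * ?T x))"
            using int_z[OF sh] int_z[OF s] int_T by (intro integrable_norm Bochner_Integration.integrable_diff)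
          show "integrable lborel (\<lambda>x. 2 / \<delta>\<^sup>2 * (norm h)\<^sup>2 * w x)" using w by simp
          show "AE x in lborel. norm (?z (s + h) x - ?z s x - ?z s x * ?T x) \<le> 2 / \<delta>\<^sup>2 * (norm h)\<^sup>2 * w x"
            using dom nz
          proof eventually_elim
            fix x :: "complex^'n"
            assume d: "norm (?z s x) * exp (2 * \<delta> * ?\<Lambda> x) \<le> w x" and p: "\<forall>k. peval (P k) (($) x) \<noteq> 0"
            have T: "norm (?T x) \<le> norm h * ?\<Lambda> x"
              unfolding sum_distrib_left
              by (intro order_trans[OF norm_sum] sum_mono) (auto simp: norm_mult intro!: mult_right_mono hk)
            have "norm (?z (s + h) x - ?z s x - ?z s x * ?T x) = norm (?z s x) * norm (exp (?T x) - 1 - ?T x)"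
            proof -
              have "?z (s + h) x = ?z s x * exp (?T x)"
                using p by (intro zeta_integrand_shift) simp
              then have "?z (s + h) x - ?z s x - ?z s x * ?T x = ?z s x * (exp (?T x) - 1 - ?T x)"
                by (simp only: right_diff_distrib) simp
              then show ?thesis by (simp only: norm_mult)
            qed
            also have "\<dots> \<le> norm (?z s x) * ((norm h * ?\<Lambda> x)\<^sup>2 * exp (\<delta> * ?\<Lambda> x))"
            proof (intro mult_left_mono norm_ge_zero)
              have "norm (exp (?T x) - 1 - ?T x) \<le> (norm (?T x))\<^sup>2 * exp (norm (?T x))"
                by (rule norm_exp_minus_1_minus_le)
              also have "\<dots> \<le> (norm h * ?\<Lambda> x)\<^sup>2 * exp (\<delta> * ?\<Lambda> x)"
              proof (intro mult_mono power_mono T)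
                show "exp (norm (?T x)) \<le> exp (\<delta> * ?\<Lambda> x)"
                  using T mult_right_mono[OF h \<Lambda>0[of x]] by simp
              qed auto
              finally show "norm (exp (?T x) - 1 - ?T x) \<le> (norm h * ?\<Lambda> x)\<^sup>2 * exp (\<delta> * ?\<Lambda> x)" .
            qed
            also have "\<dots> \<le> norm (?z s x) * ((norm h)\<^sup>2 * (2 / \<delta>\<^sup>2 * exp (\<delta> * ?\<Lambda> x)) * exp (\<delta> * ?\<Lambda> x))"
              unfolding power_mult_distrib
              by (intro mult_left_mono mult_right_mono le_exp \<Lambda>0) auto
            also have "\<dots> = 2 / \<delta>\<^sup>2 * (norm h)\<^sup>2 * (norm (?z s x) * exp (2 * \<delta> * ?\<Lambda> x))"
            proof -
              have "exp (2 * \<delta> * ?\<Lambda> x) = exp (\<delta> * ?\<Lambda> x) * exp (\<delta> * ?\<Lambda> x)" by (simp flip: exp_add)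
              then show ?thesis by (simp only: mult_ac)
            qed
            also have "\<dots> \<le> 2 / \<delta>\<^sup>2 * (norm h)\<^sup>2 * w x"
              using d by (intro mult_left_mono) auto
            finally show "norm (?z (s + h) x - ?z s x - ?z s x * ?T x) \<le> 2 / \<delta>\<^sup>2 * (norm h)\<^sup>2 * w x" .
          qed
        qed
      qed
      from divide_right_mono[OF this, of G] G show ?thesis
        by (simp only: norm_divide norm_of_real abs_of_pos less_imp_le)
    qed
    also have "\<dots> = (2 / \<delta>\<^sup>2 * (\<integral>x. w x \<partial>lborel) / G) * (norm h)\<^sup>2"
      by simp
    finally show "norm (zeta_int P (s + h) - zeta_int P s - D h) \<le>
        (2 / \<delta>\<^sup>2 * (\<integral>x. w x \<partial>lborel) / G) * (norm h)\<^sup>2" .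
  qed
  moreover have "\<forall>c v. D (c *s v) = c * D v"
    by (simp add: D_def sum_distrib_left mult_ac)
  ultimately show "\<exists>D. (zeta_int P has_derivative D) (at s) \<and> (\<forall>c v. D (c *s v) = c * D v)"
    by blast
qed

text \<open>
  For exponents in \<open>(0, 1]\<close> each factor is at most \<open>1 + |P k|^2\<close>. The limit of \<open>|P k|^(2t)\<close> is one only where \<open>P k\<close> does
  not vanish, that is, almost everywhere.
\<close>

lemma real_zeta_tendsto_at_0:
  fixes P :: "'r::finite \<Rightarrow> 'n::finite cpoly"
  assumes nz: "AE x in lborel. \<forall>k. peval (P k) (($) (x :: complex^'n)) \<noteq> 0"
  shows "(\<lambda>n. real_zeta P (\<lambda>k. inverse (real (Suc n)))) \<longlonglongrightarrow> gauss_mass TYPE('n)"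
  unfolding real_zeta_def gauss_mass_def
proof (rule integral_dominated_convergence
      [where w = "\<lambda>x. (\<Prod>k\<in>UNIV. 1 + abs2pow 1 (peval (P k) (($) x))) * gauss x"])
  have "moderate (\<lambda>x::complex^'n. complex_of_real (\<Prod>k\<in>UNIV. 1 + abs2pow 1 (peval (P k) (($) x))))"
    unfolding of_real_prod of_real_add
    by (intro moderate_prod moderate_add moderate_abs2pow moderate_peval) (auto simp: moderate_const)
  then show "integrable lborel (\<lambda>x::complex^'n. (\<Prod>k\<in>UNIV. 1 + abs2pow 1 (peval (P k) (($) x))) * gauss x)"
    by (rule integrable_real_moderate_gauss)
  show "gauss \<in> borel_measurable lborel" by simp
  show "(\<lambda>x::complex^'n. absprod P (\<lambda>k. inverse (real (Suc n))) x * gauss x) \<in> borel_measurable lborel" for n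
    using integrable_absprod[of "\<lambda>k. inverse (real (Suc n))" P] by auto
  show "AE x in lborel. norm (absprod P (\<lambda>k. inverse (real (Suc n))) (x::complex^'n) * gauss x) \<le>
      (\<Prod>k\<in>UNIV. 1 + abs2pow 1 (peval (P k) (($) x))) * gauss x" for n
  proof (intro AE_I2)
    fix x :: "complex^'n"
    have "abs2pow (inverse (real (Suc n))) w \<le> 1 + abs2pow 1 w" for w
    proof -
      have "(cmod w)\<^sup>2 powr inverse (real (Suc n)) \<le> (1 + (cmod w)\<^sup>2) powr inverse (real (Suc n))"
        by (intro powr_mono2) auto
      also have "\<dots> \<le> (1 + (cmod w)\<^sup>2) powr 1"
        by (intro powr_mono) (auto simp: inverse_le_1_iff)
      finally show ?thesis by (simp add: abs2pow_def add_nonneg_nonneg)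
    qed
    then have "absprod P (\<lambda>k. inverse (real (Suc n))) x \<le> (\<Prod>k\<in>UNIV. 1 + abs2pow 1 (peval (P k) (($) x)))"
      unfolding absprod_def by (intro prod_mono) (auto simp: abs2pow_def)
    then show "norm (absprod P (\<lambda>k. inverse (real (Suc n))) x * gauss x) \<le>
      (\<Prod>k\<in>UNIV. 1 + abs2pow 1 (peval (P k) (($) x))) * gauss x"
      using gauss_pos[of x] by (simp add: absprod_nonneg abs_mult)
  qed
  show "AE x in lborel. (\<lambda>n. absprod P (\<lambda>k. inverse (real (Suc n))) x * gauss x) \<longlonglongrightarrow> gauss (x::complex^'n)"
    using nz
  proof eventually_elim
    fix x :: "complex^'n" assume "\<forall>k. peval (P k) (($) x) \<noteq> 0"
    then have "(\<lambda>n. abs2pow (inverse (real (Suc n))) (peval (P k) (($) x))) \<longlonglongrightarrow> 1" for k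
      unfolding abs2pow_def
      using tendsto_powr[OF tendsto_const LIMSEQ_inverse_real_of_nat, of "(cmod (peval (P k) (($) x)))\<^sup>2"]
      by simp
    then have "(\<lambda>n. absprod P (\<lambda>k. inverse (real (Suc n))) x) \<longlonglongrightarrow> (\<Prod>k\<in>(UNIV::'r set). 1)"
      unfolding absprod_def by (intro tendsto_prod)
    then have "(\<lambda>n. absprod P (\<lambda>k. inverse (real (Suc n))) x * gauss x) \<longlonglongrightarrow> 1 * gauss x"
      by (intro tendsto_mult tendsto_const) simp
    then show "(\<lambda>n. absprod P (\<lambda>k. inverse (real (Suc n))) x * gauss x) \<longlonglongrightarrow> gauss x" by simp
  qed
qed

section \<open>Uniqueness of log-convex solutions\<close>

text \<open>
  A variant of the theorem of Bohr and Mollerup. Log-convexity squeezes \<open>f (n + x) / f n\<close> between the \<open>x\<close>-th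
  powers of \<open>f n / f (n - 1)\<close> and \<open>f (n + 1) / f n\<close>. Both quotients are those of the comparison function \<open>\<gamma>\<close>, by
  periodicity of \<open>f / \<gamma>\<close>, and therefore asymptotic to \<open>a n\<close>; so \<open>f (n + x) / f n\<close> and \<open>\<gamma> (n + x) / \<gamma> n\<close> are both
  asymptotic to \<open>(a n)^x\<close>.
\<close>

lemma log_convex_solution_unique:
  fixes f :: "real \<Rightarrow> real" and \<gamma> :: "real \<Rightarrow> complex" and a :: "nat \<Rightarrow> real"
  assumes pos: "\<And>x. x \<ge> 0 \<Longrightarrow> f x > 0"
    and conv: "\<And>u v \<theta>. u \<ge> 0 \<Longrightarrow> v \<ge> 0 \<Longrightarrow> 0 \<le> \<theta> \<Longrightarrow> \<theta> \<le> 1 \<Longrightarrow>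
      f ((1 - \<theta>) * u + \<theta> * v) \<le> f u powr (1 - \<theta>) * f v powr \<theta>"
    and nz: "\<And>x. x \<ge> 0 \<Longrightarrow> \<gamma> x \<noteq> 0"
    and per: "\<And>x. x \<ge> 0 \<Longrightarrow> of_real (f (x + 1)) / \<gamma> (x + 1) = of_real (f x) / \<gamma> x"
    and apos: "\<And>n. n > 0 \<Longrightarrow> a n > 0"
    and aratio: "(\<lambda>n. a n / a (Suc n)) \<longlonglongrightarrow> 1"
    and asym: "\<And>x. 0 \<le> x \<Longrightarrow> x \<le> 1 \<Longrightarrow>
      (\<lambda>n. \<gamma> (real n + x) / (\<gamma> (real n) * of_real (a n powr x))) \<longlonglongrightarrow> 1"
    and x: "0 \<le> x" "x \<le> 1"
  shows "of_real (f x) / \<gamma> x = of_real (f 0) / \<gamma> 0"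
proof -
  define F where "F y = of_real (f y) / \<gamma> y" for y
  have Fnz: "F y \<noteq> 0" if "y \<ge> 0" for y
    using pos[OF that] nz[OF that] by (simp add: F_def)
  have Fper: "F (real n + y) = F y" if "y \<ge> 0" for n y
  proof (induction n)
    case (Suc n)
    have "F (real (Suc n) + y) = F ((real n + y) + 1)" by (simp add: add_ac)
    also have "\<dots> = F (real n + y)" unfolding F_def using that by (intro per) simp
    finally show ?case using Suc by simp
  qed simp
  define q where "q n y = f (real n + y) / (f (real n) * a n powr y)" for n y
  have qpos: "q n y > 0" if "n > 0" "y \<ge> 0" for n y
    using pos[of "real n + y"] pos[of "real n"] apos[OF that(1)] that by (simp add: q_def)
  have qlim: "(\<lambda>n. complex_of_real (q n y)) \<longlonglongrightarrow> F y / F 0" if y: "0 \<le> y" "y \<le> 1" for y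
  proof -
    have "complex_of_real (q n y) = F y / F 0 * (\<gamma> (real n + y) / (\<gamma> (real n) * of_real (a n powr y)))" for n
    proof -
      have "of_real (f (real n + y)) = F y * \<gamma> (real n + y)" "of_real (f (real n)) = F 0 * \<gamma> (real n)"
        using Fper[OF y(1), of n] Fper[of 0 n] nz[of "real n + y"] nz[of "real n"] y(1)
        by (auto simp: F_def field_simps)
      then show ?thesis by (simp add: q_def)
    qed
    then show ?thesis
      using tendsto_mult[OF tendsto_const asym[OF y], of "F y / F 0"] by simp
  qed
  have q1: "(\<lambda>n. q n 1) \<longlonglongrightarrow> 1"
  proof -
    have "F 1 = F 0" using Fper[of 0 1] by simp
    then have "(\<lambda>n. complex_of_real (q n 1)) \<longlonglongrightarrow> of_real 1"
      using qlim[of 1] Fnz[of 0] by simp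
    then show ?thesis by (simp only: tendsto_of_real_iff)
  qed
  have upper: "q (Suc n) x \<le> q (Suc n) 1 powr x" for n
  proof -
    let ?u = "f (real (Suc n))" and ?v = "f (real (Suc n) + 1)" and ?A = "a (Suc n)"
    have p: "?u > 0" "?v > 0" "?A > 0" by (auto intro!: pos apos)
    have "f (real (Suc n) + x) = f ((1 - x) * real (Suc n) + x * (real (Suc n) + 1))"
      by (simp add: algebra_simps)
    also have "\<dots> \<le> ?u powr (1 - x) * ?v powr x" using x by (intro conv) auto
    finally have "q (Suc n) x \<le> ?u powr (1 - x) * ?v powr x / (?u * ?A powr x)"
      unfolding q_def using p by (intro divide_right_mono) auto
    also have "\<dots> = q (Suc n) 1 powr x"
      using p by (simp add: q_def powr_divide powr_mult powr_diff)
    finally show ?thesis .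
  qed
  have lower: "(q n 1 * (a n / a (Suc n))) powr x \<le> q (Suc n) x" if n: "n > 0" for n
  proof -
    let ?u = "f (real n)" and ?v = "f (real (Suc n))" and ?w = "f (real (Suc n) + x)"
    have p: "?u > 0" "?v > 0" "?w > 0" "a n > 0" "a (Suc n) > 0" using x n by (auto intro!: pos apos)
    \<comment> \<open>\<open>n + 1\<close> is the convex combination of \<open>n\<close> and \<open>n + 1 + x\<close> with weight \<open>1 / (1 + x)\<close> on the latter\<close>
    define \<theta> where "\<theta> = 1 / (1 + x)"
    have \<theta>: "\<theta> * (1 + x) = 1" "0 \<le> \<theta>" "\<theta> \<le> 1" using x by (auto simp: \<theta>_def)
    then have "\<theta> + \<theta> * x = 1" by (simp add: distrib_left)
    then have "(1 - \<theta>) * real n + \<theta> * (real (Suc n) + x) = real (Suc n)"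
      by (simp add: algebra_simps)
    then have "?v \<le> ?u powr (1 - \<theta>) * ?w powr \<theta>"
      using conv[of "real n" "real (Suc n) + x" \<theta>] x \<theta> by simp
    then have "?v powr (1 + x) \<le> (?u powr (1 - \<theta>) * ?w powr \<theta>) powr (1 + x)"
      using p x by (intro powr_mono2) auto
    also have "\<dots> = ?u powr x * ?w"
    proof -
      have "(1 - \<theta>) * (1 + x) = x" using \<theta>(1) by (simp add: left_diff_distrib)
      then show ?thesis using p \<theta>(1) by (simp add: powr_mult powr_powr)
    qed
    finally have "?v * ?v powr x \<le> ?u powr x * ?w"
      using p by (simp add: powr_add)
    then have "(?v / ?u) powr x \<le> ?w / ?v"
      using p by (simp add: powr_divide field_simps)
    then have "(?v / ?u) powr x / a (Suc n) powr x \<le> ?w / ?v / a (Suc n) powr x"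
      by (intro divide_right_mono) auto
    moreover have "q n 1 * (a n / a (Suc n)) = (?v / ?u) / a (Suc n)"
      using p by (simp add: q_def add.commute)
    ultimately show ?thesis using p by (simp add: q_def powr_divide powr_mult)
  qed
  have "(\<lambda>n. q (Suc n) x) \<longlonglongrightarrow> 1"
  proof (rule tendsto_sandwich)
    show "\<forall>\<^sub>F n in sequentially. (q n 1 * (a n / a (Suc n))) powr x \<le> q (Suc n) x"
      using eventually_gt_at_top[of 0] by eventually_elim (rule lower)
    show "\<forall>\<^sub>F n in sequentially. q (Suc n) x \<le> q (Suc n) 1 powr x"
      using upper by simp
    show "(\<lambda>n. (q n 1 * (a n / a (Suc n))) powr x) \<longlonglongrightarrow> 1"
      using tendsto_powr[OF tendsto_mult[OF q1 aratio] tendsto_const[of x]] by simp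
    show "(\<lambda>n. q (Suc n) 1 powr x) \<longlonglongrightarrow> 1"
      using tendsto_powr[OF LIMSEQ_Suc[OF q1] tendsto_const[of x]] by simp
  qed
  then have "(\<lambda>n. complex_of_real (q (Suc n) x)) \<longlonglongrightarrow> of_real 1"
    by (intro tendsto_of_real)
  with LIMSEQ_Suc[OF qlim[OF x]] have "F x / F 0 = of_real 1"
    by (rule LIMSEQ_unique)
  then have "F x = F 0" using Fnz[of 0] by simp
  then show ?thesis by (simp only: F_def)
qed

text \<open>
  Gauss's product formula for Gamma at \<open>w - 1\<close> and at \<open>w + y - 1\<close>, divided by each other. The shift by one turns
  the Pochhammer symbol with \<open>N + 1\<close> factors into \<open>Gamma (w + N)\<close>; it requires \<open>Re w > 1\<close>.
\<close>

lemma Gamma_ratio_asymptotics: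
  assumes w: "Re w > 1" and y: "y \<ge> 0"
  shows "(\<lambda>N. Gamma (w + of_nat N + of_real y) / (Gamma (w + of_nat N) * of_real (real N powr y))) \<longlonglongrightarrow> 1"
proof -
  have A: "(\<lambda>N. Gamma (u + of_nat N) / (fact N * exp ((u - 1) * of_real (ln (real N))))) \<longlonglongrightarrow> 1" if u: "Re u > 1" for u :: complex
  proof -
    have nz: "u - 1 \<notin> \<int>\<^sub>\<le>\<^sub>0"
    proof
      assume "u - 1 \<in> \<int>\<^sub>\<le>\<^sub>0"
      then obtain n where "u - 1 = of_int n" "n \<le> 0" by (elim nonpos_Ints_cases)
      from arg_cong[OF this(1), of Re] this(2) u show False by simp
    qed
    have "(\<lambda>N. inverse (Gamma_series (u - 1) N) * Gamma (u - 1)) \<longlonglongrightarrow> inverse (Gamma (u - 1)) * Gamma (u - 1)"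
      by (intro tendsto_intros) (simp add: Gamma_eq_zero_iff nz)
    also have "inverse (Gamma (u - 1)) * Gamma (u - 1) = 1"
      using nz by (simp add: Gamma_eq_zero_iff)
    also have "(\<lambda>N. inverse (Gamma_series (u - 1) N) * Gamma (u - 1)) =
        (\<lambda>N. Gamma (u + of_nat N) / (fact N * exp ((u - 1) * of_real (ln (real N)))))"
    proof
      fix N
      have "pochhammer (u - 1) (N + 1) = Gamma (u - 1 + of_nat (N + 1)) / Gamma (u - 1)"
        by (rule pochhammer_Gamma[OF nz])
      then show "inverse (Gamma_series (u - 1) N) * Gamma (u - 1) =
          Gamma (u + of_nat N) / (fact N * exp ((u - 1) * of_real (ln (real N))))"
        using nz by (simp add: Gamma_series_def Gamma_eq_zero_iff field_simps)
    qed
    finally show ?thesis .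
  qed
  have "(\<lambda>N. (Gamma (w + of_real y + of_nat N) / (fact N * exp ((w + of_real y - 1) * of_real (ln (real N))))) /
            (Gamma (w + of_nat N) / (fact N * exp ((w - 1) * of_real (ln (real N)))))) \<longlonglongrightarrow> 1 / 1"
    using w y by (intro tendsto_divide A) auto
  then have "(\<lambda>N. (Gamma (w + of_real y + of_nat N) / (fact N * exp ((w + of_real y - 1) * of_real (ln (real N))))) /
            (Gamma (w + of_nat N) / (fact N * exp ((w - 1) * of_real (ln (real N)))))) \<longlonglongrightarrow> 1" by simp
  moreover have "\<forall>\<^sub>F N in sequentially.
      (Gamma (w + of_real y + of_nat N) / (fact N * exp ((w + of_real y - 1) * of_real (ln (real N))))) /
            (Gamma (w + of_nat N) / (fact N * exp ((w - 1) * of_real (ln (real N))))) =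
      Gamma (w + of_nat N + of_real y) / (Gamma (w + of_nat N) * of_real (real N powr y))"
    using eventually_gt_at_top[of 0]
  proof eventually_elim
    case (elim N)
    have "exp ((w + of_real y - 1) * of_real (ln (real N))) =
        exp ((w - 1) * of_real (ln (real N))) * complex_of_real (real N powr y)"
      using elim by (simp add: powr_def exp_of_real[symmetric] algebra_simps flip: exp_add)
    then show ?case by (simp add: add_ac)
  qed
  ultimately show ?thesis by (rule Lim_transform_eventually)
qed

lemma Gamma_ratio_asymptotics_multiple:
  assumes w: "Re w > 1" and x: "x \<ge> 0"
  shows "(\<lambda>n. Gamma (w + of_nat m * of_real (real n + x)) /
     (Gamma (w + of_nat m * of_real (real n)) * of_real ((real (m * n) ^ m) powr x))) \<longlonglongrightarrow> 1"
proof (cases "m = 0")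
  case True
  have "w \<notin> \<int>\<^sub>\<le>\<^sub>0" using w by (auto elim!: nonpos_Ints_cases)
  then show ?thesis using True by (simp add: Gamma_eq_zero_iff)
next
  case False
  have "filterlim (\<lambda>n. m * n) at_top sequentially"
    using False by (intro filterlim_subseq strict_monoI) simp
  from filterlim_compose[OF Gamma_ratio_asymptotics[OF w, of "real m * x"] this] x
  have *: "(\<lambda>n. Gamma (w + of_nat (m * n) + of_real (real m * x)) /
     (Gamma (w + of_nat (m * n)) * of_real (real (m * n) powr (real m * x)))) \<longlonglongrightarrow> 1" by simp
  have "\<forall>\<^sub>F n in sequentially. Gamma (w + of_nat (m * n) + of_real (real m * x)) /
     (Gamma (w + of_nat (m * n)) * of_real (real (m * n) powr (real m * x))) =
     Gamma (w + of_nat m * of_real (real n + x)) /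
     (Gamma (w + of_nat m * of_real (real n)) * of_real ((real (m * n) ^ m) powr x))"
    using eventually_gt_at_top[of 0]
  proof eventually_elim
    case (elim n)
    have "real (m * n) powr (real m * x) = (real (m * n) ^ m) powr x"
      using elim False by (simp add: powr_powr[symmetric] powr_realpow del: of_nat_mult)
    then show ?case by (simp add: algebra_simps)
  qed
  with * show ?thesis by (rule Lim_transform_eventually)
qed

section \<open>Holomorphic functions of several variables\<close>

lemma holomorphic_sv_on_const: "holomorphic_sv_on (\<lambda>_. c) A"
  unfolding holomorphic_sv_on_def by (auto intro!: exI[of _ "\<lambda>_. 0"])

lemma holomorphic_sv_on_mult:
  assumes "holomorphic_sv_on f A" "holomorphic_sv_on g A"
  shows "holomorphic_sv_on (\<lambda>x. f x * g x) A"
  unfolding holomorphic_sv_on_def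
proof
  fix x assume "x \<in> A"
  with assms obtain D E where D: "(f has_derivative D) (at x)" "\<forall>c v. D (c *s v) = c * D v"
    and E: "(g has_derivative E) (at x)" "\<forall>c v. E (c *s v) = c * E v"
    unfolding holomorphic_sv_on_def by metis
  from has_derivative_mult[OF D(1) E(1)] D(2) E(2)
  show "\<exists>D. ((\<lambda>x. f x * g x) has_derivative D) (at x) \<and> (\<forall>c v. D (c *s v) = c * D v)"
    by - (rule exI, rule conjI, assumption, simp add: algebra_simps)
qed

lemma holomorphic_sv_on_diff:
  assumes "holomorphic_sv_on f A" "holomorphic_sv_on g A"
  shows "holomorphic_sv_on (\<lambda>x. f x - g x) A"
  unfolding holomorphic_sv_on_def
proof
  fix x assume "x \<in> A"
  with assms obtain D E where D: "(f has_derivative D) (at x)" "\<forall>c v. D (c *s v) = c * D v"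
    and E: "(g has_derivative E) (at x)" "\<forall>c v. E (c *s v) = c * E v"
    unfolding holomorphic_sv_on_def by metis
  from has_derivative_diff[OF D(1) E(1)] D(2) E(2)
  show "\<exists>D. ((\<lambda>x. f x - g x) has_derivative D) (at x) \<and> (\<forall>c v. D (c *s v) = c * D v)"
    by - (rule exI, rule conjI, assumption, simp add: algebra_simps)
qed

lemma holomorphic_sv_on_prod:
  "(\<And>i. i \<in> I \<Longrightarrow> holomorphic_sv_on (f i) A) \<Longrightarrow> holomorphic_sv_on (\<lambda>x. \<Prod>i\<in>I. f i x) A"
  by (induction I rule: infinite_finite_induct)
     (auto intro: holomorphic_sv_on_const holomorphic_sv_on_mult)

lemma holomorphic_sv_on_power:
  "holomorphic_sv_on f A \<Longrightarrow> holomorphic_sv_on (\<lambda>x. f x ^ n) A"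
  by (induction n) (auto intro: holomorphic_sv_on_const holomorphic_sv_on_mult simp: power_Suc)

lemma holomorphic_sv_on_compose:
  assumes "holomorphic_sv_on f A" and g: "\<And>w. (g has_field_derivative g' w) (at w)"
  shows "holomorphic_sv_on (\<lambda>x. g (f x)) A"
  unfolding holomorphic_sv_on_def
proof
  fix x assume "x \<in> A"
  with assms obtain D where D: "(f has_derivative D) (at x)" "\<forall>c v. D (c *s v) = c * D v"
    unfolding holomorphic_sv_on_def by metis
  from has_derivative_compose[OF D(1) g[unfolded has_field_derivative_def]] D(2)
  show "\<exists>D. ((\<lambda>x. g (f x)) has_derivative D) (at x) \<and> (\<forall>c v. D (c *s v) = c * D v)"
    by - (rule exI, rule conjI, assumption, simp)
qed

lemma holomorphic_sv_on_affine:
  "holomorphic_sv_on (\<lambda>s::complex^'r::finite. (\<Sum>k\<in>UNIV. a k * s $ k) + c) A"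
  unfolding holomorphic_sv_on_def
proof
  fix x :: "complex^'r"
  let ?T = "\<lambda>s::complex^'r. \<Sum>k\<in>UNIV. a k * s $ k"
  have "bounded_linear ?T"
    by (intro bounded_linear_sum bounded_linear_const_mult bounded_linear_component)
  then have "((\<lambda>s. ?T s + c) has_derivative ?T) (at x)"
    using has_derivative_add[OF bounded_linear_imp_has_derivative has_derivative_const] by fastforce
  moreover have "\<forall>c v. ?T (c *s v) = c * ?T v" by (simp add: sum_distrib_left mult_ac)
  ultimately show "\<exists>D. ((\<lambda>s. ?T s + c) has_derivative D) (at x) \<and> (\<forall>c v. D (c *s v) = c * D v)" by blast
qed

lemma continuous_holomorphic_sv:
  "holomorphic_sv_on f A \<Longrightarrow> x \<in> A \<Longrightarrow> isCont f x"
  unfolding holomorphic_sv_on_def using has_derivative_continuous by blast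

text \<open>
  The variables are released from the real axis one after the other, by the identity theorem in one
  variable; \<open>A\<close> is the set of variables already allowed to be complex.
\<close>

lemma identity_theorem_orthant:
  fixes \<Phi> :: "complex^'r::finite \<Rightarrow> complex"
  assumes hol: "holomorphic_sv_on \<Phi> {s. \<forall>k. Re (s $ k) > 0}" and N: "N \<ge> 0"
    and zero: "\<And>t. (\<And>k. t k > N) \<Longrightarrow> \<Phi> (\<chi> k. of_real (t k)) = 0"
    and s: "\<And>k. Re (s $ k) > 0"
  shows "\<Phi> s = 0"
proof -
  have "\<forall>s. (\<forall>k. Re (s $ k) > 0) \<longrightarrow> (\<forall>k. k \<notin> A \<longrightarrow> Im (s $ k) = 0 \<and> Re (s $ k) > N) \<longrightarrow> \<Phi> s = 0"
    if "finite A" for A :: "'r set"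
    using that
  proof induction
    case empty
    show ?case
    proof (intro allI impI)
      fix s :: "complex^'r" assume a: "\<forall>k. k \<notin> {} \<longrightarrow> Im (s $ k) = 0 \<and> Re (s $ k) > N"
      then have "s = (\<chi> k. of_real (Re (s $ k)))" by (simp add: vec_eq_iff complex_eq_iff)
      with zero[of "\<lambda>k. Re (s $ k)"] a show "\<Phi> s = 0" by simp
    qed
  next
    case (insert i A)
    show ?case
    proof (intro allI impI)
      fix s :: "complex^'r" assume s: "\<forall>k. Re (s $ k) > 0"
        and r: "\<forall>k. k \<notin> insert i A \<longrightarrow> Im (s $ k) = 0 \<and> Re (s $ k) > N"
      let ?x = "s - (s $ i) *s axis i 1"
      let ?p = "\<lambda>w. ?x + w *s axis i 1"
      have p: "?p w $ k = (if k = i then w else s $ k)" for w k by (simp add: axis_def)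
      let ?H = "{w. Re w > 0}"
      let ?U = "{w. Im w = 0 \<and> Re w > N}"
      have "\<Phi> (?p (s $ i)) = 0"
      proof (rule analytic_continuation[of "\<lambda>w. \<Phi> (?p w)" ?H ?U "of_real (N + 1)"])
        show "(\<lambda>w. \<Phi> (?p w)) holomorphic_on ?H"
        proof (rule holomorphic_onI)
          fix w assume w: "w \<in> ?H"
          have "?p w \<in> {s. \<forall>k. Re (s $ k) > 0}" using w s by (simp add: p del: vector_add_component vector_minus_component vector_smult_component)
          with hol obtain D where "(\<Phi> has_derivative D) (at (?p w))" "\<And>c v. D (c *s v) = c * D v"
            unfolding holomorphic_sv_on_def by blast
          from has_field_derivative_along_axis[OF this]
          show "(\<lambda>w. \<Phi> (?p w)) field_differentiable at w within ?H"
            using field_differentiable_def field_differentiable_at_within by blast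
        qed
        show "open ?H" by (rule open_halfspace_Re_gt)
        show "connected ?H" by (intro convex_connected convex_halfspace_Re_gt)
        show "?U \<subseteq> ?H" using N by auto
        show "of_real (N + 1) \<in> ?H" using N by simp
        show "(of_real (N + 1) :: complex) islimpt ?U"
          unfolding islimpt_approachable
        proof (intro allI impI)
          fix e :: real assume "e > 0"
          then show "\<exists>x'\<in>?U. x' \<noteq> of_real (N + 1) \<and> dist x' (of_real (N + 1)) < e"
            by (intro bexI[of _ "of_real (N + 1 + e / 2)"]) (auto simp: dist_norm norm_of_real simp flip: of_real_diff)
        qed
        show "\<Phi> (?p w) = 0" if "w \<in> ?U" for w
        proof -
          have "\<forall>k. Re (?p w $ k) > 0" "\<forall>k. k \<notin> A \<longrightarrow> Im (?p w $ k) = 0 \<and> Re (?p w $ k) > N"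
            using that s r N by (auto simp: p simp del: vector_add_component vector_minus_component vector_smult_component)
          with insert.IH show ?thesis by blast
        qed
        show "s $ i \<in> ?H" using s by simp
      qed
      then show "\<Phi> s = 0" by simp
    qed
  qed
  from this[of UNIV] s show ?thesis by simp
qed

section \<open>The product of Gamma functions\<close>

text \<open>
  The part of the structure theorem for b-functions that matters for the Gamma product. The smallest index
  in the support of each \<open>z i\<close> has positive exponent.
\<close>

locale gamma_data =
  fixes c' :: "'r::finite \<Rightarrow> real" and l :: nat and \<mu> :: "nat \<Rightarrow> 'r \<Rightarrow> nat"
    and \<alpha> :: "nat \<Rightarrow> complex" and z :: "nat \<Rightarrow> int \<Rightarrow> int"
  assumes c'_pos: "\<And>k. c' k > 0"
    and \<mu>_nonzero: "\<And>i. i \<in> {1..l} \<Longrightarrow> \<exists>k. \<mu> i k \<noteq> 0"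
    and finite_support: "\<And>i. i \<in> {1..l} \<Longrightarrow> finite {j. z i j \<noteq> 0}"
    and support_nonempty: "\<And>i. i \<in> {1..l} \<Longrightarrow> {j. z i j \<noteq> 0} \<noteq> {}"
    and z_Min: "\<And>i. i \<in> {1..l} \<Longrightarrow> z i (Min {j. z i j \<noteq> 0}) > 0"
begin

definition gamma_arg :: "nat \<Rightarrow> int \<Rightarrow> complex^'r \<Rightarrow> complex" where
  "gamma_arg i j s = lin_form (\<mu> i) s + \<alpha> i + of_int j"

definition gamma_product :: "complex^'r \<Rightarrow> complex" where
  "gamma_product s = (\<Prod>k\<in>UNIV. of_real (c' k) powr (s $ k)) *
     (\<Prod>i\<in>{1..l}. \<Prod>j | z i j \<noteq> 0. Gamma (gamma_arg i j s) powi z i j)"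

text \<open>
  Numerator and denominator of the Gamma product as entire functions, in terms of \<open>rGamma\<close>: factors with
  positive exponent go to the denominator. The truncation in \<open>nat\<close> turns all other factors into one.
\<close>

definition numer :: "complex^'r \<Rightarrow> complex" where
  "numer s = (\<Prod>k\<in>UNIV. of_real (c' k) powr (s $ k)) *
     (\<Prod>i\<in>{1..l}. \<Prod>j | z i j \<noteq> 0. rGamma (gamma_arg i j s) ^ nat (- z i j))"

definition denom :: "complex^'r \<Rightarrow> complex" where
  "denom s = (\<Prod>i\<in>{1..l}. \<Prod>j | z i j \<noteq> 0. rGamma (gamma_arg i j s) ^ nat (z i j))"

lemma holomorphic_rGamma_arg: "holomorphic_sv_on (\<lambda>s. rGamma (gamma_arg i j s)) A"
proof (rule holomorphic_sv_on_compose[where g = rGamma and g' = "deriv rGamma"])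
  show "holomorphic_sv_on (gamma_arg i j) A"
    unfolding gamma_arg_def[abs_def] lin_form_def add.assoc by (rule holomorphic_sv_on_affine)
  show "(rGamma has_field_derivative deriv rGamma w) (at w)" for w :: complex
    by (metis DERIV_deriv_iff_field_differentiable field_differentiable_rGamma)
qed

lemma holomorphic_denom: "holomorphic_sv_on denom A"
  unfolding denom_def[abs_def]
  by (intro holomorphic_sv_on_prod holomorphic_sv_on_power holomorphic_rGamma_arg)

lemma holomorphic_numer: "holomorphic_sv_on numer A"
proof -
  have "holomorphic_sv_on (\<lambda>s. complex_of_real (c' k) powr (s $ k)) A" for k
  proof -
    have eq: "(\<Sum>i\<in>UNIV. (if i = k then Ln (of_real (c' k)) else 0) * s $ i) = Ln (of_real (c' k)) * s $ k"
      for s :: "complex^'r"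
      by (simp add: if_distrib[of "\<lambda>x. x * _"] cong: if_cong)
    have "holomorphic_sv_on (\<lambda>s. exp ((\<Sum>i\<in>UNIV. (if i = k then Ln (of_real (c' k)) else 0) * s $ i) + 0)) A"
      by (rule holomorphic_sv_on_compose[OF holomorphic_sv_on_affine DERIV_exp])
    then show ?thesis
      unfolding eq using c'_pos[of k] by (simp add: powr_def mult.commute)
  qed
  then show ?thesis
    unfolding numer_def[abs_def]
    by (intro holomorphic_sv_on_mult holomorphic_sv_on_prod holomorphic_sv_on_power holomorphic_rGamma_arg)
qed

lemma gamma_product_times_denom:
  assumes "denom s \<noteq> 0"
  shows "gamma_product s * denom s = numer s"
proof -
  have nz: "rGamma (gamma_arg i j s) \<noteq> 0" if "i \<in> {1..l}" "z i j > 0" for i j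
  proof
    assume "rGamma (gamma_arg i j s) = 0"
    then have "(\<Prod>j | z i j \<noteq> 0. rGamma (gamma_arg i j s) ^ nat (z i j)) = 0"
      using finite_support that by (intro prod_zero) (auto intro!: exI[of _ j])
    then have "denom s = 0"
      unfolding denom_def using that(1) by (intro prod_zero) auto
    with assms show False by simp
  qed
  have "Gamma (gamma_arg i j s) powi z i j * rGamma (gamma_arg i j s) ^ nat (z i j) = rGamma (gamma_arg i j s) ^ nat (- z i j)"
    if i: "i \<in> {1..l}" and j: "z i j \<noteq> 0" for i j
  proof (cases "z i j > 0")
    case True
    have "Gamma (gamma_arg i j s) powi z i j * rGamma (gamma_arg i j s) ^ nat (z i j) = 1"
      using nz[OF i True] True by (simp add: Gamma_def power_int_def power_inverse)
    then show ?thesis using True by simp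
  next
    case False
    then show ?thesis using j by (simp add: Gamma_def power_int_def)
  qed
  then show ?thesis
    unfolding gamma_product_def denom_def numer_def mult.assoc prod.distrib[symmetric]
    by (intro arg_cong2[of _ _ _ _ "(*)"] refl prod.cong) auto
qed

lemma denom_eq_0_iff:
  "denom s = 0 \<longleftrightarrow> (\<exists>i\<in>{1..l}. \<exists>j. z i j > 0 \<and> gamma_arg i j s \<in> \<int>\<^sub>\<le>\<^sub>0)"
proof -
  have "denom s = 0 \<longleftrightarrow> (\<exists>i\<in>{1..l}. \<exists>j. z i j \<noteq> 0 \<and> z i j > 0 \<and> gamma_arg i j s \<in> \<int>\<^sub>\<le>\<^sub>0)"
    unfolding denom_def using finite_support by (auto simp: rGamma_eq_zero_iff)
  then show ?thesis by auto
qed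

lemma numer_eq_0_iff:
  "numer s = 0 \<longleftrightarrow> (\<exists>i\<in>{1..l}. \<exists>j. z i j < 0 \<and> gamma_arg i j s \<in> \<int>\<^sub>\<le>\<^sub>0)"
proof -
  have "of_real (c' k) powr (s $ k) \<noteq> (0::complex)" for k using c'_pos[of k] by simp
  then have "numer s = 0 \<longleftrightarrow> (\<exists>i\<in>{1..l}. \<exists>j. z i j \<noteq> 0 \<and> z i j < 0 \<and> gamma_arg i j s \<in> \<int>\<^sub>\<le>\<^sub>0)"
    unfolding numer_def using finite_support by (auto simp: rGamma_eq_zero_iff)
  then show ?thesis by auto
qed

subsection \<open>Behaviour for large real arguments\<close>

definition real_vec :: "('r \<Rightarrow> real) \<Rightarrow> complex^'r" where
  "real_vec t = (\<chi> k. of_real (t k))"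

lemma lin_form_real_vec_shift:
  "lin_form (\<mu> i) (real_vec (t(k := t k + x))) = lin_form (\<mu> i) (real_vec t) + of_nat (\<mu> i k) * of_real x"
proof -
  have "lin_form (\<mu> i) (real_vec (t(k := t k + x))) =
        (\<Sum>q\<in>UNIV. of_nat (\<mu> i q) * of_real (t q) + (if q = k then of_nat (\<mu> i k) * of_real x else 0))"
    unfolding lin_form_def real_vec_def by (intro sum.cong) (auto simp: distrib_left)
  then show ?thesis by (simp add: sum.distrib lin_form_def real_vec_def)
qed

lemma gamma_arg_shift: "gamma_arg i j (real_vec (t(k := t k + x))) = gamma_arg i j (real_vec t) + of_nat (\<mu> i k) * of_real x"
  by (simp add: gamma_arg_def lin_form_real_vec_shift)

text \<open>
  At least one coefficient of the form is a positive integer and the others are nonnegative.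
\<close>

lemma Re_lin_form_ge:
  assumes i: "i \<in> {1..l}" and t: "\<And>k. t k > N" and N: "N \<ge> 0"
  shows "Re (lin_form (\<mu> i) (real_vec t)) > N"
proof -
  obtain k where k: "\<mu> i k \<noteq> 0" using \<mu>_nonzero[OF i] by blast
  have t0: "t q \<ge> 0" for q using t[of q] N by linarith
  have "N < t k" by (rule t)
  also have "\<dots> \<le> real (\<mu> i k) * t k" using k t0[of k] by (simp add: mult_le_cancel_right1)
  also have "\<dots> \<le> (\<Sum>q\<in>UNIV. real (\<mu> i q) * t q)"
    using t0 by (intro member_le_sum) auto
  finally show ?thesis by (simp add: lin_form_def real_vec_def)
qed

lemma Re_gamma_arg_large:
  obtains N where "N \<ge> 0" "\<And>t i j. (\<And>k. t k > N) \<Longrightarrow> i \<in> {1..l} \<Longrightarrow> z i j \<noteq> 0 \<Longrightarrow> Re (gamma_arg i j (real_vec t)) > 1"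
proof -
  define N where "N = 1 + (\<Sum>i\<in>{1..l}. \<Sum>j | z i j \<noteq> 0. norm (\<alpha> i) + \<bar>of_int j\<bar>)"
  have N: "1 + (norm (\<alpha> i) + \<bar>of_int j\<bar>) \<le> N" if i: "i \<in> {1..l}" and j: "z i j \<noteq> 0" for i j
  proof -
    have "norm (\<alpha> i) + \<bar>of_int j\<bar> \<le> (\<Sum>j | z i j \<noteq> 0. norm (\<alpha> i) + \<bar>of_int j\<bar>)"
      using finite_support[OF i] j by (intro member_le_sum) auto
    also have "\<dots> \<le> (\<Sum>i\<in>{1..l}. \<Sum>j | z i j \<noteq> 0. norm (\<alpha> i) + \<bar>of_int j\<bar>)"
      using i by (intro member_le_sum[of i "{1..l}" "\<lambda>i. \<Sum>j | z i j \<noteq> 0. norm (\<alpha> i) + \<bar>of_int j\<bar>"]) (auto intro!: sum_nonneg)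
    finally show ?thesis by (simp add: N_def)
  qed
  have N0: "N \<ge> 0" by (auto simp: N_def intro!: add_nonneg_nonneg sum_nonneg)
  show thesis
  proof (rule that[OF N0])
    fix t :: "'r \<Rightarrow> real" and i j assume t: "\<And>k. t k > N" and i: "i \<in> {1..l}" and j: "z i j \<noteq> 0"
    have "Re (lin_form (\<mu> i) (real_vec t)) > N" by (rule Re_lin_form_ge[OF i t N0])
    then show "Re (gamma_arg i j (real_vec t)) > 1"
      using N[OF i j] abs_Re_le_cmod[of "\<alpha> i"] by (simp add: gamma_arg_def)
  qed
qed

text \<open>
  The leading term of the quotient of \<open>gamma_product\<close> at two points that differ by one in coordinate \<open>k\<close>, as
  this coordinate grows like \<open>n\<close>. Coordinates with \<open>\<mu> i k = 0\<close> contribute \<open>0 ^ 0 = 1\<close>.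
\<close>

definition step_asymptotics :: "'r \<Rightarrow> nat \<Rightarrow> real" where
  "step_asymptotics k n = c' k * (\<Prod>i\<in>{1..l}. \<Prod>j | z i j \<noteq> 0. (real (\<mu> i k * n) ^ \<mu> i k) powi z i j)"

lemma step_asymptotics_pos: "n > 0 \<Longrightarrow> step_asymptotics k n > 0"
proof -
  assume n: "n > 0"
  have "real (m * n) ^ m > 0" for m using n by (cases "m = 0") auto
  then show ?thesis
    unfolding step_asymptotics_def by (intro mult_pos_pos prod_pos c'_pos zero_less_power_int) auto
qed

lemma step_asymptotics_ratio:
  "(\<lambda>n. step_asymptotics k n / step_asymptotics k (Suc n)) \<longlonglongrightarrow> 1"
proof -
  have base: "(\<lambda>n. (real (m * n) ^ m / real (m * Suc n) ^ m) powi q) \<longlonglongrightarrow> 1" for m :: nat and q :: int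
  proof (cases "m = 0")
    case False
    have "(\<lambda>n. real n / real (Suc n)) \<longlonglongrightarrow> 1" by (rule LIMSEQ_n_over_Suc_n)
    then have "(\<lambda>n. ((real n / real (Suc n)) ^ m) powi q) \<longlonglongrightarrow> (1 ^ m) powi q"
      by (intro tendsto_power_int tendsto_power) auto
    moreover have "(real n / real (Suc n)) ^ m = real (m * n) ^ m / real (m * Suc n) ^ m" for n
    proof -
      have "real n / real (Suc n) = real (m * n) / real (m * Suc n)"
        using False by (simp del: of_nat_Suc mult_Suc_right)
      then show ?thesis by (simp only: power_divide)
    qed
    ultimately show ?thesis by simp
  qed simp
  have "step_asymptotics k n / step_asymptotics k (Suc n) =
      (\<Prod>i\<in>{1..l}. \<Prod>j | z i j \<noteq> 0. (real (\<mu> i k * n) ^ \<mu> i k / real (\<mu> i k * Suc n) ^ \<mu> i k) powi z i j)" for n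
    using c'_pos[of k] by (simp add: step_asymptotics_def power_int_divide_distrib prod_dividef)
  moreover have "(\<lambda>n. \<Prod>i\<in>{1..l}. \<Prod>j | z i j \<noteq> 0. (real (\<mu> i k * n) ^ \<mu> i k / real (\<mu> i k * Suc n) ^ \<mu> i k) powi z i j)
      \<longlonglongrightarrow> (\<Prod>i\<in>{1..l}. \<Prod>j | z i j \<noteq> 0. 1)"
    by (intro tendsto_prod base)
  ultimately show ?thesis by simp
qed

lemma gamma_product_asymptotics:
  assumes t: "\<And>i j. i \<in> {1..l} \<Longrightarrow> z i j \<noteq> 0 \<Longrightarrow> Re (gamma_arg i j (real_vec t)) > 1" and x: "x \<ge> 0"
  shows "(\<lambda>n. gamma_product (real_vec (t(k := t k + (real n + x)))) /
     (gamma_product (real_vec (t(k := t k + real n))) * of_real (step_asymptotics k n powr x))) \<longlonglongrightarrow> 1"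
proof -
  let ?R = "\<lambda>i j n. Gamma (gamma_arg i j (real_vec t) + of_nat (\<mu> i k) * of_real (real n + x)) /
     (Gamma (gamma_arg i j (real_vec t) + of_nat (\<mu> i k) * of_real (real n)) * of_real ((real (\<mu> i k * n) ^ \<mu> i k) powr x))"
  have lim: "(\<lambda>n. \<Prod>i\<in>{1..l}. \<Prod>j | z i j \<noteq> 0. ?R i j n powi z i j) \<longlonglongrightarrow> (\<Prod>i\<in>{1..l}. \<Prod>j | z i j \<noteq> 0. 1 powi z i j)"
    by (intro tendsto_prod tendsto_power_int Gamma_ratio_asymptotics_multiple t x) auto
  have cpow: "(\<Prod>q\<in>UNIV. complex_of_real (c' q) powr (real_vec (t(k := t k + y)) $ q)) =
      (\<Prod>q\<in>UNIV. of_real (c' q) powr (real_vec t $ q)) * of_real (c' k powr y)" for y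
  proof -
    have "complex_of_real (c' q) powr (real_vec (t(k := t k + y)) $ q) =
        of_real (c' q) powr (real_vec t $ q) * (if q = k then of_real (c' k powr y) else 1)" for q
      using c'_pos[of k] by (auto simp: real_vec_def powr_add less_imp_le powr_of_real)
    then show ?thesis by (simp add: prod.distrib)
  qed
  have pw: "step_asymptotics k n powr x = c' k powr x *
      (\<Prod>i\<in>{1..l}. \<Prod>j | z i j \<noteq> 0. ((real (\<mu> i k * n) ^ \<mu> i k) powr x) powi z i j)" if n: "n > 0" for n
  proof -
    have pos: "real (m * n) ^ m > 0" for m using n by (cases "m = 0") auto
    have "((real (m * n) ^ m) powi q) powr x = ((real (m * n) ^ m) powr x) powi q" for m q
      using pos[of m] by (simp add: powr_real_of_int'[symmetric] powr_powr mult.commute del: of_nat_mult)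
    moreover have "step_asymptotics k n powr x = c' k powr x *
        (\<Prod>i\<in>{1..l}. \<Prod>j | z i j \<noteq> 0. ((real (\<mu> i k * n) ^ \<mu> i k) powi z i j) powr x)"
      unfolding step_asymptotics_def
      using c'_pos[of k] pos
      by (subst powr_mult) (auto simp: prod_powr_distrib less_imp_le prod_nonneg)
    ultimately show ?thesis by simp
  qed
  have "\<forall>\<^sub>F n in sequentially. (\<Prod>i\<in>{1..l}. \<Prod>j | z i j \<noteq> 0. ?R i j n powi z i j) =
     gamma_product (real_vec (t(k := t k + (real n + x)))) /
     (gamma_product (real_vec (t(k := t k + real n))) * of_real (step_asymptotics k n powr x))"
    using eventually_gt_at_top[of 0]
  proof eventually_elim
    case (elim n)
    let ?C = "\<Prod>q\<in>UNIV. complex_of_real (c' q) powr (real_vec t $ q)"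
    have C: "?C \<noteq> 0" using c'_pos by (simp add: less_imp_neq[symmetric])
    have ck: "c' k powr x \<noteq> 0" "c' k powr (real n) \<noteq> 0" "c' k powr (real n + x) = c' k powr (real n) * c' k powr x"
      using c'_pos[of k] by (auto simp: powr_add)
    show ?case
      unfolding gamma_product_def cpow gamma_arg_shift pw[OF elim] power_int_divide_distrib power_int_mult_distrib
        prod_dividef prod.distrib
      using C ck by (simp add: of_real_prod of_real_power_int field_simps)
  qed
  with lim show ?thesis by (auto intro: Lim_transform_eventually)
qed

lemma Gamma_shift_powi:
  assumes "Re w > 0"
  shows "Gamma (w + of_nat m) powi q = (\<Prod>\<nu><m. (w + of_nat \<nu>) powi q) * Gamma w powi q"
proof -
  have w: "w \<notin> \<int>\<^sub>\<le>\<^sub>0" using assms by (auto elim!: nonpos_Ints_cases)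
  have "Gamma (w + of_nat m) = (\<Prod>\<nu><m. w + of_nat \<nu>) * Gamma w"
    using pochhammer_Gamma[OF w, of m] w
    by (simp add: pochhammer_prod Gamma_eq_zero_iff field_simps atLeast0LessThan)
  moreover have "(\<Prod>\<nu><m. w + of_nat \<nu>) powi q = (\<Prod>\<nu><m. (w + of_nat \<nu>) powi q)"
    by (induction m) (auto simp: power_int_mult_distrib)
  ultimately show ?thesis by (simp add: power_int_mult_distrib)
qed

text \<open>
  The right-hand factor is the b-function for the unit vector in direction \<open>k\<close>, divided by \<open>(2\<pi>)^(d k)\<close>. So the
  Gamma product satisfies the functional equation of the zeta integral.
\<close>

lemma gamma_product_step:
  assumes t: "\<And>i j. i \<in> {1..l} \<Longrightarrow> z i j \<noteq> 0 \<Longrightarrow> Re (gamma_arg i j (real_vec t)) > 1"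
  shows "gamma_product (real_vec (t(k := t k + 1))) = of_real (c' k) *
    (\<Prod>i\<in>{1..l}. \<Prod>j | z i j \<noteq> 0. \<Prod>\<nu><\<mu> i k. (gamma_arg i j (real_vec t) + of_nat \<nu>) powi z i j) * gamma_product (real_vec t)"
proof -
  have "complex_of_real (c' q) powr (real_vec (t(k := t k + 1)) $ q) =
        (if q = k then of_real (c' k) else 1) * of_real (c' q) powr (real_vec t $ q)" for q
    using c'_pos[of k] by (auto simp: real_vec_def powr_add)
  then have 1: "(\<Prod>q\<in>UNIV. complex_of_real (c' q) powr (real_vec (t(k := t k + 1)) $ q)) =
      of_real (c' k) * (\<Prod>q\<in>UNIV. of_real (c' q) powr (real_vec t $ q))"
    by (simp add: prod.distrib)
  have "Gamma (gamma_arg i j (real_vec (t(k := t k + 1)))) powi z i j =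
      (\<Prod>\<nu><\<mu> i k. (gamma_arg i j (real_vec t) + of_nat \<nu>) powi z i j) * Gamma (gamma_arg i j (real_vec t)) powi z i j"
    if "i \<in> {1..l}" "z i j \<noteq> 0" for i j
    unfolding gamma_arg_shift using t[OF that] by (simp add: Gamma_shift_powi)
  then have 2: "(\<Prod>i\<in>{1..l}. \<Prod>j | z i j \<noteq> 0. Gamma (gamma_arg i j (real_vec (t(k := t k + 1)))) powi z i j) =
     (\<Prod>i\<in>{1..l}. \<Prod>j | z i j \<noteq> 0. \<Prod>\<nu><\<mu> i k. (gamma_arg i j (real_vec t) + of_nat \<nu>) powi z i j) *
     (\<Prod>i\<in>{1..l}. \<Prod>j | z i j \<noteq> 0. Gamma (gamma_arg i j (real_vec t)) powi z i j)"
    unfolding prod.distrib[symmetric] by (intro prod.cong refl) auto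
  show ?thesis
    unfolding gamma_product_def[of "real_vec (t(k := t k + 1))"] gamma_product_def[of "real_vec t"] 1 2 by (simp add: mult_ac)
qed

lemma gamma_product_nonzero:
  assumes t: "\<And>i j. i \<in> {1..l} \<Longrightarrow> z i j \<noteq> 0 \<Longrightarrow> Re (gamma_arg i j (real_vec t)) > 1"
  shows "gamma_product (real_vec t) \<noteq> 0"
proof -
  have "gamma_arg i j (real_vec t) \<notin> \<int>\<^sub>\<le>\<^sub>0" if "i \<in> {1..l}" "z i j \<noteq> 0" for i j
    using t[OF that] by (auto elim!: nonpos_Ints_cases)
  then show ?thesis
    using c'_pos finite_support
    by (auto simp: gamma_product_def Gamma_eq_zero_iff less_imp_neq[symmetric])
qed

text \<open>
  On the diagonal, \<open>gamma_arg i j\<close> is \<open>\<tau> * w i + \<alpha> i + j\<close> with \<open>w i > 0\<close>. Let \<open>J i\<close> be the smallest index in the support of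
  \<open>z i\<close>. As \<open>\<tau>\<close> decreases from infinity, the first time that some \<open>gamma_arg i (J i)\<close> reaches zero is the
  maximum \<open>\<tau>\<close> of the numbers \<open>T i\<close> below. At this time the arguments for \<open>j > J i\<close> are non-real or positive, for
  every \<open>i\<close>, and negative exponents occur only there.
\<close>

lemma first_pole_on_diagonal:
  assumes "i0 \<in> {1..l}" "z i0 j0 \<noteq> 0" "\<alpha> i0 + of_int j0 \<in> \<int>\<^sub>\<le>\<^sub>0"
  obtains \<tau> where "\<tau> \<ge> 0" "denom (real_vec (\<lambda>_. \<tau>)) = 0" "numer (real_vec (\<lambda>_. \<tau>)) \<noteq> 0"
proof -
  define J where "J i = Min {j. z i j \<noteq> 0}" for i
  define w where "w i = (\<Sum>k\<in>UNIV. real (\<mu> i k))" for i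
  have J: "J i \<le> j" if "i \<in> {1..l}" "z i j \<noteq> 0" for i j
    unfolding J_def using finite_support[OF that(1)] that(2) by (intro Min_le) auto
  have w: "w i > 0" if i: "i \<in> {1..l}" for i
  proof -
    obtain k where "\<mu> i k \<noteq> 0" using \<mu>_nonzero[OF i] by blast
    then show ?thesis unfolding w_def by (intro sum_pos2[of _ k]) auto
  qed
  have gamma_arg: "gamma_arg i j (real_vec (\<lambda>_. \<tau>)) = of_real (\<tau> * w i) + (\<alpha> i + of_int (J i)) + of_int (j - J i)" for i j \<tau>
    by (simp add: gamma_arg_def lin_form_def real_vec_def w_def sum_distrib_left mult.commute)
  define Bad where "Bad = {i\<in>{1..l}. Im (\<alpha> i) = 0 \<and> Re (\<alpha> i) + of_int (J i) \<le> 0}"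
  define T where "T i = - (Re (\<alpha> i) + of_int (J i)) / w i" for i
  have "i0 \<in> Bad"
  proof -
    obtain n where n: "\<alpha> i0 + of_int j0 = of_int n" "n \<le> 0" using assms(3) by (elim nonpos_Ints_cases)
    have "Im (\<alpha> i0) = 0" using arg_cong[OF n(1), of Im] by simp
    moreover have "Re (\<alpha> i0) + of_int j0 \<le> 0" using arg_cong[OF n(1), of Re] n(2) by simp
    moreover have "real_of_int (J i0) \<le> of_int j0" using J[OF assms(1,2)] by simp
    ultimately show ?thesis using assms(1) by (auto simp: Bad_def)
  qed
  then have Bad: "finite Bad" "Bad \<noteq> {}" by (auto simp: Bad_def)
  define \<tau> where "\<tau> = Max (T ` Bad)"
  have T_le: "T i \<le> \<tau>" if "i \<in> Bad" for i using Bad that by (auto simp: \<tau>_def)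
  obtain i where i: "i \<in> Bad" "\<tau> = T i"
  proof -
    have "\<tau> \<in> T ` Bad" unfolding \<tau>_def using Bad by (intro Max_in) auto
    then show ?thesis using that by blast
  qed
  have il: "i \<in> {1..l}" using i by (simp add: Bad_def)
  have \<tau>0: "\<tau> \<ge> 0" using i w[OF il] by (auto simp: T_def Bad_def intro!: divide_nonneg_pos)
  have "gamma_arg i (J i) (real_vec (\<lambda>_. \<tau>)) = 0"
    unfolding gamma_arg using i w[OF il] by (simp add: complex_eq_iff T_def Bad_def)
  then have "denom (real_vec (\<lambda>_. \<tau>)) = 0"
    unfolding denom_eq_0_iff using il z_Min[OF il] by (auto simp: J_def intro!: bexI[of _ i] exI[of _ "Min {j. z i j \<noteq> 0}"])
  moreover have "numer (real_vec (\<lambda>_. \<tau>)) \<noteq> 0"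
    unfolding numer_eq_0_iff
  proof safe
    fix i j assume i: "i \<in> {1..l}" and j: "z i j < 0" and a: "gamma_arg i j (real_vec (\<lambda>_. \<tau>)) \<in> \<int>\<^sub>\<le>\<^sub>0"
    have "J i \<noteq> j" using z_Min[OF i] j by (auto simp: J_def)
    with J[OF i, of j] j have "J i < j" by simp
    then have j1: "of_int (j - J i) > (0::real)" by simp
    obtain n where n: "gamma_arg i j (real_vec (\<lambda>_. \<tau>)) = of_int n" "n \<le> 0" using a by (elim nonpos_Ints_cases)
    have im: "Im (\<alpha> i) = 0" using arg_cong[OF n(1), of Im] by (simp add: gamma_arg)
    have re: "\<tau> * w i + (Re (\<alpha> i) + of_int (J i)) + of_int (j - J i) \<le> 0"
      using arg_cong[OF n(1), of Re] n(2) by (simp add: gamma_arg)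
    have "\<tau> * w i + (Re (\<alpha> i) + of_int (J i)) \<ge> 0"
    proof (cases "i \<in> Bad")
      case True
      then show ?thesis using T_le[OF True] w[OF i] by (simp add: T_def field_simps)
    next
      case False
      then have "Re (\<alpha> i) + of_int (J i) > 0" using i im by (simp add: Bad_def)
      moreover have "\<tau> * w i \<ge> 0" using \<tau>0 w[OF i] by simp
      ultimately show ?thesis by linarith
    qed
    with re j1 show False by linarith
  qed
  ultimately show thesis using \<tau>0 that by blast
qed

end

section \<open>The meromorphic continuation\<close>

text \<open>
  Along one coordinate the quotient is constant on intervals of length one by \<open>log_convex_solution_unique\<close>,
  hence constant; any two points are joined by changing one coordinate at a time.
\<close>

lemma (in gamma_data) log_convex_eq_gamma_product:
  fixes Z :: "('r \<Rightarrow> real) \<Rightarrow> real"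
  assumes N: "N \<ge> 0" "\<And>t i j. (\<And>k. t k > N) \<Longrightarrow> i \<in> {1..l} \<Longrightarrow> z i j \<noteq> 0 \<Longrightarrow> Re (gamma_arg i j (real_vec t)) > 1"
    and pos: "\<And>t. (\<And>k. t k > 0) \<Longrightarrow> Z t > 0"
    and conv: "\<And>a b \<theta>. (\<And>k. a k > 0) \<Longrightarrow> (\<And>k. b k > 0) \<Longrightarrow> 0 \<le> \<theta> \<Longrightarrow> \<theta> \<le> 1 \<Longrightarrow>
      Z (\<lambda>k. (1 - \<theta>) * a k + \<theta> * b k) \<le> Z a powr (1 - \<theta>) * Z b powr \<theta>"
    and step: "\<And>t k. (\<And>k. t k > N) \<Longrightarrow>
      of_real (Z (t(k := t k + 1))) / gamma_product (real_vec (t(k := t k + 1))) = of_real (Z t) / gamma_product (real_vec t)"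
    and t: "\<And>k. t k > N" "\<And>k. t' k > N"
  shows "of_real (Z t) / gamma_product (real_vec t) = of_real (Z t') / gamma_product (real_vec t')"
proof -
  define F where "F t = of_real (Z t) / gamma_product (real_vec t)" for t
  have F1: "F (t(k := t k + x)) = F t" if t: "\<And>k. t k > N" and x: "0 \<le> x" "x \<le> 1" for t k x
  proof -
    have big: "(t(k := t k + y)) q > N" if "y \<ge> 0" for y q
      using t[of q] that by auto
    have big0: "(t(k := t k + y)) q > 0" if "y \<ge> 0" for y q
      using big[OF that, of q] N(1) by linarith
    have "of_real (Z (t(k := t k + x))) / gamma_product (real_vec (t(k := t k + x))) =
        of_real (Z (t(k := t k + 0))) / gamma_product (real_vec (t(k := t k + 0)))"
    proof (rule log_convex_solution_unique[where a = "step_asymptotics k"])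
      show "Z (t(k := t k + y)) > 0" if "y \<ge> 0" for y
        by (intro pos big0 that)
      show "Z (t(k := t k + ((1 - \<theta>) * u + \<theta> * v))) \<le> Z (t(k := t k + u)) powr (1 - \<theta>) * Z (t(k := t k + v)) powr \<theta>"
        if "u \<ge> 0" "v \<ge> 0" "0 \<le> \<theta>" "\<theta> \<le> 1" for u v \<theta>
      proof -
        have "t(k := t k + ((1 - \<theta>) * u + \<theta> * v)) = (\<lambda>q. (1 - \<theta>) * (t(k := t k + u)) q + \<theta> * (t(k := t k + v)) q)"
          by (auto simp: fun_eq_iff algebra_simps)
        then show ?thesis using that by (simp only:) (intro conv big0)
      qed
      show "gamma_product (real_vec (t(k := t k + y))) \<noteq> 0" if "y \<ge> 0" for y
        by (intro gamma_product_nonzero N(2) big that)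
      show "of_real (Z (t(k := t k + (y + 1)))) / gamma_product (real_vec (t(k := t k + (y + 1)))) =
            of_real (Z (t(k := t k + y))) / gamma_product (real_vec (t(k := t k + y)))" if "y \<ge> 0" for y
        using step[of "t(k := t k + y)" k, OF big[OF that]] by (simp add: add.assoc)
      show "(\<lambda>n. gamma_product (real_vec (t(k := t k + (real n + y)))) /
          (gamma_product (real_vec (t(k := t k + real n))) * of_real (step_asymptotics k n powr y))) \<longlonglongrightarrow> 1"
        if "0 \<le> y" "y \<le> 1" for y
        using t that by (intro gamma_product_asymptotics N(2))
    qed (auto intro: step_asymptotics_pos step_asymptotics_ratio x)
    then show ?thesis by (simp add: F_def)
  qed
  have Fn: "\<forall>t x. (\<forall>k. t k > N) \<longrightarrow> 0 \<le> x \<longrightarrow> x \<le> real n \<longrightarrow> F (t(k := t k + x)) = F t" for n k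
  proof (induction n)
    case 0
    then show ?case by auto
  next
    case (Suc n)
    show ?case
    proof (intro allI impI)
      fix t :: "'r \<Rightarrow> real" and x :: real
      assume t: "\<forall>k. t k > N" and x: "0 \<le> x" "x \<le> real (Suc n)"
      show "F (t(k := t k + x)) = F t"
      proof (cases "x \<le> 1")
        case True
        then show ?thesis using F1 t x by blast
      next
        case False
        let ?t = "t(k := t k + 1)"
        have "F (?t(k := ?t k + (x - 1))) = F ?t"
        proof (rule Suc.IH[rule_format])
          show "N < ?t q" for q using t by (auto intro: less_trans[OF _ less_add_one])
        qed (use x False in auto)
        also have "F ?t = F t" using F1 t by simp
        finally show ?thesis by simp
      qed
    qed
  qed
  have F2: "F (t(k := y)) = F t" if t: "\<And>k. t k > N" and y: "y > N" for t k y
  proof -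
    have up: "F (t(k := y)) = F t" if t: "\<And>k. t k > N" and y: "y \<ge> t k" for t y
    proof -
      obtain n :: nat where "y - t k \<le> real n" using real_arch_simple by blast
      then show ?thesis using Fn[of n k] t y by (metis add_diff_cancel_left' diff_add_cancel diff_ge_0_iff_ge add.commute)
    qed
    show ?thesis
    proof (cases "y \<ge> t k")
      case True
      then show ?thesis using up t by blast
    next
      case False
      have "F ((t(k := y))(k := t k)) = F (t(k := y))"
        using t y False by (intro up) auto
      then show ?thesis by simp
    qed
  qed
  have "F (\<lambda>k. if k \<in> A then t' k else t k) = F t" if "finite A" for A
    using that
  proof induction
    case (insert q A)
    have "(\<lambda>k. if k \<in> insert q A then t' k else t k) = (\<lambda>k. if k \<in> A then t' k else t k)(q := t' q)"
      by (auto simp: fun_eq_iff)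
    then show ?case using insert F2[of "\<lambda>k. if k \<in> A then t' k else t k" "t' q" q] t by simp
  qed simp
  from this[of UNIV] show ?thesis by (simp add: F_def)
qed

text \<open>
  The zero sets of the \<open>P k\<close> lie in \<open>S\<close>, so no \<open>P k\<close> vanishes at a point of the open orbit.
\<close>

lemma basic_relative_invariants_nonvanishing:
  fixes P :: "'r::finite \<Rightarrow> 'n::finite cpoly"
  assumes "reductive_prehomogeneous G \<rho> S" "basic_relative_invariants G \<rho> S P"
  shows "AE x in lborel. \<forall>k. peval (P k) (($) (x :: complex^'n)) \<noteq> 0"
proof -
  obtain x0 where x0: "x0 \<notin> S"
    using assms(1) by (auto simp: reductive_prehomogeneous_def)
  have "zero_locus {P k} \<subseteq> S" for k
  proof -
    have "zero_locus {P k} \<in> {Y. irreducible_component S Y \<and> codimension Y = 1}"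
      using assms(2) unfolding basic_relative_invariants_def by (auto dest: bij_betwE)
    then show ?thesis by (simp add: irreducible_component_def)
  qed
  then have "peval (P k) (($) x0) \<noteq> 0" for k
    using x0 by (auto simp: zero_locus_def)
  moreover have "homogeneous_poly (P k)" for k
    using assms(2) by (simp add: basic_relative_invariants_def)
  ultimately have "AE x in lborel. peval (P k) (($) (x :: complex^'n)) \<noteq> 0" for k
    by (intro AE_peval_nonzero)
  then show ?thesis by (simp add: AE_finite_all[of UNIV, simplified])
qed

theorem theorem3p1:
  fixes G :: "(complex^'m::finite^'m) set"
    and \<rho> :: "complex^'m^'m \<Rightarrow> complex^'n::{finite,linorder}^'n::_"
    and S :: "(complex^'n::_) set"
    and P :: "'r::finite \<Rightarrow> 'n cpoly"
    and b :: "('r \<Rightarrow> nat) \<Rightarrow> 'r cpoly"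
    and c :: "'r \<Rightarrow> real" and l :: nat
    and \<mu> :: "nat \<Rightarrow> 'r \<Rightarrow> nat" and \<alpha> :: "nat \<Rightarrow> complex" and z :: "nat \<Rightarrow> int \<Rightarrow> int"
  assumes "reductive_prehomogeneous G \<rho> S"
    and "self_adjoint_image G \<rho>"
    and "basic_relative_invariants G \<rho> S P"
    and "b_functions P b"
    and "b_function_data b c l \<mu> \<alpha> z"
  shows "(\<forall>s. (\<forall>k. Re (s $ k) > 0) \<longrightarrow> integrable haarV (zeta_integrand P s)) \<and>
    holomorphic_sv_on (zeta_int P) {s. \<forall>k. Re (s $ k) > 0} \<and>
    (\<exists>Z. meromorphic_sv Z \<and>
       (\<forall>s. (\<forall>k. Re (s $ k) > 0) \<longrightarrow> Z s = zeta_int P s) \<and>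
       (\<forall>s. (\<forall>i\<in>{1..l}. \<forall>j. z i j > 0 \<longrightarrow> lin_form (\<mu> i) s + \<alpha> i + of_int j \<notin> \<int>\<^sub>\<le>\<^sub>0) \<longrightarrow>
          Z s = (\<Prod>k\<in>UNIV. of_real ((2 * pi) powi (- int (tdeg (P k))) * c k) powr (s $ k)) *
            (\<Prod>i\<in>{1..l}. \<Prod>j | z i j \<noteq> 0.
               (Gamma (lin_form (\<mu> i) s + \<alpha> i + of_int j) / Gamma (\<alpha> i + of_int j)) powi z i j)))"
proof -
  note data = assms(5)[unfolded b_function_data_def]
  have nz: "AE x in lborel. \<forall>k. peval (P k) (($) (x :: complex^'n::_)) \<noteq> 0"
    using assms(1,3) by (rule basic_relative_invariants_nonvanishing)
  have hom: "homogeneous_poly (P k)" for k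
    using assms(3) by (simp add: basic_relative_invariants_def)
  define c' where "c' k = (2 * pi) powi (- int (tdeg (P k))) * c k" for k
  interpret gamma_data c' l \<mu> \<alpha> z
  proof
    show "c' k > 0" for k
      using data by (simp add: c'_def zero_less_power_int)
    fix i assume i: "i \<in> {1..l}"
    show "\<exists>k. \<mu> i k \<noteq> 0" "finite {j. z i j \<noteq> 0}" "z i (Min {j. z i j \<noteq> 0}) > 0"
      using data i by blast+
    show "{j. z i j \<noteq> 0} \<noteq> {}"
    proof
      assume e: "{j. z i j \<noteq> 0} = {}"
      have "(\<Sum>j | z i j \<noteq> 0. z i j) > 0" using data i by blast
      then show False unfolding e by simp
    qed
  qed
  let ?D = "{s :: complex^'r. \<forall>k. Re (s $ k) > 0}"
  obtain N0 where N0: "N0 \<ge> 0" "\<And>t i j. (\<And>k. t k > N0) \<Longrightarrow> i \<in> {1..l} \<Longrightarrow> z i j \<noteq> 0 \<Longrightarrow> Re (gamma_arg i j (real_vec t)) > 1"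
    using Re_gamma_arg_large by metis
  define N where "N = max N0 (Max (range (\<lambda>k. real (tdeg (P k)))))"
  have N: "N \<ge> 0" "\<And>t i j. (\<And>k. t k > N) \<Longrightarrow> i \<in> {1..l} \<Longrightarrow> z i j \<noteq> 0 \<Longrightarrow> Re (gamma_arg i j (real_vec t)) > 1"
    using N0 by (auto simp: N_def)
  have N_deg: "real (tdeg (P k)) \<le> N" for k
    unfolding N_def by (intro max.coboundedI2 Max_ge) auto
  have step: "of_real (real_zeta P (t(k := t k + 1))) / gamma_product (real_vec (t(k := t k + 1))) =
      of_real (real_zeta P t) / gamma_product (real_vec t)" if t: "\<And>k. t k > N" for t k
  proof -
    define \<delta> :: "'r \<Rightarrow> nat" where "\<delta> = (\<lambda>q. if q = k then 1 else 0)"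
    have t0: "t q > 0" "t q > real (tdeg (P k))" for q
      using t[of q] N(1) N_deg[of k] by linarith+
    \<comment> \<open>\<open>\<delta>\<close> is the unit vector in direction \<open>k\<close>, as a shift of the exponents\<close>
    have fe: "of_real ((2 * pi) ^ tdeg (P k)) * of_real (real_zeta P (t(k := t k + 1))) =
        peval (b \<delta>) (\<lambda>k. of_real (t k)) * complex_of_real (real_zeta P t)"
      using gaussian_functional_equation[OF assms(4) hom nz t0] by (simp add: complex_real_zeta \<delta>_def)
    have lfn: "lin_form_nat (\<mu> i) \<delta> = \<mu> i k" for i
      by (simp add: lin_form_nat_def \<delta>_def if_distrib cong: if_cong)
    have argpos: "gamma_arg i j (real_vec t) + of_nat \<nu> \<noteq> 0" if "i \<in> {1..l}" "z i j \<noteq> 0" for i j \<nu>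
    proof
      assume "gamma_arg i j (real_vec t) + of_nat \<nu> = 0"
      from arg_cong[OF this, of Re] N(2)[of t i j] t that show False by simp
    qed
    have "peval (b \<delta>) (($) (real_vec t)) = (\<Prod>q\<in>UNIV. of_real (c q) ^ \<delta> q) *
        (\<Prod>i\<in>{1..l}. \<Prod>j | z i j \<noteq> 0. \<Prod>\<nu><lin_form_nat (\<mu> i) \<delta>.
             (lin_form (\<mu> i) (real_vec t) + \<alpha> i + of_int j + of_nat \<nu>) powi z i j)"
      using data argpos by (auto simp: gamma_arg_def \<delta>_def)
    also have "(\<Prod>q\<in>UNIV. complex_of_real (c q) ^ \<delta> q) = of_real (c k)"
    proof -
      have "(\<Prod>q\<in>UNIV. complex_of_real (c q) ^ \<delta> q) = (\<Prod>q\<in>UNIV. if q = k then of_real (c k) else 1)"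
        by (intro prod.cong) (auto simp: \<delta>_def)
      then show ?thesis by simp
    qed
    also have "($) (real_vec t) = (\<lambda>k. complex_of_real (t k))" by (simp add: real_vec_def fun_eq_iff)
    finally have bval: "peval (b \<delta>) (\<lambda>k. of_real (t k)) = of_real (c k) *
        (\<Prod>i\<in>{1..l}. \<Prod>j | z i j \<noteq> 0. \<Prod>\<nu><\<mu> i k. (gamma_arg i j (real_vec t) + of_nat \<nu>) powi z i j)"
      by (simp add: lfn gamma_arg_def)
    have ck: "of_real (c k) = of_real ((2 * pi) ^ tdeg (P k)) * (of_real (c' k) :: complex)"
    proof -
      have inv: "x * (inverse x * c k) = c k" if "x \<noteq> 0" for x :: real
        using that by simp
      have "c k = (2 * pi) ^ tdeg (P k) * c' k"
        unfolding c'_def power_int_minus power_int_of_nat by (rule inv[symmetric]) simp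
      then show ?thesis by (simp only: of_real_mult)
    qed
    let ?B = "\<Prod>i\<in>{1..l}. \<Prod>j | z i j \<noteq> 0. \<Prod>\<nu><\<mu> i k. (gamma_arg i j (real_vec t) + of_nat \<nu>) powi z i j"
    have Z: "of_real (real_zeta P (t(k := t k + 1))) = of_real (c' k) * ?B * complex_of_real (real_zeta P t)"
      using fe unfolding bval ck by simp
    have g: "gamma_product (real_vec (t(k := t k + 1))) = of_real (c' k) * ?B * gamma_product (real_vec t)"
      by (intro gamma_product_step N(2) t)
    have "gamma_product (real_vec (t(k := t k + 1))) \<noteq> 0"
    proof (intro gamma_product_nonzero N(2))
      show "(t(k := t k + 1)) q > N" for q using t[of q] by auto
    qed
    then show ?thesis unfolding Z g by simp
  qed
  define K where "K = of_real (real_zeta P (\<lambda>_. N + 1)) / gamma_product (real_vec (\<lambda>_. N + 1)) / of_real (gauss_mass TYPE('n))"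
  have "(\<lambda>_. N + 1) k > N" for k :: 'r by simp
  have K0: "K \<noteq> 0"
  proof -
    have "real_zeta P (\<lambda>_. N + 1) > 0" using N(1) by (intro real_zeta_pos nz) simp
    moreover have "gamma_product (real_vec (\<lambda>_. N + 1)) \<noteq> 0" by (intro gamma_product_nonzero N(2)) simp
    ultimately show ?thesis using gauss_mass_pos[where 'n = 'n] by (simp add: K_def)
  qed
  have real_formula: "zeta_int P (real_vec t) = K * gamma_product (real_vec t)" if t: "\<And>k. t k > N" for t
  proof -
    have t0: "t k > 0" for k using t[of k] N(1) by linarith
    have "of_real (real_zeta P t) / gamma_product (real_vec t) =
        of_real (real_zeta P (\<lambda>_. N + 1)) / gamma_product (real_vec (\<lambda>_. N + 1))"
    proof (rule log_convex_eq_gamma_product[where Z = "real_zeta P", OF N])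
      fix a b :: "'r \<Rightarrow> real" and \<theta> :: real
      assume "\<And>k. a k > 0" "\<And>k. b k > 0" "0 \<le> \<theta>" "\<theta> \<le> 1"
      then show "real_zeta P (\<lambda>k. (1 - \<theta>) * a k + \<theta> * b k) \<le> real_zeta P a powr (1 - \<theta>) * real_zeta P b powr \<theta>"
        by (rule real_zeta_log_convex[OF nz])
    next
      fix a :: "'r \<Rightarrow> real" assume "\<And>k. a k > 0"
      then show "real_zeta P a > 0" by (rule real_zeta_pos[OF nz])
    next
      fix a :: "'r \<Rightarrow> real" and k assume "\<And>k. a k > N"
      then show "of_real (real_zeta P (a(k := a k + 1))) / gamma_product (real_vec (a(k := a k + 1))) =
        of_real (real_zeta P a) / gamma_product (real_vec a)" by (rule step)
    qed (use t in auto)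
    moreover have "gamma_product (real_vec t) \<noteq> 0" by (intro gamma_product_nonzero N(2) t)
    ultimately show ?thesis
      using zeta_int_real[OF t0, of P] by (simp add: K_def real_vec_def field_simps)
  qed
  have hol: "holomorphic_sv_on (zeta_int P) ?D" by (rule holomorphic_zeta_int[OF nz])
  have identity: "zeta_int P s * denom s = K * numer s" if s: "\<And>k. Re (s $ k) > 0" for s
  proof -
    have "zeta_int P s * denom s - K * numer s = 0"
    proof (rule identity_theorem_orthant[OF _ N(1) _ s])
      show "holomorphic_sv_on (\<lambda>s. zeta_int P s * denom s - K * numer s) ?D"
        by (intro holomorphic_sv_on_diff holomorphic_sv_on_mult hol holomorphic_denom holomorphic_numer holomorphic_sv_on_const)
      fix t :: "'r \<Rightarrow> real" assume t: "\<And>k. t k > N"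
      have "denom (real_vec t) \<noteq> 0"
        unfolding denom_eq_0_iff
      proof safe
        fix i j assume "i \<in> {1..l}" "z i j > 0" and a: "gamma_arg i j (real_vec t) \<in> \<int>\<^sub>\<le>\<^sub>0"
        then have "Re (gamma_arg i j (real_vec t)) > 1" by (intro N(2) t) auto
        with a show False by (auto elim!: nonpos_Ints_cases)
      qed
      then show "zeta_int P (\<chi> k. of_real (t k)) * denom (\<chi> k. of_real (t k)) - K * numer (\<chi> k. of_real (t k)) = 0"
        using gamma_product_times_denom[of "real_vec t"] real_formula[OF t] by (simp add: real_vec_def)
    qed
    then show ?thesis by simp
  qed
  have lim0: "(\<lambda>n. zeta_int P (real_vec (\<lambda>_. inverse (real (Suc n))))) \<longlonglongrightarrow> 1"
  proof -
    have "(\<lambda>n. complex_of_real (real_zeta P (\<lambda>_. inverse (real (Suc n))) / gauss_mass TYPE('n)))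
        \<longlonglongrightarrow> of_real (gauss_mass TYPE('n) / gauss_mass TYPE('n))"
      using gauss_mass_pos[where 'n = 'n]
      by (intro tendsto_of_real tendsto_divide real_zeta_tendsto_at_0 nz tendsto_const) simp
    moreover have "zeta_int P (real_vec (\<lambda>_. inverse (real (Suc n)))) =
        complex_of_real (real_zeta P (\<lambda>_. inverse (real (Suc n))) / gauss_mass TYPE('n))" for n
      unfolding real_vec_def by (rule zeta_int_real) simp
    ultimately show ?thesis using gauss_mass_pos[where 'n = 'n] by simp
  qed
  have at_0: "denom (real_vec (\<lambda>_. 0)) = K * numer (real_vec (\<lambda>_. 0))"
  proof -
    let ?v = "\<lambda>n. real_vec (\<lambda>_. inverse (real (Suc n)))"
    have v: "?v \<longlonglongrightarrow> real_vec (\<lambda>_. 0)"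
    proof (rule vec_tendstoI)
      show "(\<lambda>n. ?v n $ k) \<longlonglongrightarrow> real_vec (\<lambda>_. 0) $ k" for k
        using tendsto_of_real[OF LIMSEQ_inverse_real_of_nat, where 'a = complex] by (simp add: real_vec_def)
    qed
    have "(\<lambda>n. denom (?v n)) \<longlonglongrightarrow> denom (real_vec (\<lambda>_. 0))"
      by (rule isCont_tendsto_compose[OF continuous_holomorphic_sv[OF holomorphic_denom[of UNIV]] v]) simp
    from tendsto_mult[OF lim0 this]
    have "(\<lambda>n. K * numer (?v n)) \<longlonglongrightarrow> denom (real_vec (\<lambda>_. 0))"
      by (simp add: identity real_vec_def)
    moreover have "(\<lambda>n. K * numer (?v n)) \<longlonglongrightarrow> K * numer (real_vec (\<lambda>_. 0))"
      by (intro tendsto_mult tendsto_const isCont_tendsto_compose[OF continuous_holomorphic_sv[OF holomorphic_numer[of UNIV]] v]) simp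
    ultimately show ?thesis by (rule LIMSEQ_unique)
  qed
  \<comment> \<open>a first pole at \<open>\<tau> > 0\<close> would contradict \<open>identity\<close> there, one at \<open>\<tau> = 0\<close> would contradict its limit \<open>at_0\<close>\<close>
  have regular: "\<alpha> i + of_int j \<notin> \<int>\<^sub>\<le>\<^sub>0" if i: "i \<in> {1..l}" and j: "z i j \<noteq> 0" for i j
  proof
    assume "\<alpha> i + of_int j \<in> \<int>\<^sub>\<le>\<^sub>0"
    then obtain \<tau> where \<tau>: "\<tau> \<ge> 0" "denom (real_vec (\<lambda>_. \<tau>)) = 0" "numer (real_vec (\<lambda>_. \<tau>)) \<noteq> 0"
      using first_pole_on_diagonal[OF i j] by metis
    show False
    proof (cases "\<tau> = 0")
      case True
      then show False using at_0 \<tau> K0 by simp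
    next
      case False
      then show False using identity[of "real_vec (\<lambda>_. \<tau>)"] \<tau> K0 by (simp add: real_vec_def)
    qed
  qed
  have arg0: "gamma_arg i j (real_vec (\<lambda>_. 0)) = \<alpha> i + of_int j" for i j
    by (simp add: gamma_arg_def lin_form_def real_vec_def)
  have K: "K * (\<Prod>i\<in>{1..l}. \<Prod>j | z i j \<noteq> 0. Gamma (\<alpha> i + of_int j) powi z i j) = 1"
  proof -
    have d: "denom (real_vec (\<lambda>_. 0)) \<noteq> 0" unfolding denom_eq_0_iff arg0 using regular by force
    have "gamma_product (real_vec (\<lambda>_. 0)) = (\<Prod>i\<in>{1..l}. \<Prod>j | z i j \<noteq> 0. Gamma (\<alpha> i + of_int j) powi z i j)"
    proof -
      have "real_vec (\<lambda>_. 0) $ k = 0" for k by (simp add: real_vec_def)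
      then show ?thesis using c'_pos by (simp add: gamma_product_def arg0 less_imp_neq[symmetric])
    qed
    moreover have "K * gamma_product (real_vec (\<lambda>_. 0)) * denom (real_vec (\<lambda>_. 0)) = 1 * denom (real_vec (\<lambda>_. 0))"
      using gamma_product_times_denom[OF d] at_0 by (simp add: mult.assoc)
    ultimately show ?thesis using d by simp
  qed
  \<comment> \<open>where \<open>denom\<close> vanishes the quotient has no meaning, but the zeta integral may still converge (removable singularities); its values are used wherever it converges\<close>
  define Z where "Z s = (if s \<in> ?D then zeta_int P s else K * numer s / denom s)" for s
  have Z_eq: "Z s = K * numer s / denom s" if "denom s \<noteq> 0" for s
    using identity[of s] that by (auto simp: Z_def field_simps)
  have "meromorphic_sv Z"
    unfolding meromorphic_sv_def
  proof (rule allI, rule exI[of _ UNIV], rule exI[of _ "\<lambda>s. K * numer s"], rule exI[of _ denom],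
      intro conjI ballI impI)
    show "holomorphic_sv_on (\<lambda>s. K * numer s) UNIV"
      by (intro holomorphic_sv_on_mult holomorphic_sv_on_const holomorphic_numer)
    show "\<exists>w\<in>UNIV. denom w \<noteq> 0"
      by (intro bexI[of _ "real_vec (\<lambda>_. 0)"]) (use regular in \<open>auto simp: denom_eq_0_iff arg0\<close>)
  qed (auto simp: holomorphic_denom Z_eq)
  moreover have "Z s = zeta_int P s" if "\<forall>k. Re (s $ k) > 0" for s
    using that by (simp add: Z_def)
  moreover have "Z s = (\<Prod>k\<in>UNIV. of_real ((2 * pi) powi (- int (tdeg (P k))) * c k) powr (s $ k)) *
            (\<Prod>i\<in>{1..l}. \<Prod>j | z i j \<noteq> 0.
               (Gamma (lin_form (\<mu> i) s + \<alpha> i + of_int j) / Gamma (\<alpha> i + of_int j)) powi z i j)"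
    if s: "\<forall>i\<in>{1..l}. \<forall>j. z i j > 0 \<longrightarrow> lin_form (\<mu> i) s + \<alpha> i + of_int j \<notin> \<int>\<^sub>\<le>\<^sub>0" for s
  proof -
    have d: "denom s \<noteq> 0" using s by (auto simp: denom_eq_0_iff gamma_arg_def)
    define Q where "Q = (\<Prod>i\<in>{1..l}. \<Prod>j | z i j \<noteq> 0. Gamma (\<alpha> i + of_int j) powi z i j)"
    have KQ: "K * Q = 1" using K by (simp only: Q_def)
    then have Q: "Q \<noteq> 0" by auto
    have "Z s = K * gamma_product s"
      unfolding Z_eq[OF d] gamma_product_times_denom[OF d, symmetric] using d by simp
    also have "\<dots> = gamma_product s / Q"
      using KQ Q by (simp add: field_simps)
    also have "\<dots> = (\<Prod>k\<in>UNIV. of_real (c' k) powr (s $ k)) *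
            (\<Prod>i\<in>{1..l}. \<Prod>j | z i j \<noteq> 0. (Gamma (gamma_arg i j s) / Gamma (\<alpha> i + of_int j)) powi z i j)"
      by (simp add: gamma_product_def Q_def power_int_divide_distrib prod_dividef)
    finally show ?thesis by (simp only: c'_def gamma_arg_def)
  qed
  moreover have "integrable haarV (zeta_integrand P s)" if "\<forall>k. Re (s $ k) > 0" for s
    using that by (intro integrable_haarV integrable_zeta_integrand) blast
  ultimately show ?thesis using hol by blast
qed

end
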